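(* Let $(J^s)_{s\in(1/2,1)}$ be a family of kernels satisfying Hypotheses (H1) and (H2) below, with constant $\delta>0$ and limit kernel $J^1$. There is $\varepsilon_{\max}>0$ depending only on the dimension $d$ such that the following holds. Let $\varepsilon\in(0,\varepsilon_{\max}]$, $s\in(1/2,1)$, $k\in(0,1)$, $1\ge M>m>k$ and $\eta>2+\delta$. Let $u_0\in H^\eta\cap L^1_M$, let $u^s_\varepsilon$ be the solution of $$\partial_t u=\frac{1}{\varepsilon^{2s}}\big(J^s_\varepsilon*u-u\big)+\mathrm{div}(xu)$$ and $u^1_\varepsilon$ the solution of $$\partial_t u=\frac{1}{\varepsilon^{2}}\big(J^1_\varepsilon*u-u\big)+\mathrm{div}(xu),$$ both with initial datum $u_0$. Then there is a constant $C$ independent of $\varepsilon$ and $s$ such that for all $t>0$ $$\|u^s_\varepsilon(t)-u^1_\varepsilon(t)\|_{L^1_k}\le C(1-s)^\theta\big(1+\varepsilon^{\theta\delta}|\log\varepsilon|\big),\qquad\theta=\frac{m-k}{m+d/2}.$$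
   Context: Notation: $\langle x\rangle=(1+|x|^2)^{1/2}$; $\|f\|_{L^1_k}=\int\langle x\rangle^k|f|\,dx$; $H^\eta$ the $L^2$-Sobolev space. Fourier transform $\hat f(\xi)=\int e^{-ix\cdot\xi}f(x)\,dx$. $J_\varepsilon(x)=\varepsilon^{-d}J(x/\varepsilon)$ for any kernel $J$. Hypothesis (H1): $(J^s)_{s\in(1/2,1)}$ is a family of probability densities on $\mathbb{R}^d$ with $J^s\in L^1\cap L^p$ for some $p\in(1,\infty]$, such that (i) $\int\min\{1,|y|^2\}J^s(y)\,dy<\infty$; (ii) there exist $\delta>0$, $C_0>0$ independent of $s$ with $\hat J^s(\xi)=1-|\xi|^{2s}+R_s(\xi)$, $|R_s(\xi)|\le C_0|\xi|^{2s+\delta}$ for $|\xi|\le1$; (iii) there exist $C,R>0$ and $\Psi\in L^1_2$ with $\int x\Psi=0$, all independent of $s$, such that $J^s(x)\le C(1-s)|x|^{-d-2s}+\Psi(x)$ for $|x|\ge R$. Hypothesis (H2): there is a probability density $J^1$ with $\hat J^1(\xi)=1-|\xi|^2+R_1(\xi)$, $|R_1(\xi)|\le C_0|\xi|^{2+\delta}$ for $|\xi|\le1$, and a constant $\mathfrak C>0$ such that for all $s\in(1/2,1)$ and $\xi\in\mathbb{R}^d$: $\left|\frac{1-\hat J^s(\xi)}{|\xi|^{2s}}-\frac{1-\hat J^1(\xi)}{|\xi|^2}\right|\le\mathfrak C(1-s)|\xi|^\delta\max(1,|\log|\xi||)$. Solutions are mild solutions in $C([0,\infty);L^1_k)$ (Duhamel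 formula with the transport semigroup $T_tf(x)=e^{(d-\varepsilon^{-2s})t}f(e^tx)$). *)

theory Defs
  imports "HOL-Analysis.Analysis"
begin

definition jbr :: "'a::euclidean_space \<Rightarrow> real" where
  "jbr x = sqrt (1 + (norm x)\<^sup>2)"

definition L1w :: "real \<Rightarrow> ('a::euclidean_space \<Rightarrow> real) \<Rightarrow> bool" where
  "L1w k f \<longleftrightarrow> f \<in> borel_measurable lborel \<and>
     integrable lborel (\<lambda>x. jbr x powr k * \<bar>f x\<bar>)"

definition L1w_norm :: "real \<Rightarrow> ('a::euclidean_space \<Rightarrow> real) \<Rightarrow> real" where
  "L1w_norm k f = (\<integral>x. jbr x powr k * \<bar>f x\<bar> \<partial>lborel)"

definition fourier :: "('a::euclidean_space \<Rightarrow> real) \<Rightarrow> 'a \<Rightarrow> complex" where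
  "fourier f \<xi> = (\<integral>x. cis (- (x \<bullet> \<xi>)) * complex_of_real (f x) \<partial>lborel)"

text \<open>Sobolev space \<open>H^\<eta>\<close>, for functions that are also integrable (so that the
  Fourier transform is the classical one): \<open>f \<in> L^2\<close> and
  \<open>\<integral> (1+|\<xi>|^2)^\<eta> |\<hat>f(\<xi>)|^2 d\<xi> < \<infinity>\<close>.\<close>
definition sobolev_H :: "real \<Rightarrow> ('a::euclidean_space \<Rightarrow> real) \<Rightarrow> bool" where
  "sobolev_H \<eta> f \<longleftrightarrow> f \<in> borel_measurable lborel \<and>
     integrable lborel (\<lambda>x. (f x)\<^sup>2) \<and>
     (\<lambda>\<xi>. fourier f \<xi>) \<in> borel_measurable lborel \<and>
     integrable lborel (\<lambda>\<xi>. (1 + (norm \<xi>)\<^sup>2) powr \<eta> * (cmod (fourier f \<xi>))\<^sup>2)"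

definition prob_density :: "('a::euclidean_space \<Rightarrow> real) \<Rightarrow> bool" where
  "prob_density J \<longleftrightarrow> J \<in> borel_measurable lborel \<and> (\<forall>x. 0 \<le> J x) \<and>
     integrable lborel J \<and> (\<integral>x. J x \<partial>lborel) = 1"

definition in_some_Lp :: "('a::euclidean_space \<Rightarrow> real) \<Rightarrow> bool" where
  "in_some_Lp J \<longleftrightarrow>
     (\<exists>p>1. integrable lborel (\<lambda>x. \<bar>J x\<bar> powr p)) \<or>
     (\<exists>B. AE x in lborel. \<bar>J x\<bar> \<le> B)"

definition rescale :: "real \<Rightarrow> ('a::euclidean_space \<Rightarrow> real) \<Rightarrow> 'a \<Rightarrow> real" where
  "rescale \<epsilon> J x = \<epsilon> powr (- real DIM('a)) * J ((1/\<epsilon>) *\<^sub>R x)"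

definition conv :: "('a::euclidean_space \<Rightarrow> real) \<Rightarrow> ('a \<Rightarrow> real) \<Rightarrow> 'a \<Rightarrow> real" where
  "conv J u x = (\<integral>y. J (x - y) * u y \<partial>lborel)"

definition H1 :: "(real \<Rightarrow> 'a::euclidean_space \<Rightarrow> real) \<Rightarrow> real \<Rightarrow> real \<Rightarrow> bool" where
  "H1 J \<delta> C0 \<longleftrightarrow> 0 < \<delta> \<and> 0 < C0 \<and>
     (\<forall>s\<in>{1/2<..<1}. prob_density (J s) \<and> in_some_Lp (J s) \<and>
        integrable lborel (\<lambda>y. min 1 ((norm y)\<^sup>2) * J s y) \<and>
        (\<forall>\<xi>::'a. norm \<xi> \<le> 1 \<longrightarrow>
           cmod (fourier (J s) \<xi> - complex_of_real (1 - norm \<xi> powr (2 * s)))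
             \<le> C0 * norm \<xi> powr (2 * s + \<delta>))) \<and>
     (\<exists>C R (\<Psi>::'a \<Rightarrow> real). 0 < C \<and> 0 < R \<and> L1w 2 \<Psi> \<and>
        integrable lborel (\<lambda>x. \<Psi> x *\<^sub>R x) \<and> (\<integral>x. \<Psi> x *\<^sub>R x \<partial>lborel) = 0 \<and>
        (\<forall>s\<in>{1/2<..<1}. \<forall>x. R \<le> norm x \<longrightarrow>
           J s x \<le> C * (1 - s) * norm x powr (- real DIM('a) - 2 * s) + \<Psi> x))"

definition H2 :: "(real \<Rightarrow> 'a::euclidean_space \<Rightarrow> real) \<Rightarrow> ('a \<Rightarrow> real) \<Rightarrow> real \<Rightarrow> real \<Rightarrow> bool" where
  "H2 J J1 \<delta> C0 \<longleftrightarrow> prob_density J1 \<and>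
     (\<forall>\<xi>::'a. norm \<xi> \<le> 1 \<longrightarrow>
        cmod (fourier J1 \<xi> - complex_of_real (1 - (norm \<xi>)\<^sup>2)) \<le> C0 * norm \<xi> powr (2 + \<delta>)) \<and>
     (\<exists>\<CC>>0. \<forall>s\<in>{1/2<..<1}. \<forall>\<xi>::'a. \<xi> \<noteq> 0 \<longrightarrow>
        cmod ((1 - fourier (J s) \<xi>) / complex_of_real (norm \<xi> powr (2 * s))
              - (1 - fourier J1 \<xi>) / complex_of_real ((norm \<xi>)\<^sup>2))
        \<le> \<CC> * (1 - s) * norm \<xi> powr \<delta> * max 1 \<bar>ln (norm \<xi>)\<bar>)"

text \<open>Mild solution in \<open>C([0,\<infinity>); L^1_k)\<close> of
  \<open>\<partial>_t u = \<epsilon>^{-2\<sigma>} (J_\<epsilon> * u - u) + div(x u)\<close>, \<open>u(0) = u\<^sub>0\<close>,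
  via Duhamel's formula with the transport semigroup
  \<open>T_t f(x) = e^{(d - \<epsilon>^{-2\<sigma>}) t} f(e^t x)\<close>.\<close>
definition transport :: "real \<Rightarrow> real \<Rightarrow> real \<Rightarrow> ('a::euclidean_space \<Rightarrow> real) \<Rightarrow> 'a \<Rightarrow> real" where
  "transport \<epsilon> \<sigma> t f x =
     exp ((real DIM('a) - 1 / \<epsilon> powr (2 * \<sigma>)) * t) * f (exp t *\<^sub>R x)"

definition mild_solution ::
  "real \<Rightarrow> ('a::euclidean_space \<Rightarrow> real) \<Rightarrow> real \<Rightarrow> real \<Rightarrow> ('a \<Rightarrow> real)
     \<Rightarrow> (real \<Rightarrow> 'a \<Rightarrow> real) \<Rightarrow> bool" where
  "mild_solution k J \<epsilon> \<sigma> u0 u \<longleftrightarrow>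
     (\<lambda>(t, x). u t x) \<in> borel_measurable (lborel \<Otimes>\<^sub>M lborel) \<and>
     (\<forall>t\<ge>0. L1w k (u t)) \<and>
     (\<forall>t\<ge>0. ((\<lambda>\<tau>. L1w_norm k (\<lambda>x. u \<tau> x - u t x)) \<longlongrightarrow> 0) (at t within {0..})) \<and>
     (\<forall>t\<ge>0. AE x in lborel.
        u t x = transport \<epsilon> \<sigma> t u0 x +
          (\<integral>\<tau>\<in>{0..t}. transport \<epsilon> \<sigma> (t - \<tau>)
              (\<lambda>y. (1 / \<epsilon> powr (2 * \<sigma>)) * conv (rescale \<epsilon> J) (u \<tau>) y) x \<partial>lborel))"

end

theory Submission
  imports Defs "HOL-Probability.Sinc_Integral" "HOL-Probability.Characteristic_Functions"
begin

text \<open>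
  In Fourier variables both equations are solved along the rays \<open>\<tau> \<mapsto> e\<^sup>\<tau>\<xi>\<close>: the transform of
  \<open>u(t)\<close> at \<open>e\<^sup>t\<xi>\<close> is that of \<open>u\<^sub>0\<close> at \<open>\<xi>\<close> times \<open>e\<^sup>-\<^sup>B\<close>, where \<open>B\<close> integrates the symbol over the
  ray. By (H2) the two exponents differ by \<open>O(1-s)\<close> times a polynomial in the frequency. The real
  part of \<open>B\<close> yields decay of any prescribed order once \<open>\<epsilon>\<close> is small: at low frequencies by the
  expansion of the symbol, at high ones because the oscillations of \<open>1 - cos\<close> average out along a
  ray, up to a bounded loss in between. Since \<open>\<delta> \<le> 2\<close> automatically, an order depending only on the
  dimension suffices, so the difference of the solutions is \<open>O(1-s)\<close> in \<open>L\<^sup>2\<close> uniformly in time.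

  Moments are controlled by testing \<open>|u|\<close> with \<open>1 - cos(2\<^sup>-\<^sup>j x\<^sub>b)\<close>: a Gronwall argument along the same
  rays needs only the expansion of the symbol at the origin, and summing over \<open>j\<close> with weights
  \<open>2\<^sup>j\<^sup>m\<close> reproduces \<open>|x\<^sub>b|\<^sup>m\<close>. Interpolating between \<open>L\<^sup>2\<close> and \<open>L\<^sup>1\<^sub>m\<close> gives the rate. When \<open>s\<close> stays away
  from \<open>1\<close> the moment bound alone is enough.
\<close>

section \<open>Gaussians\<close>

text \<open>The order of decay required is N = 5 + d: the difference of the two exponents grows at
  most like the frequency to the power q = 2 + \<delta> + \<kappa> \<le> 5, and d further powers pay
  for integrability and for the Jacobian of the dilation by e^t. A kernel that is spread across
  hyperplanes dissipates at rate at least \<lambda>/8 with \<lambda> = \<epsilon>^(-2s), and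
  \<lambda> \<ge> 1/\<epsilon> since 2s > 1 and \<epsilon> \<le> 1; so \<epsilon> \<le> 1/(8N) makes
  the order N available. The window of intermediate frequencies, where neither the expansion nor the
  averaging applies, is crossed in a time independent of \<epsilon> and \<xi>, and therefore costs
  only a constant factor. The obstacle in the moment estimate is that solutions are known to lie
  only in L^1_k with k < m, so only bounded weights may be tested. This is why |x_b|^m enters
  through cosines, and summing the scales costs the passage from M to m. Every estimate starts from
  one weak Duhamel formula, which holds for signed solutions.\<close>

lemma nn_integral_lborel_affine:
  fixes t :: "'a::euclidean_space"
  assumes [measurable]: "f \<in> borel_measurable borel" and c: "c \<noteq> 0"
  shows "(\<integral>\<^sup>+x. f x \<partial>lborel) = ennreal (\<bar>c\<bar> ^ DIM('a)) * (\<integral>\<^sup>+x. f (t + c *\<^sub>R x) \<partial>lborel)"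
  by (subst lborel_affine[OF c, of t])
     (simp add: nn_integral_density nn_integral_distr nn_integral_cmult)

lemma integrable_lborel_affine:
  fixes t :: "'a::euclidean_space" and f :: "'a \<Rightarrow> 'b::{banach, second_countable_topology}"
  assumes f: "integrable lborel f" and c: "c \<noteq> 0"
  shows "integrable lborel (\<lambda>x. f (t + c *\<^sub>R x))"
proof -
  have [measurable]: "f \<in> borel_measurable borel"
    using f[THEN borel_measurable_integrable] by simp
  show ?thesis
    using f unfolding integrable_iff_bounded
    by (subst (asm) nn_integral_lborel_affine[OF _ c, of _ t])
       (auto simp: ennreal_mult_less_top c)
qed

lemma integral_lborel_affine:
  fixes t :: "'a::euclidean_space" and f :: "'a \<Rightarrow> 'b::{banach, second_countable_topology}"
  assumes [measurable]: "f \<in> borel_measurable borel" and c: "c \<noteq> 0"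
  shows "(LBINT x. f x) = (\<bar>c\<bar> ^ DIM('a)) *\<^sub>R (LBINT x. f (t + c *\<^sub>R x))"
  by (subst lborel_affine[OF c, of t])
     (simp add: integral_density integral_distr)

lemma integral_lborel_prod_Basis:
  fixes f :: "'a::euclidean_space \<Rightarrow> real \<Rightarrow> 'c::{real_normed_field,banach,second_countable_topology}"
  assumes f: "\<And>b. b \<in> Basis \<Longrightarrow> integrable lborel (f b)"
  shows integrable_lborel_prod_Basis: "integrable lborel (\<lambda>x::'a. \<Prod>b\<in>Basis. f b (x \<bullet> b))"
    and "(LBINT x. (\<Prod>b\<in>Basis. f b (x \<bullet> b))) = (\<Prod>b\<in>(Basis::'a set). \<integral>y. f b y \<partial>lborel)"
proof -
  interpret product_sigma_finite "\<lambda>_::'a. lborel :: real measure" ..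
  have [measurable]: "b \<in> Basis \<Longrightarrow> f b \<in> borel_measurable borel" for b
    using f[THEN borel_measurable_integrable] by simp
  have eq: "(\<Prod>b\<in>Basis. f b ((\<Sum>b\<in>Basis. g b *\<^sub>R b) \<bullet> b)) = (\<Prod>b\<in>Basis. f b (g b))" for g :: "'a \<Rightarrow> real"
    by (intro prod.cong) (auto simp: inner_sum_left_Basis)
  show "integrable lborel (\<lambda>x::'a. \<Prod>b\<in>Basis. f b (x \<bullet> b))"
    by (subst lborel_eq, subst integrable_distr_eq)
       (auto simp: eq intro!: product_integrable_prod f)
  show "(LBINT x. (\<Prod>b\<in>Basis. f b (x \<bullet> b))) = (\<Prod>b\<in>(Basis::'a set). \<integral>y. f b y \<partial>lborel)"
    by (subst lborel_eq, subst integral_distr)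
       (auto simp: eq intro!: product_integral_prod f)
qed

section \<open>Fourier transform of the Gaussian\<close>

lemma measurable_cis [measurable]: "cis \<in> borel_measurable borel"
  by (intro borel_measurable_continuous_onI continuous_intros)

lemma gaussian_1d:
  fixes t :: real
  shows "integrable lborel (\<lambda>x. cis (- (t * x)) * complex_of_real (exp (- (x\<^sup>2) / 2)))" (is ?I)
    and "(LBINT x. cis (- (t * x)) * complex_of_real (exp (- (x\<^sup>2) / 2)))
      = complex_of_real (sqrt (2 * pi) * exp (- (t\<^sup>2) / 2))" (is ?E)
proof -
  have i: "integrable lborel (\<lambda>x. std_normal_density x)"
    using integrable_normal_moment[of 1 0 0] by simp
  have e: "exp (- (x\<^sup>2) / 2) = sqrt (2 * pi) * std_normal_density x" for x
    by (simp add: std_normal_density_def)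
  have "integrable lborel (\<lambda>x::real. exp (- (x\<^sup>2) / 2))" unfolding e using i by simp
  then show ?I
    by (rule Bochner_Integration.integrable_bound) (auto simp: norm_mult)
  have "complex_of_real (exp (- (t\<^sup>2) / 2)) = char std_normal_distribution (- t)"
    by (simp only: char_std_normal_distribution power2_minus)
  also have "\<dots> = (LBINT x. std_normal_density x *\<^sub>R iexp (- t * x))"
    unfolding char_def by (subst integral_density) auto
  finally have "complex_of_real (sqrt (2 * pi) * exp (- (t\<^sup>2) / 2)) =
      complex_of_real (sqrt (2 * pi)) * (LBINT x. std_normal_density x *\<^sub>R iexp (- t * x))"
    by (simp only: of_real_mult)
  also have "\<dots> = (LBINT x. complex_of_real (sqrt (2 * pi)) * (std_normal_density x *\<^sub>R iexp (- t * x)))"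
    by (simp only: integral_mult_right_zero)
  also have "\<dots> = (LBINT x. cis (- (t * x)) * complex_of_real (exp (- (x\<^sup>2) / 2)))"
    by (intro Bochner_Integration.integral_cong refl)
       (simp only: e cis_conv_exp scaleR_conv_of_real of_real_mult of_real_minus mult_minus_left mult_minus_right mult.assoc mult.commute mult.left_commute)
  finally show ?E ..
qed

lemma norm_sq_Basis: "(norm (x::'a::euclidean_space))\<^sup>2 = (\<Sum>b\<in>Basis. (x \<bullet> b)\<^sup>2)"
  unfolding power2_norm_eq_inner by (subst euclidean_inner) (simp add: power2_eq_square)

lemma cis_sum: "finite A \<Longrightarrow> cis (\<Sum>i\<in>A. f i) = (\<Prod>i\<in>A. cis (f i))"
  by (induction A rule: finite_induct) (auto simp: cis_mult[symmetric])

lemma gaussian: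
  fixes x :: "'a::euclidean_space"
  shows "integrable lborel (\<lambda>\<xi>. cis (- (x \<bullet> \<xi>)) * complex_of_real (exp (- (norm \<xi>)\<^sup>2 / 2)))" (is ?I)
    and "(LBINT \<xi>. cis (- (x \<bullet> \<xi>)) * complex_of_real (exp (- (norm \<xi>)\<^sup>2 / 2)))
      = complex_of_real (sqrt (2 * pi) ^ DIM('a) * exp (- (norm x)\<^sup>2 / 2))" (is ?E)
proof -
  let ?f = "\<lambda>b y. cis (- ((x \<bullet> b) * y)) * complex_of_real (exp (- (y\<^sup>2) / 2))"
  have eq: "cis (- (x \<bullet> \<xi>)) * complex_of_real (exp (- (norm \<xi>)\<^sup>2 / 2)) = (\<Prod>b\<in>Basis. ?f b (\<xi> \<bullet> b))" for \<xi>
  proof -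
    have "- (norm \<xi>)\<^sup>2 / 2 = (\<Sum>b\<in>Basis. - (\<xi> \<bullet> b)\<^sup>2 / 2)" "- (x \<bullet> \<xi>) = (\<Sum>b\<in>Basis. - ((x \<bullet> b) * (\<xi> \<bullet> b)))"
      by (auto simp: norm_sq_Basis sum_negf sum_divide_distrib euclidean_inner[of x \<xi>])
    then show ?thesis
      by (simp only: exp_sum[OF finite_Basis] cis_sum[OF finite_Basis] prod.distrib of_real_prod)
  qed
  show ?I unfolding eq
    by (intro integrable_lborel_prod_Basis gaussian_1d)
  have "(LBINT \<xi>. cis (- (x \<bullet> \<xi>)) * complex_of_real (exp (- (norm \<xi>)\<^sup>2 / 2))) =
      (\<Prod>b\<in>(Basis::'a set). \<integral>y. ?f b y \<partial>lborel)"
    unfolding eq by (intro integral_lborel_prod_Basis gaussian_1d)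
  also have "\<dots> = (\<Prod>b\<in>(Basis::'a set). complex_of_real (sqrt (2 * pi) * exp (- ((x \<bullet> b)\<^sup>2) / 2)))"
    by (simp only: gaussian_1d(2))
  also have "\<dots> = complex_of_real (\<Prod>b\<in>(Basis::'a set). (sqrt (2 * pi) * exp (- ((x \<bullet> b)\<^sup>2) / 2)))"
    by (simp only: of_real_prod)
  also have "(\<Prod>b\<in>(Basis::'a set). (sqrt (2 * pi) * exp (- ((x \<bullet> b)\<^sup>2) / 2))) =
     (sqrt (2 * pi) ^ DIM('a) * exp (- (norm x)\<^sup>2 / 2))"
  proof -
    have "- (norm x)\<^sup>2 / 2 = (\<Sum>b\<in>Basis. - (x \<bullet> b)\<^sup>2 / 2)"
      by (auto simp: norm_sq_Basis sum_negf sum_divide_distrib)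
    then show ?thesis
      by (simp only: exp_sum[OF finite_Basis] prod.distrib prod_constant)
  qed
  finally show ?E .
qed

lemma gaussian_real:
  shows "integrable lborel (\<lambda>\<xi>::'a::euclidean_space. exp (- (norm \<xi>)\<^sup>2 / 2))"
    and "(LBINT \<xi>. exp (- (norm (\<xi>::'a))\<^sup>2 / 2)) = sqrt (2 * pi) ^ DIM('a)"
proof -
  have 1: "integrable lborel (\<lambda>\<xi>. complex_of_real (exp (- (norm (\<xi>::'a))\<^sup>2 / 2)))"
    using gaussian(1)[of 0] by simp
  then show 2: "integrable lborel (\<lambda>\<xi>::'a. exp (- (norm \<xi>)\<^sup>2 / 2))"
    using integrable_Re by fastforce
  have "complex_of_real (LBINT \<xi>. exp (- (norm (\<xi>::'a))\<^sup>2 / 2)) = complex_of_real (sqrt (2 * pi) ^ DIM('a))"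
    using gaussian(2)[of "0::'a"] by (simp add: integral_complex_of_real del: of_real_exp of_real_power)
  then show "(LBINT \<xi>. exp (- (norm (\<xi>::'a))\<^sup>2 / 2)) = sqrt (2 * pi) ^ DIM('a)"
    by (simp only: of_real_eq_iff)
qed

section \<open>The Fourier transform and a Plancherel inequality\<close>

lemma integrable_pair_bound:
  fixes h :: "'a::euclidean_space \<times> 'b::euclidean_space \<Rightarrow> 'c::{banach, second_countable_topology}"
  assumes f: "integrable lborel (f :: 'a \<Rightarrow> real)" and g: "integrable lborel (g :: 'b \<Rightarrow> real)"
    and h: "h \<in> borel_measurable (lborel \<Otimes>\<^sub>M lborel)"
    and le: "\<And>x y. norm (h (x, y)) \<le> \<bar>f x\<bar> * \<bar>g y\<bar>"
  shows "integrable (lborel \<Otimes>\<^sub>M lborel) h"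
proof -
  have [measurable]: "f \<in> borel_measurable borel" "g \<in> borel_measurable borel"
    using f g by (auto dest: borel_measurable_integrable)
  have "integrable (lborel \<Otimes>\<^sub>M lborel) (\<lambda>(x, y). f x * g y)"
    by (rule lborel_pair.Fubini_integrable) (use f g in \<open>auto simp: abs_mult\<close>)
  then show ?thesis
    by (rule Bochner_Integration.integrable_bound) (use h le in \<open>auto simp: abs_mult\<close>)
qed

lemma integrable_fourier_integrand:
  fixes f :: "'a::euclidean_space \<Rightarrow> real"
  assumes "integrable lborel f"
  shows "integrable lborel (\<lambda>x. cis (- (x \<bullet> \<xi>)) * complex_of_real (f x))"
proof -
  have [measurable]: "f \<in> borel_measurable borel"
    using assms by (auto dest: borel_measurable_integrable)
  show ?thesis
    by (rule Bochner_Integration.integrable_bound[OF assms]) (auto simp: norm_mult)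
qed

lemma norm_fourier_le:
  "cmod (fourier f \<xi>) \<le> (LBINT x. \<bar>f x\<bar>)"
  unfolding fourier_def by (rule order_trans[OF integral_norm_bound]) (simp add: norm_mult)

lemma continuous_on_fourier:
  fixes f :: "'a::euclidean_space \<Rightarrow> real"
  assumes f: "integrable lborel f"
  shows "continuous_on UNIV (fourier f)"
proof -
  have [measurable]: "f \<in> borel_measurable borel"
    using f by (auto dest: borel_measurable_integrable)
  show ?thesis
    unfolding continuous_on_sequentially comp_def
  proof safe
    fix X :: "nat \<Rightarrow> 'a" and a assume X: "X \<longlonglongrightarrow> a"
    show "(\<lambda>n. fourier f (X n)) \<longlonglongrightarrow> fourier f a" unfolding fourier_def
    proof (rule integral_dominated_convergence[where w="\<lambda>x. \<bar>f x\<bar>"])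
      have "isCont (\<lambda>\<xi>. cis (- (x \<bullet> \<xi>)) * complex_of_real (f x)) a" for x
        by (rule continuous_on_interior[of UNIV]) (auto intro!: continuous_intros)
      from isCont_tendsto_compose[OF this X]
      show "AE x in lborel. (\<lambda>n. cis (- (x \<bullet> X n)) * complex_of_real (f x)) \<longlonglongrightarrow> cis (- (x \<bullet> a)) * complex_of_real (f x)"
        by simp
    qed (use f in \<open>auto simp: norm_mult\<close>)
  qed
qed

lemma measurable_fourier:
  "integrable lborel f \<Longrightarrow> fourier f \<in> borel_measurable borel"
  by (intro borel_measurable_continuous_onI continuous_on_fourier)

abbreviation gauss :: "'a::euclidean_space \<Rightarrow> real" where
  "gauss z \<equiv> exp (- (norm z)\<^sup>2 / 2)"

lemma gauss_scaled:
  fixes x :: "'a::euclidean_space"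
  assumes s: "0 < \<sigma>"
  shows "integrable lborel (\<lambda>\<xi>::'a. gauss (\<sigma> *\<^sub>R \<xi>))"
    and "(LBINT \<xi>. complex_of_real (gauss (\<sigma> *\<^sub>R \<xi>)) * cis (- (x \<bullet> \<xi>)))
      = complex_of_real (sqrt (2 * pi) ^ DIM('a) * (inverse \<sigma> ^ DIM('a) * gauss (inverse \<sigma> *\<^sub>R x)))"
proof -
  show "integrable lborel (\<lambda>\<xi>::'a. gauss (\<sigma> *\<^sub>R \<xi>))"
    using integrable_lborel_affine[OF gaussian_real(1), of \<sigma> 0] s by simp
  have "(LBINT \<xi>. complex_of_real (gauss (\<sigma> *\<^sub>R \<xi>)) * cis (- (x \<bullet> \<xi>)))
     = (inverse \<sigma> ^ DIM('a)) *\<^sub>R (LBINT \<xi>. complex_of_real (gauss \<xi>) * cis (- ((inverse \<sigma> *\<^sub>R x) \<bullet> \<xi>)))"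
    using s by (subst integral_lborel_affine[where c="inverse \<sigma>" and t=0]) auto
  also have "(LBINT \<xi>. complex_of_real (gauss \<xi>) * cis (- ((inverse \<sigma> *\<^sub>R x) \<bullet> \<xi>))) =
      complex_of_real (sqrt (2 * pi) ^ DIM('a) * gauss (inverse \<sigma> *\<^sub>R x))"
    by (subst gaussian(2)[symmetric]) (simp only: mult.commute)
  finally show "(LBINT \<xi>. complex_of_real (gauss (\<sigma> *\<^sub>R \<xi>)) * cis (- (x \<bullet> \<xi>)))
      = complex_of_real (sqrt (2 * pi) ^ DIM('a) * (inverse \<sigma> ^ DIM('a) * gauss (inverse \<sigma> *\<^sub>R x)))"
    by (simp add: scaleR_conv_of_real del: of_real_exp)
qed

text \<open>Parseval's identity with a Gaussian weight. The weight makes the frequency integral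
  absolutely convergent for merely integrable functions, so Fubini applies, and its own transform
  becomes an average of \<open>g\<close> at scale \<sigma> on the space side. Letting \<sigma> tend
  to 0 recovers the unweighted identity.\<close>

lemma fourier_gauss:
  fixes f g :: "'a::euclidean_space \<Rightarrow> real"
  assumes f: "integrable lborel f" and g: "integrable lborel g" and s: "0 < \<sigma>"
  shows "(LBINT \<xi>. complex_of_real (gauss (\<sigma> *\<^sub>R \<xi>)) * (fourier f \<xi> * cnj (fourier g \<xi>)))
    = complex_of_real (sqrt (2 * pi) ^ DIM('a) * (LBINT x. f x * (LBINT z. g (x + \<sigma> *\<^sub>R z) * gauss z)))"
proof -
  have [measurable]: "f \<in> borel_measurable borel" "g \<in> borel_measurable borel"
    using f g by (auto dest: borel_measurable_integrable)
  note [measurable] = measurable_fourier[OF f] measurable_fourier[OF g]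
  define c where "c = sqrt (2 * pi) ^ DIM('a)"
  define B where "B = (LBINT x. \<bar>g x\<bar>)"
  have B: "cmod (fourier g \<xi>) \<le> \<bar>B\<bar>" for \<xi>
    using norm_fourier_le[of g \<xi>] unfolding B_def by linarith
  have cnj: "cnj (fourier g \<xi>) = (LBINT y. cis (y \<bullet> \<xi>) * complex_of_real (g y))" for \<xi>
    unfolding fourier_def by (subst Bochner_Integration.integral_cnj[symmetric]) (simp add: cis_cnj)
  have inner: "(LBINT \<xi>. complex_of_real (gauss (\<sigma> *\<^sub>R \<xi>)) * cis (- (x \<bullet> \<xi>)) * cnj (fourier g \<xi>))
     = complex_of_real (c * (LBINT z. g (x + \<sigma> *\<^sub>R z) * gauss z))" for x
  proof -
    have cis: "cis (- ((x - y) \<bullet> \<xi>)) = cis (- (x \<bullet> \<xi>)) * cis (y \<bullet> \<xi>)" for y \<xi>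
      by (simp add: cis_mult inner_diff_left)
    have "(LBINT \<xi>. complex_of_real (gauss (\<sigma> *\<^sub>R \<xi>)) * cis (- (x \<bullet> \<xi>)) * cnj (fourier g \<xi>))
      = (LBINT \<xi>. (LBINT y. complex_of_real (gauss (\<sigma> *\<^sub>R \<xi>)) * cis (- ((x - y) \<bullet> \<xi>)) * complex_of_real (g y)))"
      unfolding cnj integral_mult_right_zero[symmetric]
      by (simp only: cis mult.assoc)
    also have "\<dots> = (LBINT y. (LBINT \<xi>. complex_of_real (gauss (\<sigma> *\<^sub>R \<xi>)) * cis (- ((x - y) \<bullet> \<xi>)) * complex_of_real (g y)))"
      by (rule lborel_pair.Fubini_integral, rule integrable_pair_bound[OF g gauss_scaled(1)[OF s]])
         (auto simp: norm_mult mult.commute)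
    also have "\<dots> = (LBINT y. complex_of_real (c * (inverse \<sigma> ^ DIM('a) * (gauss (inverse \<sigma> *\<^sub>R (x - y)) * g y))))"
      by (intro Bochner_Integration.integral_cong refl)
         (subst integral_mult_left_zero, subst gauss_scaled(2)[OF s], simp only: of_real_mult c_def mult_ac)
    also have "\<dots> = complex_of_real (c * (inverse \<sigma> ^ DIM('a) * (LBINT y. gauss (inverse \<sigma> *\<^sub>R (x - y)) * g y)))"
      by (simp only: integral_complex_of_real integral_mult_right_zero)
    also have "(LBINT y. gauss (inverse \<sigma> *\<^sub>R (x - y)) * g y) = (\<sigma> ^ DIM('a)) *\<^sub>R (LBINT z. g (x + \<sigma> *\<^sub>R z) * gauss z)"
      using s by (subst integral_lborel_affine[where c=\<sigma> and t=x]) (auto simp: mult.commute)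
    finally show ?thesis using s by (simp add: power_inverse)
  qed
  have "(LBINT \<xi>. complex_of_real (gauss (\<sigma> *\<^sub>R \<xi>)) * (fourier f \<xi> * cnj (fourier g \<xi>)))
    = (LBINT \<xi>. (LBINT x. complex_of_real (gauss (\<sigma> *\<^sub>R \<xi>)) * cis (- (x \<bullet> \<xi>)) * cnj (fourier g \<xi>) * complex_of_real (f x)))"
    unfolding fourier_def[of f]
    by (intro Bochner_Integration.integral_cong refl)
       (subst integral_mult_left_zero[symmetric], subst integral_mult_right_zero[symmetric], simp only: mult_ac)
  also have "\<dots> = (LBINT x. (LBINT \<xi>. complex_of_real (gauss (\<sigma> *\<^sub>R \<xi>)) * cis (- (x \<bullet> \<xi>)) * cnj (fourier g \<xi>) * complex_of_real (f x)))"
  proof (rule lborel_pair.Fubini_integral, rule integrable_pair_bound)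
    show "integrable lborel (\<lambda>x. f x * B)" using f by simp
    fix x \<xi>
    have "cmod (fourier g \<xi>) * (\<bar>f x\<bar> * gauss (\<sigma> *\<^sub>R \<xi>)) \<le> \<bar>B\<bar> * (\<bar>f x\<bar> * gauss (\<sigma> *\<^sub>R \<xi>))"
      by (intro mult_right_mono B) auto
    then show "cmod (case (x, \<xi>) of (x, \<xi>) \<Rightarrow> complex_of_real (gauss (\<sigma> *\<^sub>R \<xi>)) * cis (- (x \<bullet> \<xi>)) * cnj (fourier g \<xi>) * complex_of_real (f x))
      \<le> \<bar>f x * B\<bar> * \<bar>gauss (\<sigma> *\<^sub>R \<xi>)\<bar>"
      by (simp add: norm_mult abs_mult mult_ac)
    have [measurable]: "cnj \<in> borel_measurable borel"
      by (intro borel_measurable_continuous_onI continuous_intros)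
    show "(\<lambda>(x, \<xi>). complex_of_real (gauss (\<sigma> *\<^sub>R \<xi>)) * cis (- (x \<bullet> \<xi>)) * cnj (fourier g \<xi>) * complex_of_real (f x))
      \<in> borel_measurable (lborel \<Otimes>\<^sub>M lborel)"
      by measurable
  qed (rule gauss_scaled(1)[OF s])
  also have "\<dots> = (LBINT x. complex_of_real (c * (LBINT z. g (x + \<sigma> *\<^sub>R z) * gauss z)) * complex_of_real (f x))"
    by (simp only: integral_mult_left_zero inner)
  also have "\<dots> = complex_of_real (LBINT x. c * (f x * (LBINT z. g (x + \<sigma> *\<^sub>R z) * gauss z)))"
    by (subst integral_complex_of_real[symmetric], intro Bochner_Integration.integral_cong refl) (simp add: mult_ac del: of_real_exp)
  finally show ?thesis unfolding c_def by (simp only: integral_mult_right_zero)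
qed

text \<open>A Plancherel bound in the form of Young's inequality with parameter \<open>l\<close>:
  the weighted Parseval identity is estimated first, then \<sigma> tends to 0. Continuity and
  boundedness of \<open>g\<close> let its Gaussian averages converge under a dominating function.
  The factor c = (2 pi)^(d/2) is at least 1 and is not tracked sharply.\<close>

lemma abs_integral_continuous_le:
  fixes f g :: "'a::euclidean_space \<Rightarrow> real"
  assumes f: "integrable lborel f" and F: "integrable lborel (\<lambda>\<xi>. (cmod (fourier f \<xi>))\<^sup>2)"
    and g: "integrable lborel g" and g1: "\<And>x. \<bar>g x\<bar> \<le> 1" and cont: "continuous_on UNIV g"
    and l: "0 < l"
  shows "\<bar>\<integral>x. f x * g x \<partial>lborel\<bar>
    \<le> (l * (LBINT \<xi>. (cmod (fourier f \<xi>))\<^sup>2) + (LBINT x. (g x)\<^sup>2) / l) / 2"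
proof -
  have [measurable]: "f \<in> borel_measurable borel" "g \<in> borel_measurable borel"
    using f g by (auto dest: borel_measurable_integrable)
  note [measurable] = measurable_fourier[OF f] measurable_fourier[OF g]
  define c where "c = sqrt (2 * pi) ^ DIM('a)"
  have "1 \<le> sqrt (2 * pi)" using pi_gt3 by simp
  then have c: "1 \<le> c" unfolding c_def by (rule one_le_power)
  define F2 where "F2 = (LBINT \<xi>. (cmod (fourier f \<xi>))\<^sup>2)"
  define G2 where "G2 = (LBINT x. (g x)\<^sup>2)"
  have F2: "0 \<le> F2" unfolding F2_def by simp
  have g2: "integrable lborel (\<lambda>x. (g x)\<^sup>2)"
  proof (rule Bochner_Integration.integrable_bound[OF g])
    have "\<bar>g x\<bar> * \<bar>g x\<bar> \<le> \<bar>g x\<bar>" for x by (rule mult_left_le) (use g1 in auto)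
    then show "AE x in lborel. norm ((g x)\<^sup>2) \<le> norm (g x)"
      by (auto simp: power2_eq_square abs_mult)
  qed auto
  define S where "S f \<sigma> = (LBINT x. f x * (LBINT z. g (x + \<sigma> *\<^sub>R z) * gauss z))" for f and \<sigma> :: real
  have gz: "integrable lborel (\<lambda>z. g (x + \<sigma> *\<^sub>R z) * gauss z)" for x \<sigma>
    by (rule Bochner_Integration.integrable_bound[OF gaussian_real(1)])
       (use g1 in \<open>auto simp: abs_mult intro!: mult_left_le_one_le\<close>)
  \<comment> \<open>Translations preserve the L^2 norm, so each autocorrelation of \<open>g\<close>
    is at most \<open>G2\<close>; the Gaussian has total mass \<open>c\<close>.\<close>
  have Sg: "S g \<sigma> \<le> c * G2" if s: "0 < \<sigma>" for \<sigma>
  proof -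
    have "S g \<sigma> = (LBINT x. (LBINT z. g x * g (x + \<sigma> *\<^sub>R z) * gauss z))"
      unfolding S_def by (intro Bochner_Integration.integral_cong refl) (simp add: mult.assoc)
    also have "\<dots> = (LBINT z. (LBINT x. g x * g (x + \<sigma> *\<^sub>R z) * gauss z))"
    proof (rule lborel_pair.Fubini_integral[symmetric], rule integrable_pair_bound[OF g gaussian_real(1)])
      fix x z :: 'a
      have "\<bar>g x\<bar> * gauss z * \<bar>g (x + \<sigma> *\<^sub>R z)\<bar> \<le> \<bar>g x\<bar> * gauss z"
        by (rule mult_left_le) (use g1 in auto)
      then show "norm (case (x, z) of (x, z) \<Rightarrow> g x * g (x + \<sigma> *\<^sub>R z) * gauss z) \<le> \<bar>g x\<bar> * \<bar>gauss z\<bar>"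
        by (simp add: abs_mult mult_ac)
    qed auto
    also have "\<dots> \<le> (LBINT z. G2 * gauss (z::'a))"
    proof (rule integral_mono)
      fix z :: 'a
      have t: "integrable lborel (\<lambda>x. (g (x + \<sigma> *\<^sub>R z))\<^sup>2)"
        "(LBINT x. (g (x + \<sigma> *\<^sub>R z))\<^sup>2) = G2"
        using integrable_lborel_affine[OF g2, of 1 "\<sigma> *\<^sub>R z"]
          integral_lborel_affine[of "\<lambda>x. (g x)\<^sup>2" 1 "\<sigma> *\<^sub>R z"]
        by (simp_all add: add.commute G2_def)
      have "(LBINT x. g x * g (x + \<sigma> *\<^sub>R z)) \<le> (LBINT x. ((g x)\<^sup>2 + (g (x + \<sigma> *\<^sub>R z))\<^sup>2) / 2)"
      proof (rule integral_mono)
        show "integrable lborel (\<lambda>x. g x * g (x + \<sigma> *\<^sub>R z))"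
          by (rule Bochner_Integration.integrable_bound[OF g])
             (use g1 in \<open>auto simp: abs_mult intro!: mult_left_le\<close>)
        show "g x * g (x + \<sigma> *\<^sub>R z) \<le> ((g x)\<^sup>2 + (g (x + \<sigma> *\<^sub>R z))\<^sup>2) / 2" for x
          using sum_squares_bound[of "g x" "g (x + \<sigma> *\<^sub>R z)"] by simp
      qed (use t g2 in auto)
      also have "\<dots> = G2" using t g2 by (simp add: G2_def[symmetric])
      finally show "(LBINT x. g x * g (x + \<sigma> *\<^sub>R z) * gauss z) \<le> G2 * gauss z"
        by (simp add: mult_right_mono)
    next
      show "integrable lborel (\<lambda>z. LBINT x. g x * g (x + \<sigma> *\<^sub>R z) * gauss z)"
      proof (rule lborel_pair.integrable_snd[of "\<lambda>x z. g x * g (x + \<sigma> *\<^sub>R z) * gauss z"], rule integrable_pair_bound[OF g gaussian_real(1)])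
        fix x z :: 'a
        have "\<bar>g x\<bar> * gauss z * \<bar>g (x + \<sigma> *\<^sub>R z)\<bar> \<le> \<bar>g x\<bar> * gauss z"
          by (rule mult_left_le) (use g1 in auto)
        then show "norm (case (x, z) of (x, z) \<Rightarrow> g x * g (x + \<sigma> *\<^sub>R z) * gauss z) \<le> \<bar>g x\<bar> * \<bar>gauss z\<bar>"
          by (simp add: abs_mult mult_ac)
      qed auto
    qed (use gaussian_real(1) in auto)
    also have "\<dots> = c * G2" by (simp only: integral_mult_right_zero gaussian_real(2) c_def mult.commute)
    finally show ?thesis .
  qed
  have main: "c * \<bar>S f \<sigma>\<bar> \<le> (l * c * F2 + c * G2 / l) * c / 2" if s: "0 < \<sigma>" for \<sigma>
  proof -
    have gg: "integrable lborel (\<lambda>\<xi>. gauss (\<sigma> *\<^sub>R \<xi>) * (cmod (fourier g \<xi>))\<^sup>2)"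
    proof -
      have B: "integrable lborel (\<lambda>\<xi>. gauss (\<sigma> *\<^sub>R \<xi>) * (LBINT x. \<bar>h x\<bar>)\<^sup>2)" for h :: "'a \<Rightarrow> real"
        by (intro integrable_mult_left gauss_scaled(1)[OF s])
      show "integrable lborel (\<lambda>\<xi>. gauss (\<sigma> *\<^sub>R \<xi>) * (cmod (fourier g \<xi>))\<^sup>2)"
        by (rule Bochner_Integration.integrable_bound[OF B[of g]])
           (auto simp: abs_mult intro!: mult_left_mono power_mono norm_fourier_le)
    qed
    have "complex_of_real (LBINT \<xi>. gauss (\<sigma> *\<^sub>R \<xi>) * (cmod (fourier g \<xi>))\<^sup>2) = complex_of_real (c * S g \<sigma>)"
      unfolding S_def c_def fourier_gauss[OF g g s, symmetric]
      by (subst integral_complex_of_real[symmetric]) (simp only: of_real_mult complex_norm_square)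
    then have eq: "(LBINT \<xi>. gauss (\<sigma> *\<^sub>R \<xi>) * (cmod (fourier g \<xi>))\<^sup>2) = c * S g \<sigma>"
      by (simp only: of_real_eq_iff)
    have "c * \<bar>S f \<sigma>\<bar> = cmod (complex_of_real (c * S f \<sigma>))"
      using c by (simp add: abs_mult norm_mult)
    also have "\<dots> \<le> (LBINT \<xi>. cmod (complex_of_real (gauss (\<sigma> *\<^sub>R \<xi>)) * (fourier f \<xi> * cnj (fourier g \<xi>))))"
      unfolding S_def c_def fourier_gauss[OF f g s, symmetric] by (rule integral_norm_bound)
    also have "\<dots> \<le> (LBINT \<xi>. (l * c * (cmod (fourier f \<xi>))\<^sup>2 + gauss (\<sigma> *\<^sub>R \<xi>) * (cmod (fourier g \<xi>))\<^sup>2 / (l * c)) / 2)"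
    proof (rule integral_mono_AE')
      show "AE \<xi> in lborel. cmod (complex_of_real (gauss (\<sigma> *\<^sub>R \<xi>)) * (fourier f \<xi> * cnj (fourier g \<xi>)))
        \<le> (l * c * (cmod (fourier f \<xi>))\<^sup>2 + gauss (\<sigma> *\<^sub>R \<xi>) * (cmod (fourier g \<xi>))\<^sup>2 / (l * c)) / 2"
      proof (rule AE_I2)
        fix \<xi> :: 'a
        define a b G where "a = cmod (fourier f \<xi>)" and "b = cmod (fourier g \<xi>)" and "G = gauss (\<sigma> *\<^sub>R \<xi>)"
        \<comment> \<open>The Young weight is \<open>l * c\<close> instead of \<open>l\<close>: the
          \<open>g\<close> term integrates to at most \<open>c * c * G2\<close>, and division by
          \<open>l * c\<close> leaves the same factor \<open>c\<close> in front of both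
          terms.\<close>
        have "0 \<le> (sqrt (l * c) * a - b / sqrt (l * c))\<^sup>2" by simp
        also have "\<dots> = l * c * a\<^sup>2 + b\<^sup>2 / (l * c) - 2 * (a * b)"
          using l c by (simp add: power2_diff power_mult_distrib power_divide)
        finally have "G * (2 * (a * b)) \<le> G * (l * c * a\<^sup>2 + b\<^sup>2 / (l * c))"
          by (intro mult_left_mono) (auto simp: G_def)
        \<comment> \<open>The Gaussian is discarded only from the \<open>f\<close> term, whose
          integrability is assumed; on \<open>g\<close> it has to stay, because
          \<open>fourier g\<close> is known here only to be bounded.\<close>
        also have "\<dots> \<le> 1 * (l * c * a\<^sup>2) + G * b\<^sup>2 / (l * c)"
          unfolding distrib_left using l c by (intro add_mono mult_right_mono) (auto simp: G_def)
        finally show "cmod (complex_of_real (gauss (\<sigma> *\<^sub>R \<xi>)) * (fourier f \<xi> * cnj (fourier g \<xi>)))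
        \<le> (l * c * (cmod (fourier f \<xi>))\<^sup>2 + gauss (\<sigma> *\<^sub>R \<xi>) * (cmod (fourier g \<xi>))\<^sup>2 / (l * c)) / 2"
          unfolding a_def[symmetric] b_def[symmetric] G_def[symmetric]
          by (simp add: norm_mult a_def[symmetric] b_def[symmetric] G_def)
      qed
    qed (use F gg l c in \<open>auto intro!: add_nonneg_nonneg divide_nonneg_nonneg mult_nonneg_nonneg\<close>)
    also have "\<dots> = (l * c * F2 + (c * S g \<sigma>) / (l * c)) / 2"
      unfolding F2_def eq[symmetric] using F gg by simp
    also have "\<dots> \<le> (l * c * F2 + (c * (c * G2)) / (l * c)) / 2"
      using Sg[OF s] l c by (intro divide_right_mono add_left_mono mult_left_mono) auto
    also have "\<dots> = (l * c * F2 + c * G2 / l) / 2"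
      using c by simp
    also have "\<dots> \<le> (l * c * F2 + c * G2 / l) * c / 2"
    proof -
      have "0 \<le> l * c * F2 + c * G2 / l" using c l F2 by (simp add: G2_def)
      from mult_left_mono[OF c this] show ?thesis by (intro divide_right_mono) simp_all
    qed
    finally show ?thesis .
  qed
  have lim1: "(\<lambda>n. \<integral>z. g (x + inverse (real (Suc n)) *\<^sub>R z) * gauss z \<partial>lborel) \<longlonglongrightarrow> (LBINT z. g x * gauss (z::'a))" for x
  proof (rule integral_dominated_convergence[where w="\<lambda>z::'a. gauss z"])
    have "(\<lambda>n. x + inverse (real (Suc n)) *\<^sub>R z) \<longlonglongrightarrow> x + 0 *\<^sub>R z" for z :: 'a
      by (intro tendsto_intros LIMSEQ_inverse_real_of_nat)
    then have "(\<lambda>n. g (x + inverse (real (Suc n)) *\<^sub>R z)) \<longlonglongrightarrow> g x" for z :: 'a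
      using continuous_on_tendsto_compose[OF cont, of "\<lambda>n. x + inverse (real (Suc n)) *\<^sub>R z" x] by simp
    then show "AE z in lborel. (\<lambda>n. g (x + inverse (real (Suc n)) *\<^sub>R z) * gauss z) \<longlonglongrightarrow> g x * gauss z"
      by (intro AE_I2 tendsto_intros)
  qed (use g1 gaussian_real(1) in \<open>auto simp: abs_mult intro!: mult_left_le_one_le\<close>)
  have "(\<lambda>n. S f (inverse (real (Suc n)))) \<longlonglongrightarrow> (LBINT x. f x * (LBINT z. g x * gauss (z::'a)))"
    unfolding S_def
  proof (rule integral_dominated_convergence[where w="\<lambda>x. \<bar>f x\<bar> * c"])
    show "AE x in lborel. norm (f x * (LBINT z. g (x + inverse (real (Suc n)) *\<^sub>R z) * gauss z)) \<le> \<bar>f x\<bar> * c" for n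
    proof (rule AE_I2)
      fix x :: 'a
      have "\<bar>\<integral>z. g (x + inverse (real (Suc n)) *\<^sub>R z) * gauss z \<partial>lborel\<bar> \<le> (LBINT z. gauss (z::'a))"
        by (rule order_trans[OF integral_abs_bound integral_mono[OF integrable_abs[OF gz] gaussian_real(1)]])
           (use g1 in \<open>auto simp: abs_mult intro!: mult_left_le_one_le\<close>)
      then show "norm (f x * (LBINT z. g (x + inverse (real (Suc n)) *\<^sub>R z) * gauss z)) \<le> \<bar>f x\<bar> * c"
        unfolding gaussian_real(2) c_def[symmetric] real_norm_def abs_mult by (rule mult_left_mono) simp
    qed
  qed (use f lim1 in \<open>auto intro!: tendsto_intros\<close>)
  also have "(LBINT x. f x * (LBINT z. g x * gauss (z::'a))) = c * (LBINT x. f x * g x)"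
    by (simp only: integral_mult_right_zero gaussian_real(2) c_def[symmetric] mult.assoc[symmetric] integral_mult_left_zero mult.commute[of c])
  finally have "(\<lambda>n. c * \<bar>S f (inverse (real (Suc n)))\<bar>) \<longlonglongrightarrow> c * \<bar>c * (LBINT x. f x * g x)\<bar>"
    by (intro tendsto_intros)
  then have "c * \<bar>c * (LBINT x. f x * g x)\<bar> \<le> (l * c * F2 + c * G2 / l) * c / 2"
    by (rule LIMSEQ_le_const2) (use main in auto)
  then have "(c * c) * \<bar>\<integral>x. f x * g x \<partial>lborel\<bar> \<le> (c * c) * ((l * F2 + G2 / l) / 2)"
    using c by (simp add: abs_mult field_simps)
  then show ?thesis using c unfolding F2_def[symmetric] G2_def[symmetric] by simp
qed

text \<open>Optimising over \<open>l\<close> bounds the left-hand side by the square root of the volume times the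
  \<open>L\<^sup>2\<close> norm of the Fourier transform.\<close>

lemma integral_abs_le_fourier_L2:
  fixes f :: "'a::euclidean_space \<Rightarrow> real"
  assumes f: "integrable lborel f" and F: "integrable lborel (\<lambda>\<xi>. (cmod (fourier f \<xi>))\<^sup>2)"
    and r: "0 < r" and l: "0 < l"
  shows "(\<integral>x\<in>cball 0 r. \<bar>f x\<bar> \<partial>lborel)
    \<le> (l * (LBINT \<xi>. (cmod (fourier f \<xi>))\<^sup>2) + measure lborel (cball (0::'a) r) / l) / 2"
proof -
  have [measurable]: "f \<in> borel_measurable borel"
    using f by (auto dest: borel_measurable_integrable)
  have [measurable]: "cball (0::'a) r \<in> sets borel" by simp
  \<comment> \<open>The sign of \<open>f\<close> on the ball is the test function that produces the
    L^1 norm. Being discontinuous, it is reached as an almost everywhere limit of continuous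
    functions clipped to [-1, 1].\<close>
  define h where "h x = sgn (f x) * indicator (cball 0 r) x" for x
  have [measurable]: "h \<in> borel_measurable borel" unfolding h_def by measurable
  then have "h \<in> borel_measurable lebesgue" by (intro measurable_completion) simp
  then have "h measurable_on UNIV" using lebesgue_measurable_imp_measurable_on[of h UNIV]
    by (simp add: lebesgue_on_UNIV_eq)
  then obtain N g where N: "negligible N" and g: "\<And>n. continuous_on UNIV (g n)"
    and lim: "\<And>x. x \<notin> N \<Longrightarrow> (\<lambda>n. g n x) \<longlonglongrightarrow> h x"
    unfolding measurable_on_def by auto
  have AE: "AE x in lborel. x \<notin> N"
  proof -
    have "AE x in lebesgue. x \<notin> N" using N by (simp add: negligible_iff_null_sets AE_not_in)
    then show ?thesis by (simp only: AE_completion_iff)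
  qed
  \<comment> \<open>Equal to 1 on the ball, the cutoff does not alter the limit; vanishing beyond
    radius \<open>r + 1\<close>, it makes each approximation integrable and gives a common majorant
    for the squares.\<close>
  define cut where "cut x = max 0 (min 1 (r + 1 - norm x))" for x :: 'a
  have [measurable]: "cut \<in> borel_measurable borel" unfolding cut_def by measurable
  have cut01: "0 \<le> cut x" "cut x \<le> 1" "x \<notin> cball 0 (r + 1) \<Longrightarrow> cut x = 0" "x \<in> cball 0 r \<Longrightarrow> cut x = 1" for x
    by (auto simp: cut_def)
  define k where "k n x = cut x * max (- 1) (min 1 (g n x))" for n x
  have k1: "\<bar>k n x\<bar> \<le> cut x" for n x
    unfolding k_def abs_mult using cut01(1,2)[of x] by (auto intro!: mult_left_le)
  have kle: "\<bar>k n x\<bar> \<le> indicator (cball 0 (r + 1)) x" for n x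
    using k1[of n x] cut01[of x] by (auto split: split_indicator)
  have cont: "continuous_on UNIV (k n)" for n
    unfolding k_def cut_def by (intro continuous_intros g)
  have [measurable]: "k n \<in> borel_measurable borel" for n
    by (rule borel_measurable_continuous_onI[OF cont])
  have ind: "integrable lborel (indicator (cball (0::'a) (r + 1)) :: _ \<Rightarrow> real)"
    by (rule integrable_real_indicator) (use emeasure_bounded_finite[OF bounded_cball[of "0::'a" "r + 1"]] in \<open>auto simp: less_top\<close>)
  have ki: "integrable lborel (k n)" for n
    by (rule Bochner_Integration.integrable_bound[OF ind]) (use kle in auto)
  have klim: "AE x in lborel. (\<lambda>n. k n x) \<longlonglongrightarrow> h x"
    using AE
  proof eventually_elim
    case (elim x)
    have "(\<lambda>n. k n x) \<longlonglongrightarrow> cut x * max (- 1) (min 1 (h x))"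
      unfolding k_def by (intro tendsto_intros lim elim)
    moreover have "cut x * max (- 1) (min 1 (h x)) = h x"
      using cut01(4)[of x] by (auto simp: h_def sgn_if split: split_indicator)
    ultimately show ?case by simp
  qed
  have L1: "(\<lambda>n. \<integral>x. f x * k n x \<partial>lborel) \<longlonglongrightarrow> (LBINT x. f x * h x)"
  proof (rule integral_dominated_convergence[where w="\<lambda>x. \<bar>f x\<bar>"])
    show "AE x in lborel. (\<lambda>n. f x * k n x) \<longlonglongrightarrow> f x * h x"
      using klim by eventually_elim (intro tendsto_intros)
    show "AE x in lborel. norm (f x * k n x) \<le> \<bar>f x\<bar>" for n
    proof (rule AE_I2)
      fix x show "norm (f x * k n x) \<le> \<bar>f x\<bar>"
        using order_trans[OF k1 cut01(2), of n x] by (auto simp: abs_mult intro!: mult_left_le)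
    qed
  qed (use f in auto)
  have L2: "(\<lambda>n. \<integral>x. (k n x)\<^sup>2 \<partial>lborel) \<longlonglongrightarrow> (LBINT x. (h x)\<^sup>2)"
  proof (rule integral_dominated_convergence[where w="indicator (cball (0::'a) (r + 1))"])
    show "AE x in lborel. (\<lambda>n. (k n x)\<^sup>2) \<longlonglongrightarrow> (h x)\<^sup>2"
      using klim by eventually_elim (intro tendsto_intros)
    show "AE x in lborel. norm ((k n x)\<^sup>2) \<le> indicator (cball (0::'a) (r + 1)) x" for n
    proof (rule AE_I2)
      fix x show "norm ((k n x)\<^sup>2) \<le> indicator (cball (0::'a) (r + 1)) x"
        using kle[of n x] by (auto simp: abs_square_le_1 split: split_indicator)
    qed
  qed (use ind in auto)
  have "\<bar>\<integral>x. f x * k n x \<partial>lborel\<bar>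
    \<le> (l * (LBINT \<xi>. (cmod (fourier f \<xi>))\<^sup>2) + (LBINT x. (k n x)\<^sup>2) / l) / 2" for n
    by (rule abs_integral_continuous_le[OF f F ki _ cont l]) (rule order_trans[OF k1 cut01(2)])
  moreover have "(\<lambda>n. (l * (LBINT \<xi>. (cmod (fourier f \<xi>))\<^sup>2) + (LBINT x. (k n x)\<^sup>2) / l) / 2)
    \<longlonglongrightarrow> (l * (LBINT \<xi>. (cmod (fourier f \<xi>))\<^sup>2) + (LBINT x. (h x)\<^sup>2) / l) / 2"
    by (intro tendsto_intros L2) (use l in auto)
  ultimately have "\<bar>\<integral>x. f x * h x \<partial>lborel\<bar>
    \<le> (l * (LBINT \<xi>. (cmod (fourier f \<xi>))\<^sup>2) + (LBINT x. (h x)\<^sup>2) / l) / 2"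
    using LIMSEQ_le[OF tendsto_rabs[OF L1]] by blast
  moreover have "(LBINT x. f x * h x) = (\<integral>x\<in>cball 0 r. \<bar>f x\<bar> \<partial>lborel)"
    unfolding set_lebesgue_integral_def
    by (intro Bochner_Integration.integral_cong refl) (auto simp: h_def abs_sgn split: split_indicator)
  moreover have "(LBINT x. (h x)\<^sup>2) \<le> (LBINT x. indicator (cball (0::'a) r) x)"
    by (rule integral_mono_AE') (auto simp: h_def sgn_if split: split_indicator
        intro!: integrable_real_indicator emeasure_bounded_finite[OF bounded_cball, unfolded infinity_ennreal_def])
  ultimately show ?thesis using l
    by (simp add: divide_right_mono) (smt (verit) divide_right_mono)
qed

section \<open>Volterra inequalities\<close>

text \<open>Comparison with a product of one-dimensional weights 1/(1 + y^2): each coordinate is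
  paid for by one factor (1 + |x|)^2, whence the exponent twice the dimension.\<close>

lemma integrable_inverse_1_plus_norm_power:
  "integrable lborel (\<lambda>x::'a::euclidean_space. inverse ((1 + norm x) ^ (2 * DIM('a))))"
proof -
  have 1: "integrable lborel (\<lambda>y::real. inverse (1 + y\<^sup>2))"
    using integrable_inverse_1_plus_square by (simp add: set_integrable_def)
  have "integrable lborel (\<lambda>x::'a. \<Prod>b\<in>Basis. inverse (1 + (x \<bullet> b)\<^sup>2))"
    by (rule integrable_lborel_prod_Basis) (rule 1)
  then show ?thesis
  proof (rule Bochner_Integration.integrable_bound)
    show "AE x in lborel. norm (inverse ((1 + norm (x::'a)) ^ (2 * DIM('a)))) \<le> norm (\<Prod>b\<in>Basis. inverse (1 + (x \<bullet> b)\<^sup>2))"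
    proof (rule AE_I2)
      fix x :: 'a
      have "1 + (x \<bullet> b)\<^sup>2 \<le> (1 + norm x)\<^sup>2" if "b \<in> Basis" for b
      proof -
        have "(x \<bullet> b)\<^sup>2 \<le> (norm x)\<^sup>2"
          using Basis_le_norm[OF that, of x] by (metis abs_le_square_iff abs_norm_cancel)
        moreover have "(1 + norm x)\<^sup>2 = 1 + 2 * norm x + (norm x)\<^sup>2" by (simp add: power2_sum)
        ultimately show ?thesis using norm_ge_zero[of x] by linarith
      qed
      then have "inverse ((1 + norm x)\<^sup>2) \<le> inverse (1 + (x \<bullet> b)\<^sup>2)" if "b \<in> Basis" for b
        using that by (intro le_imp_inverse_le) (auto simp: add_pos_nonneg)
      then have "(\<Prod>b\<in>(Basis::'a set). inverse ((1 + norm x)\<^sup>2)) \<le> (\<Prod>b\<in>Basis. inverse (1 + (x \<bullet> b)\<^sup>2))"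
        by (intro prod_mono) auto
      moreover have "0 \<le> (\<Prod>b\<in>Basis. inverse (1 + (x \<bullet> b)\<^sup>2))" by (intro prod_nonneg) auto
      ultimately show "norm (inverse ((1 + norm x) ^ (2 * DIM('a)))) \<le> norm (\<Prod>b\<in>Basis. inverse (1 + (x \<bullet> b)\<^sup>2))"
        by (simp add: power_mult power_inverse)
    qed
  qed simp
qed

abbreviation duhamel :: "real \<Rightarrow> real \<Rightarrow> real \<Rightarrow> real" where
  "duhamel lam t \<tau> \<equiv> lam * exp (- lam * (t - \<tau>))"

lemma set_integral_exp_kernel:
  fixes t :: real
  assumes "0 \<le> t"
  shows "set_integrable lborel {0..t} (\<lambda>\<tau>. duhamel lam t \<tau>)"
    and "(LBINT \<tau>:{0..t}. duhamel lam t \<tau>) = 1 - exp (- lam * t)"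
proof -
  show "set_integrable lborel {0..t} (\<lambda>\<tau>. duhamel lam t \<tau>)"
    by (intro borel_integrable_atLeastAtMost' continuous_intros)
  have "(LBINT \<tau>:{0..t}. duhamel lam t \<tau>) = exp (- lam * (t - t)) - exp (- lam * (t - 0))"
    unfolding set_lebesgue_integral_def
    by (rule integral_FTC_atLeastAtMost[OF assms])
       (auto intro!: derivative_eq_intros continuous_intros simp: has_real_derivative_iff_has_vector_derivative[symmetric])
  then show "(LBINT \<tau>:{0..t}. duhamel lam t \<tau>) = 1 - exp (- lam * t)" by simp
qed

lemma set_integrable_bounded_mult:
  fixes f :: "real \<Rightarrow> real" and g :: "real \<Rightarrow> 'b::{banach, second_countable_topology}"
  assumes f: "set_integrable lborel A f" and A: "A \<in> sets borel" and g: "g \<in> borel_measurable borel"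
    and B: "\<And>x. x \<in> A \<Longrightarrow> norm (g x) \<le> B"
  shows "set_integrable lborel A (\<lambda>x. f x *\<^sub>R g x)"
proof -
  have "integrable lborel (\<lambda>x. \<bar>B\<bar> * (indicator A x *\<^sub>R f x))"
    using f unfolding set_integrable_def by simp
  then show ?thesis unfolding set_integrable_def
  proof (rule Bochner_Integration.integrable_bound)
    have "(\<lambda>x. (indicator A x *\<^sub>R f x) *\<^sub>R g x) \<in> borel_measurable lborel"
      using f[unfolded set_integrable_def, THEN borel_measurable_integrable] g by simp
    then show "(\<lambda>x. indicator A x *\<^sub>R f x *\<^sub>R g x) \<in> borel_measurable lborel" by simp
    show "AE x in lborel. norm (indicator A x *\<^sub>R f x *\<^sub>R g x) \<le> norm (\<bar>B\<bar> * (indicator A x *\<^sub>R f x))"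
    proof (rule AE_I2)
      fix x
      show "norm (indicator A x *\<^sub>R f x *\<^sub>R g x) \<le> norm (\<bar>B\<bar> * (indicator A x *\<^sub>R f x))"
      proof (cases "x \<in> A")
        case True
        then have "norm (g x) \<le> \<bar>B\<bar>" using B[of x] by linarith
        then show ?thesis using True by (simp add: abs_mult mult.commute[of "\<bar>B\<bar>"] mult_left_mono)
      qed auto
    qed
  qed
qed

text \<open>The Volterra operator with kernel \<open>\<lambda>e\<^sup>-\<^sup>\<lambda>\<^sup>(\<^sup>t\<^sup>-\<^sup>\<tau>\<^sup>)\<close> is a contraction for the supremum
  norm on \<open>[0,T]\<close>, with factor \<open>1 - e\<^sup>-\<^sup>\<lambda>\<^sup>T\<close>.\<close>

lemma volterra_nonpos:
  fixes D :: "real \<Rightarrow> real"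
  assumes lam: "0 \<le> lam" and meas: "D \<in> borel_measurable borel"
    and bdd: "\<And>t. t \<in> {0..T} \<Longrightarrow> \<bar>D t\<bar> \<le> B"
    and le: "\<And>t. t \<in> {0..T} \<Longrightarrow> D t \<le> (LBINT \<tau>:{0..t}. duhamel lam t \<tau> * D \<tau>)"
    and t: "t \<in> {0..T}"
  shows "D t \<le> 0"
proof -
  define q where "q = 1 - exp (- lam * T)"
  have q: "0 \<le> q" "q < 1" using lam t unfolding q_def by auto
  have B: "0 \<le> B" using bdd[OF t] by linarith
  \<comment> \<open>Each substitution of the bound into the inequality gains one factor
    \<open>q\<close>. The kernel is nonnegative, so upper bounds on \<open>D\<close> alone can be
    iterated.\<close>
  have *: "\<forall>t\<in>{0..T}. D t \<le> B * q ^ n" for n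
  proof (induction n)
    case 0
    show ?case using bdd by (auto simp: abs_le_iff)
  next
    case (Suc n)
    show ?case
    proof
      fix t assume t: "t \<in> {0..T}"
      have "D t \<le> (LBINT \<tau>:{0..t}. duhamel lam t \<tau> * D \<tau>)" by (rule le[OF t])
      also have "\<dots> \<le> (LBINT \<tau>:{0..t}. duhamel lam t \<tau> * (B * q ^ n))"
      proof (rule set_integral_mono)
        show "set_integrable lborel {0..t} (\<lambda>\<tau>. duhamel lam t \<tau> * D \<tau>)"
          using set_integrable_bounded_mult[OF set_integral_exp_kernel(1)[of t lam] _ meas, of B] t bdd by simp
        show "set_integrable lborel {0..t} (\<lambda>\<tau>. duhamel lam t \<tau> * (B * q ^ n))"
          using t by (intro set_integrable_mult_left set_integral_exp_kernel(1)) auto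
        show "duhamel lam t \<tau> * D \<tau> \<le> duhamel lam t \<tau> * (B * q ^ n)" if "\<tau> \<in> {0..t}" for \<tau>
          using Suc lam that t by (intro mult_left_mono) auto
      qed
      also have "\<dots> = (1 - exp (- lam * t)) * (B * q ^ n)"
        using t by (simp only: set_integral_mult_left set_integral_exp_kernel(2)[of t lam] atLeastAtMost_iff)
      also have "\<dots> \<le> q * (B * q ^ n)"
        using t lam q B unfolding q_def by (intro mult_right_mono) (auto intro: mult_left_mono)
      finally show "D t \<le> B * q ^ Suc n" by (simp add: mult_ac)
    qed
  qed
  have "(\<lambda>n. B * q ^ n) \<longlonglongrightarrow> B * 0"
    using q by (intro tendsto_intros LIMSEQ_realpow_zero) auto
  then show ?thesis using * t by (intro LIMSEQ_le_const[of _ "0" "D t"]) auto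
qed

text \<open>Variation of constants with the integrating factor e^(lam \<tau>). It shows that an
  explicit candidate, known through its derivative, satisfies an integral equation of the same type
  as the quantities derived from the weak formulation, so that the two can be subtracted.\<close>

lemma duhamel_identity:
  fixes y w :: "real \<Rightarrow> 'b::euclidean_space"
  assumes t: "0 \<le> t"
    and y: "\<And>\<tau>. \<tau> \<in> {0..t} \<Longrightarrow> (y has_vector_derivative lam *\<^sub>R (w \<tau> - y \<tau>)) (at \<tau> within {0..t})"
    and w: "continuous_on {0..t} w"
  shows "y t = exp (- lam * t) *\<^sub>R y 0 + (LBINT \<tau>:{0..t}. duhamel lam t \<tau> *\<^sub>R w \<tau>)"
proof -
  have "(LBINT \<tau>:{0..t}. duhamel lam t \<tau> *\<^sub>R w \<tau>)
     = exp (- lam * (t - t)) *\<^sub>R y t - exp (- lam * (t - 0)) *\<^sub>R y 0"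
    unfolding set_lebesgue_integral_def
  proof (rule integral_FTC_atLeastAtMost[OF t])
    fix \<tau> assume "0 \<le> \<tau>" "\<tau> \<le> t"
    then have "((\<lambda>\<tau>. exp (- lam * (t - \<tau>)) *\<^sub>R y \<tau>) has_vector_derivative
        exp (- lam * (t - \<tau>)) *\<^sub>R (lam *\<^sub>R (w \<tau> - y \<tau>)) + duhamel lam t \<tau> *\<^sub>R y \<tau>) (at \<tau> within {0..t})"
      by (intro has_vector_derivative_scaleR y) (auto intro!: derivative_eq_intros)
    moreover have "exp (- lam * (t - \<tau>)) *\<^sub>R (lam *\<^sub>R (w \<tau> - y \<tau>)) + duhamel lam t \<tau> *\<^sub>R y \<tau>
      = duhamel lam t \<tau> *\<^sub>R w \<tau>"
      by (simp add: algebra_simps)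
    ultimately show "((\<lambda>\<tau>. exp (- lam * (t - \<tau>)) *\<^sub>R y \<tau>) has_vector_derivative
        duhamel lam t \<tau> *\<^sub>R w \<tau>) (at \<tau> within {0..t})" by simp
  next
    show "continuous_on {0..t} (\<lambda>\<tau>. duhamel lam t \<tau> *\<^sub>R w \<tau>)"
      by (intro continuous_intros w)
  qed
  then show ?thesis by simp
qed

lemma volterra_le:
  fixes Q h :: "real \<Rightarrow> real"
  assumes lam: "0 \<le> lam" and meas: "Q \<in> borel_measurable borel"
    and bdd: "\<And>t. t \<in> {0..T} \<Longrightarrow> \<bar>Q t\<bar> \<le> B" and h: "continuous_on UNIV h"
    and le: "\<And>t. t \<in> {0..T} \<Longrightarrow>
      Q t \<le> exp (- lam * t) * q0 + (LBINT \<tau>:{0..t}. duhamel lam t \<tau> * (Q \<tau> + h \<tau>))"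
    and T: "0 \<le> T"
  shows "Q T \<le> q0 + integral {0..T} (\<lambda>\<tau>. lam * h \<tau>)"
proof -
  have h': "continuous_on A h" for A using h continuous_on_subset by blast
  define P where "P t = q0 + integral {0..t} (\<lambda>\<tau>. lam * h \<tau>)" for t
  have dP: "(P has_vector_derivative lam *\<^sub>R ((P t + h t) - P t)) (at t within {0..s})" if "t \<in> {0..s}" for t s
  proof -
    have "((\<lambda>t. integral {0..t} (\<lambda>\<tau>. lam * h \<tau>)) has_vector_derivative lam * h t) (at t within {0..s})"
      by (intro integral_has_vector_derivative continuous_intros h' that)
    from has_vector_derivative_add[OF has_vector_derivative_const this, of q0]
    show ?thesis unfolding P_def[abs_def] by simp
  qed
  have cP: "continuous_on {0..s} P" for s
    unfolding continuous_on_eq_continuous_within using dP has_vector_derivative_continuous by blast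
  have eqP: "P t = exp (- lam * t) * q0 + (LBINT \<tau>:{0..t}. duhamel lam t \<tau> * (P \<tau> + h \<tau>))"
    if "0 \<le> t" for t
    using duhamel_identity[OF that dP] by (simp add: P_def[of 0] continuous_intros cP h')
  \<comment> \<open>Setting the comparison function to zero off [0, T] makes it Borel measurable on
    the whole line.\<close>
  define P' where "P' t = indicator {0..T} t * P t" for t
  have P': "P' \<in> borel_measurable borel"
    using borel_measurable_continuous_on_indicator[OF _ cP[of T]] unfolding P'_def by simp
  obtain BP where BP: "\<And>t. t \<in> {0..T} \<Longrightarrow> \<bar>P t\<bar> \<le> BP"
    using compact_imp_bounded[OF compact_continuous_image[OF cP[of T]]] unfolding bounded_iff by fastforce
  obtain Bh where Bh: "\<And>t. t \<in> {0..T} \<Longrightarrow> \<bar>h t\<bar> \<le> Bh"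
    using compact_imp_bounded[OF compact_continuous_image[OF h'[of "{0..T}"]]] unfolding bounded_iff by fastforce
  have [measurable]: "h \<in> borel_measurable borel" using h by (rule borel_measurable_continuous_onI)
  note [measurable] = P' meas
  have "Q T - P' T \<le> 0"
  proof (rule volterra_nonpos[OF lam, of "\<lambda>t. Q t - P' t" T "B + BP"])
    fix t assume t: "t \<in> {0..T}"
    then show "\<bar>Q t - P' t\<bar> \<le> B + BP" using bdd[of t] BP[of t] unfolding P'_def by auto
    have i1: "set_integrable lborel {0..t} (\<lambda>\<tau>. duhamel lam t \<tau> * (Q \<tau> + h \<tau>))"
      using set_integrable_bounded_mult[OF set_integral_exp_kernel(1)[of t lam], of "\<lambda>\<tau>. Q \<tau> + h \<tau>" "B + Bh"] t
        order_trans[OF abs_triangle_ineq add_mono[OF bdd Bh]] by auto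
    have i2: "set_integrable lborel {0..t} (\<lambda>\<tau>. duhamel lam t \<tau> * (P' \<tau> + h \<tau>))"
      unfolding real_scaleR_def[symmetric, of "lam * exp _"]
    proof (rule set_integrable_bounded_mult[OF set_integral_exp_kernel(1)])
      fix \<tau> assume "\<tau> \<in> {0..t}"
      then show "norm (P' \<tau> + h \<tau>) \<le> BP + Bh"
        using t order_trans[OF abs_triangle_ineq add_mono[OF BP Bh], of \<tau> \<tau>] by (auto simp: P'_def)
    qed (use t in auto)
    have "P' t = exp (- lam * t) * q0 + (LBINT \<tau>:{0..t}. duhamel lam t \<tau> * (P' \<tau> + h \<tau>))"
    proof -
      have "(LBINT \<tau>:{0..t}. duhamel lam t \<tau> * (P' \<tau> + h \<tau>)) =
        (LBINT \<tau>:{0..t}. duhamel lam t \<tau> * (P \<tau> + h \<tau>))"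
        by (rule set_lebesgue_integral_cong) (use t in \<open>auto simp: P'_def\<close>)
      then show ?thesis using eqP[of t] t by (simp add: P'_def)
    qed
    then have "Q t - P' t \<le> (LBINT \<tau>:{0..t}. duhamel lam t \<tau> * (Q \<tau> + h \<tau>))
       - (LBINT \<tau>:{0..t}. duhamel lam t \<tau> * (P' \<tau> + h \<tau>))"
      using le[OF t] by simp
    also have "\<dots> = (LBINT \<tau>:{0..t}. duhamel lam t \<tau> * (Q \<tau> - P' \<tau>))"
      by (subst set_integral_diff(2)[OF i1 i2, symmetric]) (simp add: algebra_simps)
    finally show "Q t - P' t \<le> (LBINT \<tau>:{0..t}. duhamel lam t \<tau> * (Q \<tau> - P' \<tau>))" .
  qed (use T in auto)
  then show ?thesis using T by (simp add: P'_def P_def)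
qed

text \<open>Uniqueness for a linear Volterra equation: because |j| \<le> 1, the modulus of the
  difference to the explicit exponential satisfies the homogeneous inequality, hence
  vanishes.\<close>

lemma volterra_exp:
  fixes V j :: "real \<Rightarrow> complex"
  assumes lam: "0 \<le> lam" and meas: "V \<in> borel_measurable borel"
    and bdd: "\<And>t. t \<in> {0..T} \<Longrightarrow> cmod (V t) \<le> B" and j: "continuous_on UNIV j" and j1: "\<And>t. cmod (j t) \<le> 1"
    and eq: "\<And>t. t \<in> {0..T} \<Longrightarrow>
      V t = exp (- lam * t) *\<^sub>R v0 + (LBINT \<tau>:{0..t}. duhamel lam t \<tau> *\<^sub>R (j \<tau> * V \<tau>))"
    and T: "0 \<le> T"
  shows "V T = v0 * exp (- integral {0..T} (\<lambda>\<tau>. lam *\<^sub>R (1 - j \<tau>)))"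
proof -
  have j': "continuous_on A j" for A using j continuous_on_subset by blast
  define E where "E t = v0 * exp (- integral {0..t} (\<lambda>\<tau>. lam *\<^sub>R (1 - j \<tau>)))" for t
  have dE: "(E has_vector_derivative lam *\<^sub>R ((j t * E t) - E t)) (at t within {0..s})" if "t \<in> {0..s}" for t s
  proof -
    have "((\<lambda>t. - integral {0..t} (\<lambda>\<tau>. lam *\<^sub>R (1 - j \<tau>))) has_vector_derivative - (lam *\<^sub>R (1 - j t))) (at t within {0..s})"
      using that j' by (intro has_vector_derivative_minus integral_has_vector_derivative continuous_intros) auto
    then have "((\<lambda>t. exp (- integral {0..t} (\<lambda>\<tau>. lam *\<^sub>R (1 - j \<tau>)))) has_vector_derivative
       - (lam *\<^sub>R (1 - j t)) * exp (- integral {0..t} (\<lambda>\<tau>. lam *\<^sub>R (1 - j \<tau>)))) (at t within {0..s})"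
      by (rule field_vector_diff_chain_within[unfolded comp_def]) (rule has_field_derivative_at_within[OF DERIV_exp])
    from has_vector_derivative_mult_right[OF this, of v0]
    show ?thesis unfolding E_def by (simp add: algebra_simps scaleR_conv_of_real)
  qed
  have cE: "continuous_on {0..s} E" for s
    unfolding continuous_on_eq_continuous_within using dE has_vector_derivative_continuous by blast
  have eqE: "E t = exp (- lam * t) *\<^sub>R v0 + (LBINT \<tau>:{0..t}. duhamel lam t \<tau> *\<^sub>R (j \<tau> * E \<tau>))"
    if "0 \<le> t" for t
    using duhamel_identity[OF that dE] by (simp add: E_def[of 0] continuous_intros cE j')
  define E' where "E' t = indicator {0..T} t *\<^sub>R E t" for t
  have E': "E' \<in> borel_measurable borel"
    using borel_measurable_continuous_on_indicator[OF _ cE[of T]] unfolding E'_def by simp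
  obtain BE where BE: "\<And>t. t \<in> {0..T} \<Longrightarrow> cmod (E t) \<le> BE"
    using compact_imp_bounded[OF compact_continuous_image[OF cE[of T]]] unfolding bounded_iff by fastforce
  have [measurable]: "j \<in> borel_measurable borel" using j by (rule borel_measurable_continuous_onI)
  note [measurable] = E' meas
  have "cmod (V T - E' T) \<le> 0"
  proof (rule volterra_nonpos[OF lam, of "\<lambda>t. cmod (V t - E' t)" T "B + BE"])
    fix t assume t: "t \<in> {0..T}"
    then show "\<bar>cmod (V t - E' t)\<bar> \<le> B + BE"
      using order_trans[OF norm_triangle_ineq4 add_mono[OF bdd BE], of t t] unfolding E'_def by auto
    have i1: "set_integrable lborel {0..t} (\<lambda>\<tau>. duhamel lam t \<tau> *\<^sub>R (j \<tau> * V \<tau>))"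
    proof (rule set_integrable_bounded_mult[OF set_integral_exp_kernel(1)])
      fix \<tau> assume "\<tau> \<in> {0..t}"
      then show "cmod (j \<tau> * V \<tau>) \<le> 1 * B"
        unfolding norm_mult using t by (intro mult_mono j1 bdd) auto
    qed (use t in auto)
    have i2: "set_integrable lborel {0..t} (\<lambda>\<tau>. duhamel lam t \<tau> *\<^sub>R (j \<tau> * E' \<tau>))"
    proof (rule set_integrable_bounded_mult[OF set_integral_exp_kernel(1)])
      fix \<tau> assume "\<tau> \<in> {0..t}"
      then show "cmod (j \<tau> * E' \<tau>) \<le> 1 * BE"
        unfolding norm_mult using t BE[of \<tau>] by (intro mult_mono j1) (auto simp: E'_def)
    qed (use t in auto)
    have i3: "set_integrable lborel {0..t} (\<lambda>\<tau>. duhamel lam t \<tau> *\<^sub>R cmod (V \<tau> - E' \<tau>))"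
    proof (rule set_integrable_bounded_mult[OF set_integral_exp_kernel(1)])
      fix \<tau> assume "\<tau> \<in> {0..t}"
      then show "norm (cmod (V \<tau> - E' \<tau>)) \<le> B + BE"
        using t order_trans[OF norm_triangle_ineq4 add_mono[OF bdd BE], of \<tau> \<tau>] by (auto simp: E'_def)
    qed (use t in auto)
    have "E' t = exp (- lam * t) *\<^sub>R v0 + (LBINT \<tau>:{0..t}. duhamel lam t \<tau> *\<^sub>R (j \<tau> * E' \<tau>))"
    proof -
      have "(LBINT \<tau>:{0..t}. duhamel lam t \<tau> *\<^sub>R (j \<tau> * E' \<tau>)) =
        (LBINT \<tau>:{0..t}. duhamel lam t \<tau> *\<^sub>R (j \<tau> * E \<tau>))"
        by (rule set_lebesgue_integral_cong) (use t in \<open>auto simp: E'_def\<close>)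
      then show ?thesis using eqE[of t] t by (simp add: E'_def)
    qed
    then have "V t - E' t = (LBINT \<tau>:{0..t}. duhamel lam t \<tau> *\<^sub>R (j \<tau> * V \<tau>))
       - (LBINT \<tau>:{0..t}. duhamel lam t \<tau> *\<^sub>R (j \<tau> * E' \<tau>))"
      using eq[OF t] by simp
    also have "\<dots> = (LBINT \<tau>:{0..t}. duhamel lam t \<tau> *\<^sub>R (j \<tau> * (V \<tau> - E' \<tau>)))"
      by (subst set_integral_diff(2)[OF i1 i2, symmetric]) (simp add: algebra_simps)
    finally have eqD: "V t - E' t = (LBINT \<tau>:{0..t}. duhamel lam t \<tau> *\<^sub>R (j \<tau> * (V \<tau> - E' \<tau>)))" .
    have "cmod (V t - E' t) \<le> (LBINT \<tau>. cmod (indicator {0..t} \<tau> *\<^sub>R (duhamel lam t \<tau> *\<^sub>R (j \<tau> * (V \<tau> - E' \<tau>)))))"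
      unfolding eqD set_lebesgue_integral_def by (rule integral_norm_bound)
    also have "\<dots> \<le> (LBINT \<tau>:{0..t}. duhamel lam t \<tau> * cmod (V \<tau> - E' \<tau>))"
      unfolding set_lebesgue_integral_def
    proof (rule integral_mono_AE')
      show "integrable lborel (\<lambda>\<tau>. indicator {0..t} \<tau> *\<^sub>R (duhamel lam t \<tau> * cmod (V \<tau> - E' \<tau>)))"
        using i3 unfolding set_integrable_def by simp
      have "cmod (j \<tau>) * cmod (V \<tau> - E' \<tau>) \<le> 1 * cmod (V \<tau> - E' \<tau>)" for \<tau>
        by (intro mult_right_mono j1) auto
      then show "AE \<tau> in lborel. cmod (indicator {0..t} \<tau> *\<^sub>R (duhamel lam t \<tau> *\<^sub>R (j \<tau> * (V \<tau> - E' \<tau>))))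
        \<le> indicator {0..t} \<tau> *\<^sub>R (duhamel lam t \<tau> * cmod (V \<tau> - E' \<tau>))"
        using lam by (intro AE_I2) (auto simp: norm_mult abs_mult intro!: mult_left_mono split: split_indicator)
    qed (use lam in auto)
    finally show "cmod (V t - E' t) \<le> (LBINT \<tau>:{0..t}. duhamel lam t \<tau> * cmod (V \<tau> - E' \<tau>))" .
  qed (use T in auto)
  then show ?thesis using T by (simp add: E'_def E_def)
qed

section \<open>Weak Duhamel formula and its consequences\<close>

lemma integrable_conv_kernel:
  fixes K v :: "'a::euclidean_space \<Rightarrow> real"
  assumes K: "integrable lborel K" and v: "integrable lborel v"
  shows "integrable (lborel \<Otimes>\<^sub>M lborel) (\<lambda>(y, x). K (x - y) * v y)"
proof -
  have [measurable]: "K \<in> borel_measurable borel" "v \<in> borel_measurable borel"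
    using K v by (auto dest: borel_measurable_integrable)
  have tr: "integrable lborel (\<lambda>x. K (x - y))" for y
    using integrable_lborel_affine[OF K, of 1 "- y"] by simp
  have tr': "(LBINT x. \<bar>K (x - y)\<bar>) = (LBINT x. \<bar>K x\<bar>)" for y
    using integral_lborel_affine[of "\<lambda>x. \<bar>K x\<bar>" 1 "- y"] by simp
  show ?thesis
    by (rule lborel_pair.Fubini_integrable)
       (use v tr in \<open>auto simp: abs_mult tr'\<close>)
qed

text \<open>Valid without integrability, since both sides then take the default value 0. This
  matters for convolutions, whose integrand is integrable at almost every point but is evaluated at
  every point.\<close>

lemma integral_scaleR_left_measurable:
  fixes f :: "'a \<Rightarrow> real" and c :: "'b::{banach, second_countable_topology}"
  assumes "f \<in> borel_measurable M"
  shows "(\<integral>x. f x *\<^sub>R c \<partial>M) = (\<integral>x. f x \<partial>M) *\<^sub>R c"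
proof (cases "c = 0 \<or> integrable M f")
  case False
  have "\<not> integrable M (\<lambda>x. f x *\<^sub>R c)"
  proof
    assume "integrable M (\<lambda>x. f x *\<^sub>R c)"
    then have "integrable M (\<lambda>x. norm (f x *\<^sub>R c) / norm c)" by (intro integrable_divide integrable_norm)
    then have "integrable M f"
      by (rule Bochner_Integration.integrable_bound) (use assms False in auto)
    then show False using False by simp
  qed
  then show ?thesis using False by (simp add: not_integrable_integral_eq)
qed auto

text \<open>Fubini moves the convolution onto the test function, where it becomes an average over
  jumps z weighted by \<open>K\<close>. The last part is Young's inequality in L^1.\<close>

lemma conv_test:
  fixes K v :: "'a::euclidean_space \<Rightarrow> real" and \<psi> :: "'a \<Rightarrow> 'b::{banach, second_countable_topology}"
  assumes K: "integrable lborel K" and v: "integrable lborel v"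
    and \<psi>: "\<psi> \<in> borel_measurable borel" and c: "\<And>x. norm (\<psi> x) \<le> c"
  shows "(LBINT x. conv K v x *\<^sub>R \<psi> x) = (LBINT y. v y *\<^sub>R (LBINT z. K z *\<^sub>R \<psi> (y + z)))"
    and "integrable lborel (conv K v)"
    and "(LBINT x. \<bar>conv K v x\<bar>) \<le> (LBINT x. \<bar>K x\<bar>) * (LBINT x. \<bar>v x\<bar>)"
proof -
  have [measurable]: "K \<in> borel_measurable borel" "v \<in> borel_measurable borel"
    using K v by (auto dest: borel_measurable_integrable)
  note [measurable] = \<psi>
  have int: "integrable (lborel \<Otimes>\<^sub>M lborel) (\<lambda>(y, x). K (x - y) * v y)"
    by (rule integrable_conv_kernel[OF K v])
  have "integrable (lborel \<Otimes>\<^sub>M lborel) (\<lambda>p. \<bar>c\<bar> * (case p of (y, x) \<Rightarrow> K (x - y) * v y))"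
    using int by (intro integrable_mult_right) auto
  then have int\<psi>: "integrable (lborel \<Otimes>\<^sub>M lborel) (\<lambda>(y, x). (K (x - y) * v y) *\<^sub>R \<psi> x)"
  proof (rule Bochner_Integration.integrable_bound)
    have "norm (\<psi> x) \<le> \<bar>c\<bar>" for x using c[of x] by linarith
    then show "AE p in lborel \<Otimes>\<^sub>M lborel. norm (case p of (y, x) \<Rightarrow> (K (x - y) * v y) *\<^sub>R \<psi> x)
       \<le> norm (\<bar>c\<bar> * (case p of (y, x) \<Rightarrow> K (x - y) * v y))"
      by (intro AE_I2) (auto simp: abs_mult mult.commute[of "\<bar>c\<bar>"] intro!: mult_left_mono)
  qed simp
  show "integrable lborel (conv K v)"
    unfolding conv_def[abs_def] using lborel_pair.integrable_snd[OF int] by simp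
  have "(LBINT x. conv K v x *\<^sub>R \<psi> x) = (LBINT x. (LBINT y. (K (x - y) * v y) *\<^sub>R \<psi> x))"
    unfolding conv_def by (subst integral_scaleR_left_measurable) auto
  also have "\<dots> = (LBINT y. (LBINT x. (K (x - y) * v y) *\<^sub>R \<psi> x))"
    by (rule lborel_pair.Fubini_integral[OF int\<psi>])
  also have "\<dots> = (LBINT y. v y *\<^sub>R (LBINT z. K z *\<^sub>R \<psi> (y + z)))"
  proof (intro Bochner_Integration.integral_cong refl)
    fix y
    have "(LBINT x. (K (x - y) * v y) *\<^sub>R \<psi> x) = (LBINT x. v y *\<^sub>R (K (x - y) *\<^sub>R \<psi> x))"
      by (simp add: mult.commute)
    also have "\<dots> = v y *\<^sub>R (LBINT x. K (x - y) *\<^sub>R \<psi> x)" by (rule integral_scaleR_right)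
    also have "(LBINT x. K (x - y) *\<^sub>R \<psi> x) = (LBINT z. K z *\<^sub>R \<psi> (y + z))"
      using integral_lborel_affine[of "\<lambda>x. K (x - y) *\<^sub>R \<psi> x" 1 y] by simp
    finally show "(LBINT x. (K (x - y) * v y) *\<^sub>R \<psi> x) = v y *\<^sub>R (LBINT z. K z *\<^sub>R \<psi> (y + z))" .
  qed
  finally show "(LBINT x. conv K v x *\<^sub>R \<psi> x) = (LBINT y. v y *\<^sub>R (LBINT z. K z *\<^sub>R \<psi> (y + z)))" .
  have inta: "integrable (lborel \<Otimes>\<^sub>M lborel) (\<lambda>(y, x). \<bar>K (x - y)\<bar> * \<bar>v y\<bar>)"
    using integrable_abs[OF int] by (simp add: case_prod_beta' abs_mult)
  have "(LBINT x. \<bar>conv K v x\<bar>) \<le> (LBINT x. (LBINT y. \<bar>K (x - y)\<bar> * \<bar>v y\<bar>))"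
  proof (rule integral_mono_AE')
    show "integrable lborel (\<lambda>x. \<integral>y. \<bar>K (x - y)\<bar> * \<bar>v y\<bar> \<partial>lborel)"
      using lborel_pair.integrable_snd[OF inta] by simp
    show "AE x in lborel. \<bar>conv K v x\<bar> \<le> (LBINT y. \<bar>K (x - y)\<bar> * \<bar>v y\<bar>)"
      unfolding conv_def abs_mult[symmetric] by (intro AE_I2 integral_abs_bound)
  qed (auto intro!: integral_nonneg)
  also have "\<dots> = (LBINT y. (LBINT x. \<bar>K (x - y)\<bar> * \<bar>v y\<bar>))"
    by (rule lborel_pair.Fubini_integral[OF inta])
  also have "\<dots> = (LBINT x. \<bar>K x\<bar>) * (LBINT x. \<bar>v x\<bar>)"
    using integral_lborel_affine[of "\<lambda>x. \<bar>K x\<bar>" 1 "- y" for y] by simp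
  finally show "(LBINT x. \<bar>conv K v x\<bar>) \<le> (LBINT x. \<bar>K x\<bar>) * (LBINT x. \<bar>v x\<bar>)" .
qed

text \<open>The Jacobian e^(-dr) cancels the growth factor e^(dr) of the transport semigroup; on the
  test function only a contraction of the argument is left.\<close>

lemma integral_dilate:
  fixes g :: "'a::euclidean_space \<Rightarrow> real" and \<phi> :: "'a \<Rightarrow> 'b::{banach, second_countable_topology}"
  assumes [measurable]: "g \<in> borel_measurable borel" "\<phi> \<in> borel_measurable borel"
  shows "(LBINT x. g (exp r *\<^sub>R x) *\<^sub>R \<phi> x)
    = exp (- (real DIM('a) * r)) *\<^sub>R (LBINT x. g x *\<^sub>R \<phi> (exp (- r) *\<^sub>R x))"
proof -
  have "\<bar>exp (- r)\<bar> ^ DIM('a) = exp (- (real DIM('a) * r))"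
    by (simp add: exp_of_nat_mult[symmetric])
  then show ?thesis
    by (subst integral_lborel_affine[where c="exp (- r)" and t=0]) (auto simp: exp_minus)
qed

text \<open>Treats both equations at once, with \<open>K\<close> the rescaled kernel and
  \<open>lam\<close> the jump rate \<epsilon>^(-2\<sigma>). Continuity in time is represented by the
  local bound \<open>bdd\<close>, the a priori bound that starts the Volterra comparison.\<close>

locale mild =
  fixes K :: "'a::euclidean_space \<Rightarrow> real" and lam :: real and u0 :: "'a \<Rightarrow> real" and u :: "real \<Rightarrow> 'a \<Rightarrow> real"
  assumes K: "prob_density K" and lam: "0 < lam" and u0: "integrable lborel u0"
    and meas: "(\<lambda>(t, x). u t x) \<in> borel_measurable (lborel \<Otimes>\<^sub>M lborel)"
    and int: "\<And>t. 0 \<le> t \<Longrightarrow> integrable lborel (u t)"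
    and bdd: "\<And>T. \<exists>B. \<forall>t\<in>{0..T}. (LBINT x. \<bar>u t x\<bar>) \<le> B"
    and eq: "\<And>t. 0 \<le> t \<Longrightarrow> AE x in lborel. u t x = exp ((real DIM('a) - lam) * t) * u0 (exp t *\<^sub>R x)
      + (LBINT \<tau>:{0..t}. exp ((real DIM('a) - lam) * (t - \<tau>)) * (lam * conv K (u \<tau>) (exp (t - \<tau>) *\<^sub>R x)))"
begin

lemma K_facts: "K \<in> borel_measurable borel" "integrable lborel K" "0 \<le> K x" "(LBINT x. K x) = 1"
  using K unfolding prob_density_def by auto

text \<open>Tested in this way, the factor e^(dt) is absorbed by the dilation and the time kernel is
  \<open>duhamel\<close>, whose mass is less than 1. Values in a Banach space are allowed because
  the test functions are real weights times a sign as well as complex exponentials.\<close>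

lemma weak_duhamel:
  fixes \<phi> :: "'a \<Rightarrow> 'b::{banach, second_countable_topology}"
  assumes t: "0 \<le> t" and \<phi>: "\<phi> \<in> borel_measurable borel" and c: "\<And>x. norm (\<phi> x) \<le> c"
  shows "(LBINT x. u t x *\<^sub>R \<phi> x) = exp (- lam * t) *\<^sub>R (LBINT x. u0 x *\<^sub>R \<phi> (exp (- t) *\<^sub>R x))
    + (LBINT \<tau>:{0..t}. duhamel lam t \<tau> *\<^sub>R
        (LBINT y. u \<tau> y *\<^sub>R (LBINT z. K z *\<^sub>R \<phi> (exp (- (t - \<tau>)) *\<^sub>R (y + z)))))"
proof -
  note [measurable] = \<phi> K_facts(1) meas
  have [measurable]: "u0 \<in> borel_measurable borel" using u0 by (auto dest: borel_measurable_integrable)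
  obtain B where B: "\<And>\<tau>. \<tau> \<in> {0..t} \<Longrightarrow> (LBINT x. \<bar>u \<tau> x\<bar>) \<le> B"
    using bdd[of t] by fastforce
  let ?d = "real DIM('a)"
  define F where "F \<tau> x = indicator {0..t} \<tau> * (exp ((?d - lam) * (t - \<tau>)) * (lam * conv K (u \<tau>) (exp (t - \<tau>) *\<^sub>R x)))" for \<tau> x
  have [measurable]: "(\<lambda>(\<tau>, x). F \<tau> x) \<in> borel_measurable (lborel \<Otimes>\<^sub>M lborel)"
    unfolding F_def conv_def by measurable
  have K1: "(LBINT x. \<bar>K x\<bar>) = 1" using K_facts by simp
  have cm: "conv K (u \<tau>) \<in> borel_measurable borel" "integrable lborel (conv K (u \<tau>))" if "\<tau> \<in> {0..t}" for \<tau>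
    using conv_test(2)[OF K_facts(2) int, of \<tau> "\<lambda>_. 0::real" 0] that by (auto dest: borel_measurable_integrable)
  have Fx: "integrable lborel (F \<tau>)" for \<tau>
  proof (cases "\<tau> \<in> {0..t}")
    case True
    from integrable_lborel_affine[OF cm(2)[OF True], of "exp (t - \<tau>)" 0] show ?thesis
      unfolding F_def by (intro integrable_mult_right) simp
  qed (simp add: F_def[abs_def])
  have Fn: "(LBINT x. \<bar>F \<tau> x\<bar>) \<le> indicator {0..t} \<tau> * (lam * B)" for \<tau>
  proof (cases "\<tau> \<in> {0..t}")
    case True
    have "(LBINT x. \<bar>F \<tau> x\<bar>) = (exp ((?d - lam) * (t - \<tau>)) * lam) * (LBINT x. \<bar>conv K (u \<tau>) (exp (t - \<tau>) *\<^sub>R x)\<bar> *\<^sub>R 1)"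
      using True lam unfolding F_def by (simp add: abs_mult)
    also have "\<dots> = (exp ((?d - lam) * (t - \<tau>)) * lam) * (exp (- (?d * (t - \<tau>))) * (LBINT x. \<bar>conv K (u \<tau>) x\<bar>))"
      using cm(1)[OF True] by (subst integral_dilate[of "\<lambda>x. \<bar>conv K (u \<tau>) x\<bar>" "\<lambda>_. 1::real"]) auto
    also have "\<dots> = exp (- (lam * (t - \<tau>))) * (lam * (LBINT x. \<bar>conv K (u \<tau>) x\<bar>))"
      by (simp add: exp_add[symmetric] algebra_simps)
    also have "\<dots> \<le> 1 * (lam * B)"
    proof (intro mult_mono order_refl)
      show "(LBINT x. \<bar>conv K (u \<tau>) x\<bar>) \<le> B"
        using conv_test(3)[OF K_facts(2) int, of \<tau> "\<lambda>_. 0::real" 0] True B[OF True] K1 by simp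
    qed (use True lam in \<open>auto intro!: mult_nonneg_nonneg integral_nonneg\<close>)
    finally show ?thesis using True by simp
  qed (simp add: F_def)
  have intF: "integrable (lborel \<Otimes>\<^sub>M lborel) (\<lambda>(\<tau>, x). F \<tau> x)"
  proof (rule lborel_pair.Fubini_integrable)
    have "integrable lborel (\<lambda>\<tau>. indicator {0..t} \<tau> * (lam * B))"
      by (intro integrable_mult_left integrable_real_indicator) (use t in auto)
    then show "integrable lborel (\<lambda>\<tau>. \<integral>x. norm (case (\<tau>, x) of (\<tau>, x) \<Rightarrow> F \<tau> x) \<partial>lborel)"
    proof (rule Bochner_Integration.integrable_bound)
      show "AE \<tau> in lborel. norm (LBINT x. norm (case (\<tau>, x) of (\<tau>, x) \<Rightarrow> F \<tau> x)) \<le> norm (indicator {0..t} \<tau> * (lam * B))"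
        using order_trans[OF Fn abs_ge_self] by (intro AE_I2) simp
    qed simp
    show "AE \<tau> in lborel. integrable lborel (\<lambda>x. case (\<tau>, x) of (\<tau>, x) \<Rightarrow> F \<tau> x)"
      using Fx by simp
  qed simp
  have "integrable (lborel \<Otimes>\<^sub>M lborel) (\<lambda>p. \<bar>c\<bar> * (case p of (\<tau>, x) \<Rightarrow> F \<tau> x))"
    using intF by (intro integrable_mult_right) auto
  then have intF\<phi>: "integrable (lborel \<Otimes>\<^sub>M lborel) (\<lambda>(\<tau>, x). F \<tau> x *\<^sub>R \<phi> x)"
  proof (rule Bochner_Integration.integrable_bound)
    have "norm (\<phi> x) \<le> \<bar>c\<bar>" for x using c[of x] by linarith
    then show "AE p in lborel \<Otimes>\<^sub>M lborel. norm (case p of (\<tau>, x) \<Rightarrow> F \<tau> x *\<^sub>R \<phi> x)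
       \<le> norm (\<bar>c\<bar> * (case p of (\<tau>, x) \<Rightarrow> F \<tau> x))"
      by (intro AE_I2) (auto simp: abs_mult mult.commute[of "\<bar>c\<bar>"] intro!: mult_left_mono)
  qed simp
  have int0: "integrable lborel (\<lambda>x. (exp ((?d - lam) * t) * u0 (exp t *\<^sub>R x)) *\<^sub>R \<phi> x)"
  proof (rule Bochner_Integration.integrable_bound)
    show "integrable lborel (\<lambda>x. \<bar>c\<bar> * (exp ((?d - lam) * t) * u0 (exp t *\<^sub>R x)))"
      using integrable_lborel_affine[OF u0, of "exp t" 0] by simp
    have "norm (\<phi> x) \<le> \<bar>c\<bar>" for x using c[of x] by linarith
    then show "AE x in lborel. norm ((exp ((?d - lam) * t) * u0 (exp t *\<^sub>R x)) *\<^sub>R \<phi> x) \<le> norm (\<bar>c\<bar> * (exp ((?d - lam) * t) * u0 (exp t *\<^sub>R x)))"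
      by (intro AE_I2) (auto simp: abs_mult mult.commute[of "\<bar>c\<bar>"] mult.assoc intro!: mult_left_mono)
  qed simp
  have "(LBINT x. u t x *\<^sub>R \<phi> x) = (LBINT x. (exp ((?d - lam) * t) * u0 (exp t *\<^sub>R x)) *\<^sub>R \<phi> x + (LBINT \<tau>. F \<tau> x *\<^sub>R \<phi> x))"
  proof (rule integral_cong_AE)
    show "(\<lambda>x. u t x *\<^sub>R \<phi> x) \<in> borel_measurable lborel"
      using int[OF t] by (auto dest!: borel_measurable_integrable)
    show "(\<lambda>x. (exp ((?d - lam) * t) * u0 (exp t *\<^sub>R x)) *\<^sub>R \<phi> x + (LBINT \<tau>. F \<tau> x *\<^sub>R \<phi> x)) \<in> borel_measurable lborel"
      by measurable
    have e: "(LBINT \<tau>. F \<tau> x *\<^sub>R \<phi> x) =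
      (LBINT \<tau>:{0..t}. exp ((?d - lam) * (t - \<tau>)) * (lam * conv K (u \<tau>) (exp (t - \<tau>) *\<^sub>R x))) *\<^sub>R \<phi> x" for x
    proof -
      have "(\<lambda>\<tau>. F \<tau> x) \<in> borel_measurable lborel" by measurable
      from integral_scaleR_left_measurable[OF this, of "\<phi> x"] show ?thesis
        by (simp add: F_def set_lebesgue_integral_def)
    qed
    show "AE x in lborel. u t x *\<^sub>R \<phi> x = (exp ((?d - lam) * t) * u0 (exp t *\<^sub>R x)) *\<^sub>R \<phi> x + (LBINT \<tau>. F \<tau> x *\<^sub>R \<phi> x)"
      using eq[OF t] unfolding e by eventually_elim (simp add: scaleR_left_distrib)
  qed
  also have "\<dots> = (LBINT x. (exp ((?d - lam) * t) * u0 (exp t *\<^sub>R x)) *\<^sub>R \<phi> x) + (LBINT x. (LBINT \<tau>. F \<tau> x *\<^sub>R \<phi> x))"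
    by (rule Bochner_Integration.integral_add[OF int0]) (use lborel_pair.integrable_snd[OF intF\<phi>] in simp)
  also have "(LBINT x. (LBINT \<tau>. F \<tau> x *\<^sub>R \<phi> x)) = (LBINT \<tau>. (LBINT x. F \<tau> x *\<^sub>R \<phi> x))"
    by (rule lborel_pair.Fubini_integral[OF intF\<phi>])
  also have "(LBINT x. (exp ((?d - lam) * t) * u0 (exp t *\<^sub>R x)) *\<^sub>R \<phi> x) = exp (- lam * t) *\<^sub>R (LBINT x. u0 x *\<^sub>R \<phi> (exp (- t) *\<^sub>R x))"
    unfolding scaleR_scaleR[symmetric] integral_scaleR_right integral_dilate[OF \<open>u0 \<in> _\<close> \<phi>]
    by (simp add: exp_add[symmetric] algebra_simps)
  also have "(LBINT \<tau>. (LBINT x. F \<tau> x *\<^sub>R \<phi> x)) = (LBINT \<tau>:{0..t}. duhamel lam t \<tau> *\<^sub>R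
        (LBINT y. u \<tau> y *\<^sub>R (LBINT z. K z *\<^sub>R \<phi> (exp (- (t - \<tau>)) *\<^sub>R (y + z)))))"
    unfolding set_lebesgue_integral_def
  proof (intro Bochner_Integration.integral_cong refl)
    fix \<tau>
    show "(LBINT x. F \<tau> x *\<^sub>R \<phi> x) = indicator {0..t} \<tau> *\<^sub>R (duhamel lam t \<tau> *\<^sub>R
        (LBINT y. u \<tau> y *\<^sub>R (LBINT z. K z *\<^sub>R \<phi> (exp (- (t - \<tau>)) *\<^sub>R (y + z)))))"
    proof (cases "\<tau> \<in> {0..t}")
      case True
      have "(LBINT x. F \<tau> x *\<^sub>R \<phi> x) = (LBINT x. (exp ((?d - lam) * (t - \<tau>)) * lam) *\<^sub>R (conv K (u \<tau>) (exp (t - \<tau>) *\<^sub>R x) *\<^sub>R \<phi> x))"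
        using True by (simp add: F_def mult.assoc)
      also have "\<dots> = (exp ((?d - lam) * (t - \<tau>)) * lam * exp (- (?d * (t - \<tau>)))) *\<^sub>R (LBINT x. conv K (u \<tau>) x *\<^sub>R \<phi> (exp (- (t - \<tau>)) *\<^sub>R x))"
        unfolding integral_scaleR_right integral_dilate[OF cm(1)[OF True] \<phi>] by simp
      also have "exp ((?d - lam) * (t - \<tau>)) * lam * exp (- (?d * (t - \<tau>))) = duhamel lam t \<tau>"
        by (simp add: exp_add[symmetric] algebra_simps)
      also have "(LBINT x. conv K (u \<tau>) x *\<^sub>R \<phi> (exp (- (t - \<tau>)) *\<^sub>R x)) =
         (LBINT y. u \<tau> y *\<^sub>R (LBINT z. K z *\<^sub>R \<phi> (exp (- (t - \<tau>)) *\<^sub>R (y + z))))"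
        using True by (intro conv_test(1)[OF K_facts(2) int]) (auto intro: c)
      finally show ?thesis using True by simp
    qed (simp add: F_def)
  qed
  finally show ?thesis .
qed

lemma set_integral_kernel_bound:
  fixes g :: "real \<Rightarrow> 'b::{banach, second_countable_topology}" and h :: "real \<Rightarrow> real"
  assumes t: "0 \<le> t" and h: "h \<in> borel_measurable borel" and B: "\<And>\<tau>. \<tau> \<in> {0..t} \<Longrightarrow> \<bar>h \<tau>\<bar> \<le> B"
    and le: "\<And>\<tau>. \<tau> \<in> {0..t} \<Longrightarrow> norm (g \<tau>) \<le> h \<tau>"
  shows "norm (LBINT \<tau>:{0..t}. duhamel lam t \<tau> *\<^sub>R g \<tau>)
    \<le> (LBINT \<tau>:{0..t}. duhamel lam t \<tau> * h \<tau>)"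
  unfolding set_lebesgue_integral_def
proof (rule order_trans[OF integral_norm_bound integral_mono_AE'])
  show "integrable lborel (\<lambda>\<tau>. indicator {0..t} \<tau> *\<^sub>R (duhamel lam t \<tau> * h \<tau>))"
    using set_integrable_bounded_mult[OF set_integral_exp_kernel(1)[OF t, of lam] _ h, of B] B
    by (simp add: set_integrable_def)
  show "AE \<tau> in lborel. norm (indicator {0..t} \<tau> *\<^sub>R (duhamel lam t \<tau> *\<^sub>R g \<tau>))
    \<le> indicator {0..t} \<tau> *\<^sub>R (duhamel lam t \<tau> * h \<tau>)"
    using le lam by (intro AE_I2) (auto simp: abs_mult split: split_indicator)
  show "AE \<tau> in lborel. 0 \<le> indicator {0..t} \<tau> *\<^sub>R (duhamel lam t \<tau> * h \<tau>)"
    using le lam order_trans[OF norm_ge_zero le] by (intro AE_I2) (auto split: split_indicator)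
qed

text \<open>The test function \<open>w t\<close> times the sign of \<open>u t\<close> produces the
  weighted norm at time t. By \<open>dil\<close> the weight is constant along the transport, so
  dilations cost nothing; by \<open>jump\<close> a jump raises it by at most \<open>h\<close>, which
  is charged to the mass of \<open>u\<close>. What remains is a Volterra inequality for
  \<open>volterra_le\<close>, with \<open>H\<close> as continuous majorant of the source.\<close>

lemma weighted_L1_bound:
  fixes w :: "real \<Rightarrow> 'a \<Rightarrow> real" and h :: "real \<Rightarrow> real"
  assumes wm: "(\<lambda>(\<tau>, x). w \<tau> x) \<in> borel_measurable (borel \<Otimes>\<^sub>M borel)"
    and w: "\<And>\<tau> x. 0 \<le> w \<tau> x" "\<And>\<tau> x. w \<tau> x \<le> c"
    and dil: "\<And>t \<tau> x. w t (exp (- (t - \<tau>)) *\<^sub>R x) = w \<tau> x"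
    and jump: "\<And>\<tau> y. (LBINT z. K z * w \<tau> (y + z)) \<le> w \<tau> y + h \<tau>"
    and H: "continuous_on UNIV H" "\<And>\<tau>. 0 \<le> \<tau> \<Longrightarrow> h \<tau> * (LBINT x. \<bar>u \<tau> x\<bar>) \<le> H \<tau>"
    and T: "0 \<le> T"
  shows "(LBINT x. \<bar>u T x\<bar> * w T x) \<le> (LBINT x. \<bar>u0 x\<bar> * w 0 x) + integral {0..T} (\<lambda>\<tau>. lam * H \<tau>)"
proof -
  note [measurable] = K_facts(1) meas wm
  have [measurable]: "u0 \<in> borel_measurable borel" using u0 by (auto dest: borel_measurable_integrable)
  have [measurable]: "u t \<in> borel_measurable borel" if "0 \<le> t" for t
    using int[OF that] by (auto dest: borel_measurable_integrable)
  have [measurable]: "w t \<in> borel_measurable borel" for t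
  proof -
    have "(\<lambda>x::'a. (t, x)) \<in> borel \<rightarrow>\<^sub>M borel \<Otimes>\<^sub>M borel" by measurable
    from measurable_compose[OF this wm] show ?thesis by simp
  qed
  have c: "0 \<le> c" using order_trans[OF w] .
  have iw: "integrable lborel (\<lambda>x. \<bar>v x\<bar> * w t x)" if "integrable lborel v" for v t
  proof (rule Bochner_Integration.integrable_bound)
    show "integrable lborel (\<lambda>x. c * v x)" using that by simp
    have [measurable]: "v \<in> borel_measurable borel" using that by (auto dest: borel_measurable_integrable)
    show "(\<lambda>x. \<bar>v x\<bar> * w t x) \<in> borel_measurable lborel" by simp
    show "AE x in lborel. norm (\<bar>v x\<bar> * w t x) \<le> norm (c * v x)"
      using w c by (intro AE_I2) (auto simp: abs_mult mult.commute[of c] intro!: mult_left_mono)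
  qed
  have iKw: "integrable lborel (\<lambda>z. K z * w t (y + z))" for t y
  proof (rule Bochner_Integration.integrable_bound)
    show "integrable lborel (\<lambda>x. c * K x)" using K_facts by simp
    show "AE x in lborel. norm (K x * w t (y + x)) \<le> norm (c * K x)"
      using w c by (intro AE_I2) (auto simp: abs_mult mult.commute[of c] intro!: mult_left_mono)
  qed simp
  define Q where "Q t = (LBINT x. \<bar>u t x\<bar> * w t x)" for t
  have Qm: "Q \<in> borel_measurable borel" unfolding Q_def[abs_def] by measurable
  note [measurable] = Qm
  have [measurable]: "H \<in> borel_measurable borel" by (rule borel_measurable_continuous_onI[OF H(1)])
  obtain B where B: "\<And>t. t \<in> {0..T} \<Longrightarrow> (LBINT x. \<bar>u t x\<bar>) \<le> B"
    using bdd[of T] by fastforce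
  obtain BH where BH: "\<And>t. t \<in> {0..T} \<Longrightarrow> \<bar>H t\<bar> \<le> BH"
    using compact_imp_bounded[OF compact_continuous_image[OF continuous_on_subset[OF H(1)], of "{0..T}"]]
    unfolding bounded_iff by fastforce
  have Q0: "0 \<le> Q t" for t unfolding Q_def using w by (intro Bochner_Integration.integral_nonneg) auto
  have QB: "\<bar>Q t\<bar> \<le> c * B" if t: "t \<in> {0..T}" for t
  proof -
    have "Q t \<le> (LBINT x. c * \<bar>u t x\<bar>)"
      unfolding Q_def using iw[OF int] int t w
      by (intro integral_mono) (auto simp: mult.commute[of c] intro!: mult_left_mono)
    also have "\<dots> \<le> c * B" using B[OF t] c by (simp add: mult_left_mono)
    finally show ?thesis using Q0[of t] by simp
  qed
  have "Q T \<le> (LBINT x. \<bar>u0 x\<bar> * w 0 x) + integral {0..T} (\<lambda>\<tau>. lam * H \<tau>)"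
  proof (rule volterra_le[OF _ Qm QB H(1) _ T])
    fix t assume t: "t \<in> {0..T}"
    define \<phi> where "\<phi> x = w t x * sgn (u t x)" for x
    have [measurable]: "\<phi> \<in> borel_measurable borel" unfolding \<phi>_def using t by simp
    have \<phi>: "\<bar>\<phi> x\<bar> \<le> w t x" for x using w unfolding \<phi>_def by (auto simp: abs_mult sgn_if)
    have \<phi>w: "\<bar>\<phi> (exp (- (t - \<tau>)) *\<^sub>R x)\<bar> \<le> w \<tau> x" for \<tau> x using \<phi> dil by metis
    have K\<phi>: "\<bar>\<integral>z. K z * \<phi> (exp (- (t - \<tau>)) *\<^sub>R (y + z)) \<partial>lborel\<bar> \<le> w \<tau> y + h \<tau>" for \<tau> y
    proof -
      have "\<bar>\<integral>z. K z * \<phi> (exp (- (t - \<tau>)) *\<^sub>R (y + z)) \<partial>lborel\<bar> \<le> (LBINT z. K z * w \<tau> (y + z))"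
        unfolding real_norm_def[symmetric]
        by (rule order_trans[OF integral_norm_bound integral_mono_AE'[OF iKw]])
           (use K_facts(3) w \<phi>w in \<open>auto simp: abs_mult intro!: AE_I2 mult_left_mono\<close>)
      then show ?thesis using jump[of \<tau> y] by linarith
    qed
    have "Q t = (LBINT x. u t x *\<^sub>R \<phi> x)"
      unfolding Q_def \<phi>_def
      by (intro Bochner_Integration.integral_cong refl) (auto simp: abs_sgn mult_ac)
    also have "\<dots> \<le> norm (exp (- lam * t) *\<^sub>R (LBINT x. u0 x *\<^sub>R \<phi> (exp (- t) *\<^sub>R x))) +
       norm (LBINT \<tau>:{0..t}. duhamel lam t \<tau> *\<^sub>R
        (LBINT y. u \<tau> y *\<^sub>R (LBINT z. K z *\<^sub>R \<phi> (exp (- (t - \<tau>)) *\<^sub>R (y + z)))))"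
      by (subst weak_duhamel[of t \<phi> c]) (use t order_trans[OF \<phi> w(2)] in auto)
    also have "\<dots> \<le> exp (- lam * t) * (LBINT x. \<bar>u0 x\<bar> * w 0 x)
       + (LBINT \<tau>:{0..t}. duhamel lam t \<tau> * (Q \<tau> + H \<tau>))"
    proof (rule add_mono)
      have "norm (LBINT x. u0 x *\<^sub>R \<phi> (exp (- t) *\<^sub>R x)) \<le> (LBINT x. \<bar>u0 x\<bar> * w 0 x)"
        by (rule order_trans[OF integral_norm_bound integral_mono_AE'[OF iw[OF u0]]])
           (use w \<phi>w[of 0] in \<open>auto simp: abs_mult intro!: AE_I2 mult_left_mono\<close>)
      then show "norm (exp (- lam * t) *\<^sub>R (LBINT x. u0 x *\<^sub>R \<phi> (exp (- t) *\<^sub>R x))) \<le> exp (- lam * t) * (LBINT x. \<bar>u0 x\<bar> * w 0 x)"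
        unfolding norm_scaleR by (simp only: abs_exp_cancel mult_left_mono exp_ge_zero)
      show "norm (LBINT \<tau>:{0..t}. duhamel lam t \<tau> *\<^sub>R
        (LBINT y. u \<tau> y *\<^sub>R (LBINT z. K z *\<^sub>R \<phi> (exp (- (t - \<tau>)) *\<^sub>R (y + z)))))
        \<le> (LBINT \<tau>:{0..t}. duhamel lam t \<tau> * (Q \<tau> + H \<tau>))"
      proof (rule set_integral_kernel_bound[where B="c * B + BH"])
        fix \<tau> assume \<tau>: "\<tau> \<in> {0..t}"
        then have \<tau>': "0 \<le> \<tau>" "\<tau> \<in> {0..T}" using t by auto
        show "\<bar>Q \<tau> + H \<tau>\<bar> \<le> c * B + BH"
          by (rule order_trans[OF abs_triangle_ineq add_mono[OF QB BH]]) (use \<tau>' in auto)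
        have i: "integrable lborel (\<lambda>y. \<bar>u \<tau> y\<bar> * w \<tau> y + h \<tau> * \<bar>u \<tau> y\<bar>)"
          using iw int \<tau>' by auto
        have "norm (LBINT y. u \<tau> y *\<^sub>R (LBINT z. K z *\<^sub>R \<phi> (exp (- (t - \<tau>)) *\<^sub>R (y + z))))
          \<le> (LBINT y. \<bar>u \<tau> y\<bar> * w \<tau> y + h \<tau> * \<bar>u \<tau> y\<bar>)"
        proof (rule order_trans[OF integral_norm_bound integral_mono_AE'[OF i]])
          have "\<bar>u \<tau> y\<bar> * \<bar>\<integral>z. K z * \<phi> (exp (- (t - \<tau>)) *\<^sub>R (y + z)) \<partial>lborel\<bar> \<le> \<bar>u \<tau> y\<bar> * (w \<tau> y + h \<tau>)" for y
            by (intro mult_left_mono K\<phi>) auto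
          then show "AE y in lborel. norm (u \<tau> y *\<^sub>R (LBINT z. K z *\<^sub>R \<phi> (exp (- (t - \<tau>)) *\<^sub>R (y + z)))) \<le> \<bar>u \<tau> y\<bar> * w \<tau> y + h \<tau> * \<bar>u \<tau> y\<bar>"
            by (intro AE_I2) (simp add: abs_mult distrib_left mult.commute)
          have "0 \<le> \<bar>u \<tau> y\<bar> * (w \<tau> y + h \<tau>)" for y
            using order_trans[OF abs_ge_zero K\<phi>[of \<tau> y]] by (intro mult_nonneg_nonneg) auto
          then show "AE y in lborel. 0 \<le> \<bar>u \<tau> y\<bar> * w \<tau> y + h \<tau> * \<bar>u \<tau> y\<bar>"
            by (intro AE_I2) (simp add: distrib_left mult.commute)
        qed
        also have "\<dots> = Q \<tau> + h \<tau> * (LBINT y. \<bar>u \<tau> y\<bar>)"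
          unfolding Q_def using iw int \<tau>' by simp
        also have "\<dots> \<le> Q \<tau> + H \<tau>" using H(2)[OF \<tau>'(1)] by simp
        finally show "norm (LBINT y. u \<tau> y *\<^sub>R (LBINT z. K z *\<^sub>R \<phi> (exp (- (t - \<tau>)) *\<^sub>R (y + z)))) \<le> Q \<tau> + H \<tau>" .
      qed (use t in auto)
    qed
    finally show "Q t \<le> exp (- lam * t) * (LBINT x. \<bar>u0 x\<bar> * w 0 x)
       + (LBINT \<tau>:{0..t}. duhamel lam t \<tau> * (Q \<tau> + H \<tau>))" .
  qed (use lam in auto)
  then show ?thesis unfolding Q_def .
qed

lemma mass_bound:
  assumes "0 \<le> t"
  shows "(LBINT x. \<bar>u t x\<bar>) \<le> (LBINT x. \<bar>u0 x\<bar>)"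
  using weighted_L1_bound[of "\<lambda>_ _. 1" 1 "\<lambda>_. 0" "\<lambda>_. 0" t] assms K_facts by simp

lemma fourier_eq:
  assumes T: "0 \<le> T"
  shows "fourier (u T) (exp T *\<^sub>R \<xi>) = fourier u0 \<xi> * exp (- integral {0..T} (\<lambda>\<tau>. lam *\<^sub>R (1 - fourier K (exp \<tau> *\<^sub>R \<xi>))))"
proof (rule volterra_exp[where V="\<lambda>t. fourier (u t) (exp t *\<^sub>R \<xi>)" and j="\<lambda>\<tau>. fourier K (exp \<tau> *\<^sub>R \<xi>)" and B="\<integral>x. \<bar>u0 x\<bar> \<partial>lborel"])
  note [measurable] = K_facts(1) meas
  show "(\<lambda>t. fourier (u t) (exp t *\<^sub>R \<xi>)) \<in> borel_measurable borel"
    unfolding fourier_def by measurable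
  show "cmod (fourier (u t) (exp t *\<^sub>R \<xi>)) \<le> (LBINT x. \<bar>u0 x\<bar>)" if "t \<in> {0..T}" for t
    using order_trans[OF norm_fourier_le mass_bound, of t] that by auto
  show "continuous_on UNIV (\<lambda>\<tau>. fourier K (exp \<tau> *\<^sub>R \<xi>))"
    by (rule continuous_on_compose2[OF continuous_on_fourier[OF K_facts(2)]]) (auto intro!: continuous_intros)
  show "cmod (fourier K (exp t *\<^sub>R \<xi>)) \<le> 1" for t
    using norm_fourier_le[of K] K_facts by simp
  fix t assume t: "t \<in> {0..T}"
  \<comment> \<open>At time t the frequency is e^t \<xi>; contracting the argument back to time
    \<tau> turns it into e^\<tau> \<xi>, so the same unknown reappears under the integral and the
    equation closes.\<close>
  define \<phi> where "\<phi> x = cis (- (x \<bullet> (exp t *\<^sub>R \<xi>)))" for x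
  have [measurable]: "\<phi> \<in> borel_measurable borel" unfolding \<phi>_def by measurable
  have e: "exp t * exp (- (t - \<tau>)) = exp \<tau>" for \<tau> by (simp add: exp_add[symmetric])
  have \<phi>: "\<phi> (exp (- (t - \<tau>)) *\<^sub>R x) = cis (- (x \<bullet> (exp \<tau> *\<^sub>R \<xi>)))" for \<tau> x
    unfolding \<phi>_def using e[of \<tau>] by (simp add: mult.assoc[symmetric] del: mult_exp_exp)
  have i1: "(LBINT z. K z *\<^sub>R \<phi> (exp (- (t - \<tau>)) *\<^sub>R (y + z))) = cis (- (y \<bullet> (exp \<tau> *\<^sub>R \<xi>))) * fourier K (exp \<tau> *\<^sub>R \<xi>)" for \<tau> y
  proof -
    have "cis (- ((y + z) \<bullet> v)) = cis (- (y \<bullet> v)) * cis (- (z \<bullet> v))" for z v :: 'a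
      by (simp add: cis_mult inner_add_left)
    then show ?thesis
      unfolding \<phi> fourier_def integral_mult_right_zero[symmetric]
      by (simp only: scaleR_conv_of_real mult_ac)
  qed
  have i2: "(LBINT y. u \<tau> y *\<^sub>R (cis (- (y \<bullet> (exp \<tau> *\<^sub>R \<xi>))) * fourier K (exp \<tau> *\<^sub>R \<xi>))) =
     fourier K (exp \<tau> *\<^sub>R \<xi>) * fourier (u \<tau>) (exp \<tau> *\<^sub>R \<xi>)" for \<tau>
    unfolding fourier_def[of "u \<tau>"] integral_mult_right_zero[symmetric]
    by (intro Bochner_Integration.integral_cong refl) (simp add: scaleR_conv_of_real mult_ac)
  have "fourier (u t) (exp t *\<^sub>R \<xi>) = (LBINT x. u t x *\<^sub>R \<phi> x)"
    unfolding fourier_def \<phi>_def by (simp add: scaleR_conv_of_real mult.commute)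
  also have "\<dots> = exp (- lam * t) *\<^sub>R (LBINT x. u0 x *\<^sub>R \<phi> (exp (- t) *\<^sub>R x))
    + (LBINT \<tau>:{0..t}. duhamel lam t \<tau> *\<^sub>R
        (LBINT y. u \<tau> y *\<^sub>R (LBINT z. K z *\<^sub>R \<phi> (exp (- (t - \<tau>)) *\<^sub>R (y + z)))))"
    using t by (intro weak_duhamel[of t \<phi> 1]) (auto simp: \<phi>_def)
  also have "(LBINT x. u0 x *\<^sub>R \<phi> (exp (- t) *\<^sub>R x)) = fourier u0 \<xi>"
    using \<phi>[of 0] unfolding fourier_def by (simp add: scaleR_conv_of_real mult.commute)
  finally show "fourier (u t) (exp t *\<^sub>R \<xi>) = exp (- lam * t) *\<^sub>R fourier u0 \<xi> +
     (LBINT \<tau>:{0..t}. duhamel lam t \<tau> *\<^sub>R (fourier K (exp \<tau> *\<^sub>R \<xi>) * fourier (u \<tau>) (exp \<tau> *\<^sub>R \<xi>)))"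
    unfolding i1 i2 .
qed (use lam T in auto)

text \<open>The weight 1 - cos is bounded, as \<open>weighted_L1_bound\<close> demands, and
  invariant along the ray. By the addition formula, averaging it over jumps changes it by at most |1
  - fourier K| at the current frequency.\<close>

lemma cosine_bound:
  assumes T: "0 \<le> T"
  shows "(LBINT x. \<bar>u T x\<bar> * (1 - cos (x \<bullet> (exp T *\<^sub>R \<xi>))))
    \<le> (LBINT x. \<bar>u0 x\<bar> * (1 - cos (x \<bullet> \<xi>)))
      + integral {0..T} (\<lambda>\<tau>. lam * (cmod (1 - fourier K (exp \<tau> *\<^sub>R \<xi>)) * (LBINT x. \<bar>u0 x\<bar>)))"
proof -
  let ?w = "\<lambda>\<tau> x. 1 - cos (x \<bullet> (exp \<tau> *\<^sub>R \<xi>))"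
  have jump: "(LBINT z. K z * ?w \<tau> (y + z)) \<le> ?w \<tau> y + cmod (1 - fourier K (exp \<tau> *\<^sub>R \<xi>))" for \<tau> y
  proof -
    let ?z = "exp \<tau> *\<^sub>R \<xi>"
    have i: "integrable lborel (\<lambda>z. cis (- (z \<bullet> ?z)) * complex_of_real (K z))"
      by (rule integrable_fourier_integrand[OF K_facts(2)])
    have i': "integrable lborel (\<lambda>z. Re (cis (- (y \<bullet> ?z)) * (cis (- (z \<bullet> ?z)) * complex_of_real (K z))))"
      by (intro integrable_Re integrable_mult_right i)
    have "(LBINT z. K z * ?w \<tau> (y + z)) = (LBINT z. K z - Re (cis (- (y \<bullet> ?z)) * (cis (- (z \<bullet> ?z)) * complex_of_real (K z))))"
      by (intro Bochner_Integration.integral_cong refl)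
         (simp add: inner_add_left distrib_left cos_add algebra_simps)
    also have "\<dots> = 1 - (LBINT z. Re (cis (- (y \<bullet> ?z)) * (cis (- (z \<bullet> ?z)) * complex_of_real (K z))))"
      unfolding Bochner_Integration.integral_diff[OF K_facts(2) i'] K_facts(4) ..
    also have "(LBINT z. Re (cis (- (y \<bullet> ?z)) * (cis (- (z \<bullet> ?z)) * complex_of_real (K z)))) = Re (cis (- (y \<bullet> ?z)) * fourier K ?z)"
      using i unfolding fourier_def integral_mult_right_zero[symmetric]
      by (intro integral_Re integrable_mult_right) auto
    also have "1 - Re (cis (- (y \<bullet> ?z)) * fourier K ?z) = ?w \<tau> y + Re (cis (- (y \<bullet> ?z)) * (1 - fourier K ?z))"
      by (simp add: algebra_simps)
    also have "\<dots> \<le> ?w \<tau> y + cmod (cis (- (y \<bullet> ?z)) * (1 - fourier K ?z))"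
      by (intro add_left_mono complex_Re_le_cmod)
    finally show ?thesis by (simp add: norm_mult)
  qed
  have dil: "?w t (exp (- (t - \<tau>)) *\<^sub>R x) = ?w \<tau> x" for t \<tau> x
    by (simp add: mult.assoc[symmetric] exp_add[symmetric])
  have cont: "continuous_on UNIV (\<lambda>\<tau>. cmod (1 - fourier K (exp \<tau> *\<^sub>R \<xi>)) * (LBINT x. \<bar>u0 x\<bar>))"
    by (intro continuous_intros continuous_on_compose2[OF continuous_on_fourier[OF K_facts(2)]]) auto
  have mass: "cmod (1 - fourier K (exp \<tau> *\<^sub>R \<xi>)) * (LBINT x. \<bar>u \<tau> x\<bar>)
    \<le> cmod (1 - fourier K (exp \<tau> *\<^sub>R \<xi>)) * (LBINT x. \<bar>u0 x\<bar>)" if "0 \<le> \<tau>" for \<tau>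
    by (intro mult_left_mono mass_bound that) simp
  have wm: "(\<lambda>(\<tau>, x). ?w \<tau> x) \<in> borel_measurable (borel \<Otimes>\<^sub>M borel)" by measurable
  have w01: "0 \<le> ?w \<tau> x" "?w \<tau> x \<le> 2" for \<tau> x
    using cos_le_one[of "x \<bullet> (exp \<tau> *\<^sub>R \<xi>)"] cos_ge_minus_one[of "x \<bullet> (exp \<tau> *\<^sub>R \<xi>)"] by linarith+
  from weighted_L1_bound[OF wm w01 dil jump cont mass T] show ?thesis by simp
qed

end

section \<open>Moments of mild solutions\<close>

lemma fourier_rescale:
  fixes J :: "'a::euclidean_space \<Rightarrow> real"
  assumes [measurable]: "J \<in> borel_measurable borel" and e: "0 < \<epsilon>"
  shows "fourier (rescale \<epsilon> J) \<xi> = fourier J (\<epsilon> *\<^sub>R \<xi>)"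
proof -
  have m: "(\<lambda>x. cis (- (x \<bullet> \<xi>)) * complex_of_real (rescale \<epsilon> J x)) \<in> borel_measurable borel"
    unfolding rescale_def by measurable
  have p: "\<epsilon> powr (- real DIM('a)) = inverse (\<epsilon> ^ DIM('a))"
    using e by (simp add: powr_minus powr_realpow)
  have "fourier (rescale \<epsilon> J) \<xi> = \<epsilon> ^ DIM('a) *\<^sub>R (LBINT x. cis (- ((\<epsilon> *\<^sub>R x) \<bullet> \<xi>)) * complex_of_real (rescale \<epsilon> J (\<epsilon> *\<^sub>R x)))"
    unfolding fourier_def using e m by (subst integral_lborel_affine[where c=\<epsilon> and t=0]) auto
  also have "\<dots> = \<epsilon> ^ DIM('a) *\<^sub>R (LBINT x. complex_of_real (inverse (\<epsilon> ^ DIM('a))) * (cis (- (x \<bullet> (\<epsilon> *\<^sub>R \<xi>))) * complex_of_real (J x)))"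
    using e by (simp add: rescale_def p mult_ac)
  also have "\<dots> = \<epsilon> ^ DIM('a) *\<^sub>R (complex_of_real (inverse (\<epsilon> ^ DIM('a))) * fourier J (\<epsilon> *\<^sub>R \<xi>))"
    unfolding fourier_def by (simp only: integral_mult_right_zero)
  also have "\<dots> = fourier J (\<epsilon> *\<^sub>R \<xi>)"
    using e by (simp add: scaleR_conv_of_real)
  finally show ?thesis .
qed

lemma prob_density_rescale:
  fixes J :: "'a::euclidean_space \<Rightarrow> real"
  assumes J: "prob_density J" and e: "0 < \<epsilon>"
  shows "prob_density (rescale \<epsilon> J)"
proof -
  have [measurable]: "J \<in> borel_measurable borel" using J unfolding prob_density_def by simp
  have m [measurable]: "rescale \<epsilon> J \<in> borel_measurable borel" unfolding rescale_def[abs_def] by measurable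
  have p: "\<epsilon> powr (- real DIM('a)) = inverse (\<epsilon> ^ DIM('a))"
    using e by (simp add: powr_minus powr_realpow)
  have "integrable lborel (\<lambda>x. J ((1 / \<epsilon>) *\<^sub>R x))"
    using integrable_lborel_affine[of J "1 / \<epsilon>" 0] J e unfolding prob_density_def by simp
  then have "integrable lborel (rescale \<epsilon> J)" unfolding rescale_def[abs_def] by (rule integrable_mult_right)
  moreover have "(LBINT x. rescale \<epsilon> J x) = 1"
    using e J p by (subst integral_lborel_affine[where c=\<epsilon> and t=0]) (auto simp: rescale_def prob_density_def)
  moreover have "\<forall>x. 0 \<le> rescale \<epsilon> J x" using J by (auto simp: rescale_def prob_density_def)
  ultimately show ?thesis using m unfolding prob_density_def by simp
qed

lemma jbr_ge_1: "1 \<le> jbr x" and jbr_ge_norm: "norm x \<le> jbr x" and jbr_le: "jbr x \<le> 1 + norm x"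
proof -
  show "1 \<le> jbr x" unfolding jbr_def by simp
  show "norm x \<le> jbr x" unfolding jbr_def by (rule real_le_rsqrt) simp
  show "jbr x \<le> 1 + norm x" unfolding jbr_def
    by (rule real_le_lsqrt) (auto simp: power2_sum)
qed

lemma measurable_jbr [measurable]: "jbr \<in> borel_measurable borel"
  unfolding jbr_def[abs_def] by measurable

lemma L1w_imp_integrable:
  fixes f :: "'a::euclidean_space \<Rightarrow> real"
  assumes f: "L1w k f" and k: "0 \<le> k"
  shows "integrable lborel f" and "(LBINT x. \<bar>f x\<bar>) \<le> L1w_norm k f"
proof -
  have "1 \<le> jbr x powr k" for x :: 'a using jbr_ge_1[of x] k by (rule ge_one_powr_ge_zero)
  then have le: "\<bar>f x\<bar> \<le> jbr x powr k * \<bar>f x\<bar>" for x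
    using mult_right_mono[of 1 "jbr x powr k" "\<bar>f x\<bar>"] by simp
  have i: "integrable lborel (\<lambda>x. jbr x powr k * \<bar>f x\<bar>)" using f unfolding L1w_def by simp
  then show "integrable lborel f"
    by (rule Bochner_Integration.integrable_bound) (use f le in \<open>auto simp: L1w_def intro!: AE_I2\<close>)
  show "(LBINT x. \<bar>f x\<bar>) \<le> L1w_norm k f"
    unfolding L1w_norm_def by (rule integral_mono_AE'[OF i]) (use le in auto)
qed

text \<open>The local bound in time comes from compactness of [0, T]: by the reverse triangle
  inequality the L^1_k norm is continuous in time, and for k \<ge> 0 it dominates the L^1
  norm.\<close>

lemma mild_solution_imp_mild:
  fixes J :: "'a::euclidean_space \<Rightarrow> real"
  assumes k: "0 \<le> k" and J: "prob_density J" and e: "0 < \<epsilon>" and u0: "integrable lborel u0"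
    and u: "mild_solution k J \<epsilon> \<sigma> u0 u"
  shows "mild (rescale \<epsilon> J) (1 / \<epsilon> powr (2 * \<sigma>)) u0 u"
proof
  have L: "L1w k (u t)" if "0 \<le> t" for t using u that unfolding mild_solution_def by simp
  show "prob_density (rescale \<epsilon> J)" by (rule prob_density_rescale[OF J e])
  show "0 < 1 / \<epsilon> powr (2 * \<sigma>)" using e by simp
  show "(\<lambda>(t, x). u t x) \<in> borel_measurable (lborel \<Otimes>\<^sub>M lborel)" using u unfolding mild_solution_def by simp
  show "integrable lborel (u t)" if "0 \<le> t" for t using L1w_imp_integrable(1)[OF L k] that by simp
  show "AE x in lborel. u t x = exp ((real DIM('a) - 1 / \<epsilon> powr (2 * \<sigma>)) * t) * u0 (exp t *\<^sub>R x)
      + (LBINT \<tau>:{0..t}. exp ((real DIM('a) - 1 / \<epsilon> powr (2 * \<sigma>)) * (t - \<tau>)) * (1 / \<epsilon> powr (2 * \<sigma>) * conv (rescale \<epsilon> J) (u \<tau>) (exp (t - \<tau>) *\<^sub>R x)))"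
    if "0 \<le> t" for t
    using u that unfolding mild_solution_def transport_def by auto
  fix T :: real
  have i: "integrable lborel (\<lambda>x. jbr x powr k * \<bar>u t x\<bar>)" if "0 \<le> t" for t
    using L[OF that] unfolding L1w_def by simp
  have "continuous_on {0..T} (\<lambda>t. L1w_norm k (u t))"
  proof (rule continuous_on_subset[of "{0..}"], unfold continuous_on_def, safe)
    fix t :: real assume t: "0 \<le> t"
    have "((\<lambda>\<tau>. L1w_norm k (\<lambda>x. u \<tau> x - u t x)) \<longlongrightarrow> 0) (at t within {0..})"
      using u t unfolding mild_solution_def by simp
    then have "((\<lambda>\<tau>. L1w_norm k (u \<tau>) - L1w_norm k (u t)) \<longlongrightarrow> 0) (at t within {0..})"
    proof (rule Lim_null_comparison[rotated])
      have "norm (L1w_norm k (u \<tau>) - L1w_norm k (u t)) \<le> L1w_norm k (\<lambda>x. u \<tau> x - u t x)" if \<tau>: "0 \<le> \<tau>" for \<tau>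
      proof -
        have i2: "integrable lborel (\<lambda>x. jbr x powr k * \<bar>u \<tau> x - u t x\<bar>)"
        proof (rule Bochner_Integration.integrable_bound[OF Bochner_Integration.integrable_add[OF i[OF \<tau>] i[OF t]]])
          have [measurable]: "u \<tau> \<in> borel_measurable borel" "u t \<in> borel_measurable borel"
            using L t \<tau> unfolding L1w_def by auto
          show "(\<lambda>x. jbr x powr k * \<bar>u \<tau> x - u t x\<bar>) \<in> borel_measurable lborel" by measurable
          show "AE x in lborel. norm (jbr x powr k * \<bar>u \<tau> x - u t x\<bar>) \<le> norm (jbr x powr k * \<bar>u \<tau> x\<bar> + jbr x powr k * \<bar>u t x\<bar>)"
            by (intro AE_I2) (auto simp: abs_mult distrib_left[symmetric] intro!: mult_left_mono abs_triangle_ineq4)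
        qed
        have "norm (L1w_norm k (u \<tau>) - L1w_norm k (u t)) = norm (LBINT x. jbr x powr k * \<bar>u \<tau> x\<bar> - jbr x powr k * \<bar>u t x\<bar>)"
          unfolding L1w_norm_def using i \<tau> t by simp
        also have "\<dots> \<le> L1w_norm k (\<lambda>x. u \<tau> x - u t x)"
          unfolding L1w_norm_def
        proof (rule order_trans[OF integral_norm_bound integral_mono_AE'[OF i2]])
          show "AE x in lborel. norm (jbr x powr k * \<bar>u \<tau> x\<bar> - jbr x powr k * \<bar>u t x\<bar>) \<le> jbr x powr k * \<bar>u \<tau> x - u t x\<bar>"
            by (intro AE_I2) (auto simp: abs_mult right_diff_distrib[symmetric] intro!: mult_left_mono)
        qed auto
        finally show ?thesis .
      qed
      then show "\<forall>\<^sub>F \<tau> in at t within {0..}. norm (L1w_norm k (u \<tau>) - L1w_norm k (u t)) \<le> L1w_norm k (\<lambda>x. u \<tau> x - u t x)"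
        by (auto simp: eventually_at_filter)
    qed
    then show "((\<lambda>t. L1w_norm k (u t)) \<longlongrightarrow> L1w_norm k (u t)) (at t within {0..})"
      by (simp only: LIM_zero_iff)
  qed auto
  from compact_imp_bounded[OF compact_continuous_image[OF this]]
  obtain B where "\<And>t. t \<in> {0..T} \<Longrightarrow> \<bar>L1w_norm k (u t)\<bar> \<le> B"
    unfolding bounded_iff by fastforce
  then have "(LBINT x. \<bar>u t x\<bar>) \<le> B" if "t \<in> {0..T}" for t
    using L1w_imp_integrable(2)[OF L k, of t] that by fastforce
  then show "\<exists>B. \<forall>t\<in>{0..T}. (LBINT x. \<bar>u t x\<bar>) \<le> B" by blast
qed (rule u0)

section \<open>Comparison of powers with dyadic cosines\<close>

lemma one_minus_cos_le_powr:
  assumes "0 < M" "M \<le> 1"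
  shows "1 - cos (y::real) \<le> 2 * \<bar>y\<bar> powr M"
proof (cases "\<bar>y\<bar> \<ge> 1")
  case True
  then have "1 \<le> \<bar>y\<bar> powr M" using assms by (intro ge_one_powr_ge_zero) auto
  then show ?thesis using cos_ge_minus_one[of y] by linarith
next
  case False
  show ?thesis
  proof (cases "y = 0")
    case nz: False
    have "1 - cos y \<le> y\<^sup>2 / 2"
    proof -
      have "1 - cos y = 2 * (sin (y / 2))\<^sup>2" using cos_double_sin[of "y / 2"] by simp
      also have "(sin (y / 2))\<^sup>2 \<le> (y / 2)\<^sup>2"
        using abs_sin_x_le_abs_x[of "y / 2"] by (simp only: abs_le_square_iff)
      finally show ?thesis by (simp add: power_divide)
    qed
    also have "y\<^sup>2 = \<bar>y\<bar> powr 2" using nz by simp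
    also have "\<bar>y\<bar> powr 2 \<le> \<bar>y\<bar> powr M" using False assms nz by (intro powr_mono') auto
    also have "\<bar>y\<bar> powr M / 2 \<le> 2 * \<bar>y\<bar> powr M" by simp
    finally show ?thesis by simp
  qed simp
qed

text \<open>Choosing 2^j \<le> |y| < 2^(j+1) puts |y|/2^j into [1, 2), inside [1, pi], where 1 - cos
  is at least 1 - cos 1. The factor 2 bounds the 2^m lost in |y| < 2^(j+1).\<close>

lemma powr_le_dyadic_cosine:
  fixes y :: real
  assumes m: "0 < m" "m \<le> 1" and y: "1 \<le> \<bar>y\<bar>"
  shows "\<exists>j. \<bar>y\<bar> powr m \<le> 2 / (1 - cos 1) * (2 powr m) ^ j * (1 - cos (y / 2 ^ j))"
proof -
  define j where "j = nat \<lfloor>log 2 \<bar>y\<bar>\<rfloor>"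
  have fl: "0 \<le> \<lfloor>log 2 \<bar>y\<bar>\<rfloor>" using y by simp
  have j: "2 ^ j \<le> \<bar>y\<bar>" "\<bar>y\<bar> < 2 ^ Suc j"
  proof -
    have l: "real j \<le> log 2 \<bar>y\<bar>" "log 2 \<bar>y\<bar> < real j + 1" using fl unfolding j_def by linarith+
    have "2 powr real j \<le> \<bar>y\<bar>" using l(1) y by (subst (asm) le_log_iff) auto
    then show "2 ^ j \<le> \<bar>y\<bar>" by (simp add: powr_realpow)
    have "\<bar>y\<bar> < 2 powr (real j + 1)" using l(2) y by (subst (asm) log_less_iff) auto
    then show "\<bar>y\<bar> < 2 ^ Suc j" by (simp add: powr_add powr_realpow)
  qed
  have a: "1 \<le> \<bar>y\<bar> / 2 ^ j" "\<bar>y\<bar> / 2 ^ j \<le> pi"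
  proof -
    show "1 \<le> \<bar>y\<bar> / 2 ^ j" using j(1) by (simp add: field_simps)
    have "(2::real) * 2 ^ j \<le> pi * 2 ^ j" using pi_gt3 by (intro mult_right_mono) auto
    then have "\<bar>y\<bar> \<le> pi * 2 ^ j" using j(2) unfolding power_Suc by linarith
    then show "\<bar>y\<bar> / 2 ^ j \<le> pi" by (simp add: field_simps)
  qed
  have c1: "cos 1 < (1::real)" using cos_monotone_0_pi[of 0 1] pi_gt3 by simp
  have "cos (y / 2 ^ j) = cos (\<bar>y\<bar> / 2 ^ j)" by (cases "y \<ge> 0") auto
  also have "\<dots> \<le> cos 1" using a by (intro cos_monotone_0_pi_le) auto
  finally have c: "1 - cos 1 \<le> 1 - cos (y / 2 ^ j)" by simp
  have "\<bar>y\<bar> powr m \<le> (2 ^ Suc j) powr m" using j m by (intro powr_mono2) auto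
  also have "\<dots> = 2 powr m * (2 powr m) ^ j"
    by (simp add: powr_mult powr_powr powr_realpow[symmetric] mult.commute)
  also have "\<dots> \<le> 2 powr 1 * (2 powr m) ^ j" using m by (intro mult_right_mono powr_mono) auto
  also have "\<dots> = 2 * (2 powr m) ^ j * 1" by simp
  also have "\<dots> \<le> 2 * (2 powr m) ^ j * ((1 - cos (y / 2 ^ j)) / (1 - cos 1))"
    using c c1 by (intro mult_left_mono) (auto simp: field_simps)
  finally show ?thesis by (intro exI[of _ j]) (simp add: field_simps)
qed

lemma jbr_powr_le:
  fixes x :: "'a::euclidean_space"
  assumes m: "0 < m" "m \<le> 1"
  shows "jbr x powr m \<le> (1 + real DIM('a)) * (1 + (\<Sum>b\<in>Basis. \<bar>x \<bullet> b\<bar> powr m))"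
proof -
  have "Max ((\<lambda>b. \<bar>x \<bullet> b\<bar>) ` Basis) \<in> (\<lambda>b. \<bar>x \<bullet> b\<bar>) ` Basis" by (rule Max_in) auto
  then obtain b where b: "b \<in> Basis" "Max ((\<lambda>b. \<bar>x \<bullet> b\<bar>) ` Basis) = \<bar>x \<bullet> b\<bar>" by blast
  have b': "\<bar>x \<bullet> b'\<bar> \<le> \<bar>x \<bullet> b\<bar>" if "b' \<in> Basis" for b'
    unfolding b(2)[symmetric] using that by (intro Max_ge) auto
  have "jbr x \<le> 1 + (\<Sum>b\<in>Basis. \<bar>x \<bullet> b\<bar>)" using jbr_le[of x] norm_le_l1[of x] by linarith
  also have "(\<Sum>b\<in>Basis. \<bar>x \<bullet> b\<bar>) \<le> real DIM('a) * \<bar>x \<bullet> b\<bar>"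
    using sum_bounded_above[of Basis "\<lambda>b. \<bar>x \<bullet> b\<bar>" "\<bar>x \<bullet> b\<bar>"] b' by simp
  also have "1 + real DIM('a) * \<bar>x \<bullet> b\<bar> \<le> (1 + real DIM('a)) * max 1 \<bar>x \<bullet> b\<bar>"
    unfolding distrib_right by (intro add_mono mult_left_mono) auto
  finally have "jbr x powr m \<le> ((1 + real DIM('a)) * max 1 \<bar>x \<bullet> b\<bar>) powr m"
    using jbr_ge_1[of x] m by (intro powr_mono2) auto
  also have "\<dots> = (1 + real DIM('a)) powr m * max 1 \<bar>x \<bullet> b\<bar> powr m" by (rule powr_mult)
  also have "\<dots> \<le> (1 + real DIM('a)) powr 1 * (1 + (\<Sum>b\<in>Basis. \<bar>x \<bullet> b\<bar> powr m))"
  proof (rule mult_mono)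
    show "(1 + real DIM('a)) powr m \<le> (1 + real DIM('a)) powr 1" using m by (intro powr_mono) auto
    have "max 1 \<bar>x \<bullet> b\<bar> powr m \<le> 1 + \<bar>x \<bullet> b\<bar> powr m" by (simp add: max_def)
    also have "\<bar>x \<bullet> b\<bar> powr m \<le> (\<Sum>b\<in>Basis. \<bar>x \<bullet> b\<bar> powr m)"
      using b(1) by (intro member_le_sum) auto
    finally show "max 1 \<bar>x \<bullet> b\<bar> powr m \<le> 1 + (\<Sum>b\<in>Basis. \<bar>x \<bullet> b\<bar> powr m)" by simp
  qed auto
  finally show ?thesis by simp
qed

text \<open>The ray is chosen to arrive at \<open>b\<close> / 2^j at time \<open>T\<close>, so it
  stays in the ball of radius 2^(-j), where the bound on the symbol holds. At time \<tau> its
  frequency carries the factor e^(\<tau> - T), whose power M integrates to at most 1/M whatever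
  \<open>T\<close> is.\<close>

lemma (in mild) dyadic_cosine_bound:
  assumes M: "0 < M" "M \<le> 1" and u0M: "L1w M u0"
    and A: "\<And>\<zeta>. norm \<zeta> \<le> 1 \<Longrightarrow> lam * cmod (1 - fourier K \<zeta>) \<le> A * norm \<zeta> powr M"
    and T: "0 \<le> T" and b: "norm b = 1"
  shows "(LBINT x. \<bar>u T x\<bar> * (1 - cos (x \<bullet> (b /\<^sub>R 2 ^ j))))
    \<le> (2 * L1w_norm M u0 + A / M * (LBINT x. \<bar>u0 x\<bar>)) * (2 powr (- M)) ^ j"
proof -
  have [measurable]: "u0 \<in> borel_measurable borel" using u0 by (auto dest: borel_measurable_integrable)
  define N0 where "N0 = (LBINT x. \<bar>u0 x\<bar>)"
  have N0: "0 \<le> N0" unfolding N0_def by (rule Bochner_Integration.integral_nonneg) simp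
  have A0: "0 \<le> A" using order_trans[OF _ A[of b]] b lam by simp
  define \<xi> where "\<xi> = (exp (- T) / 2 ^ j) *\<^sub>R b"
  have n\<xi>: "norm \<xi> = exp (- T) / 2 ^ j" using b by (simp add: \<xi>_def)
  have \<xi>: "exp T *\<^sub>R \<xi> = b /\<^sub>R 2 ^ j" by (simp add: \<xi>_def exp_minus divide_inverse)
  have j: "(1 / 2 ^ j) powr M = (2 powr (- M)) ^ j"
    by (simp add: powr_minus powr_divide powr_powr powr_realpow[symmetric] mult.commute power_inverse inverse_eq_divide power_one_over)
  have i0: "integrable lborel (\<lambda>x. jbr x powr M * \<bar>u0 x\<bar>)" using u0M unfolding L1w_def by simp
  have "(LBINT x. \<bar>u0 x\<bar> * (1 - cos (x \<bullet> \<xi>))) \<le> (LBINT x. 2 * (2 powr (- M)) ^ j * (jbr x powr M * \<bar>u0 x\<bar>))"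
  proof (rule integral_mono_AE')
    show "integrable lborel (\<lambda>x. 2 * (2 powr (- M)) ^ j * (jbr x powr M * \<bar>u0 x\<bar>))"
      using i0 by (rule integrable_mult_right)
    show "AE x in lborel. \<bar>u0 x\<bar> * (1 - cos (x \<bullet> \<xi>)) \<le> 2 * (2 powr (- M)) ^ j * (jbr x powr M * \<bar>u0 x\<bar>)"
    proof (rule AE_I2)
      fix x :: 'a
      have "exp (- T) \<le> 1" using T by simp
      then have "norm \<xi> \<le> 1 / 2 ^ j" unfolding n\<xi> by (intro divide_right_mono) auto
      then have "\<bar>x \<bullet> \<xi>\<bar> \<le> (1 / 2 ^ j) * jbr x"
        using Cauchy_Schwarz_ineq2[of x \<xi>] mult_mono[OF jbr_ge_norm[of x], of "norm \<xi>" "1 / 2 ^ j"] jbr_ge_1[of x]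
        by (simp add: mult.commute)
      then have "\<bar>x \<bullet> \<xi>\<bar> powr M \<le> ((1 / 2 ^ j) * jbr x) powr M" using M by (intro powr_mono2) auto
      also have "\<dots> = (2 powr (- M)) ^ j * jbr x powr M" using jbr_ge_1[of x] by (simp only: powr_mult j)
      finally have "1 - cos (x \<bullet> \<xi>) \<le> 2 * ((2 powr (- M)) ^ j * jbr x powr M)"
        using one_minus_cos_le_powr[OF M, of "x \<bullet> \<xi>"] by linarith
      from mult_left_mono[OF this, of "\<bar>u0 x\<bar>"]
      show "\<bar>u0 x\<bar> * (1 - cos (x \<bullet> \<xi>)) \<le> 2 * (2 powr (- M)) ^ j * (jbr x powr M * \<bar>u0 x\<bar>)"
        by (simp only: abs_ge_zero mult_ac simp_thms)
    qed
    show "AE x in lborel. 0 \<le> 2 * (2 powr (- M)) ^ j * (jbr x powr M * \<bar>u0 x\<bar>)" by simp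
  qed
  also have "\<dots> = 2 * (2 powr (- M)) ^ j * L1w_norm M u0"
    unfolding L1w_norm_def by (rule integral_mult_right_zero)
  finally have 1: "(LBINT x. \<bar>u0 x\<bar> * (1 - cos (x \<bullet> \<xi>))) \<le> 2 * (2 powr (- M)) ^ j * L1w_norm M u0" .
  have cont: "continuous_on {0..T} (\<lambda>\<tau>. lam * (cmod (1 - fourier K (exp \<tau> *\<^sub>R \<xi>)) * N0))"
    by (intro continuous_intros continuous_on_compose2[OF continuous_on_fourier[OF K_facts(2)]]) auto
  have hi: "((\<lambda>\<tau>. (A * N0 * (2 powr (- M)) ^ j) * exp (M * (\<tau> - T))) has_integral
     (A * N0 * (2 powr (- M)) ^ j) * (exp (M * (T - T)) / M - exp (M * (0 - T)) / M)) {0..T}"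
    using M T by (intro has_integral_mult_right fundamental_theorem_of_calculus)
      (auto intro!: derivative_eq_intros simp: has_real_derivative_iff_has_vector_derivative[symmetric])
  have "integral {0..T} (\<lambda>\<tau>. lam * (cmod (1 - fourier K (exp \<tau> *\<^sub>R \<xi>)) * N0))
     \<le> integral {0..T} (\<lambda>\<tau>. (A * N0 * (2 powr (- M)) ^ j) * exp (M * (\<tau> - T)))"
  proof (rule integral_le[OF integrable_continuous_real[OF cont] has_integral_integrable[OF hi]])
    fix \<tau> assume \<tau>: "\<tau> \<in> {0..T}"
    have n: "norm (exp \<tau> *\<^sub>R \<xi>) = exp (\<tau> - T) * (1 / 2 ^ j)"
      using n\<xi> by (simp add: exp_diff exp_minus field_simps)
    have "exp (\<tau> - T) * (1 / 2 ^ j) \<le> 1 * 1" using \<tau> by (intro mult_mono) auto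
    then have "lam * cmod (1 - fourier K (exp \<tau> *\<^sub>R \<xi>)) \<le> A * norm (exp \<tau> *\<^sub>R \<xi>) powr M"
      by (intro A) (simp only: n mult_1_right)
    also have "norm (exp \<tau> *\<^sub>R \<xi>) powr M = exp (M * (\<tau> - T)) * (2 powr (- M)) ^ j"
      unfolding n powr_mult j by (simp add: exp_powr_real mult.commute)
    finally show "lam * (cmod (1 - fourier K (exp \<tau> *\<^sub>R \<xi>)) * N0) \<le> (A * N0 * (2 powr (- M)) ^ j) * exp (M * (\<tau> - T))"
      using mult_right_mono[OF _ N0] by (fastforce simp: mult_ac)
  qed
  also have "\<dots> = (A * N0 * (2 powr (- M)) ^ j) * (exp (M * (T - T)) / M - exp (M * (0 - T)) / M)"
    by (rule integral_unique[OF hi])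
  also have "\<dots> \<le> (A * N0 * (2 powr (- M)) ^ j) * (1 / M)"
    using M A0 N0 by (intro mult_left_mono) auto
  finally have 2: "integral {0..T} (\<lambda>\<tau>. lam * (cmod (1 - fourier K (exp \<tau> *\<^sub>R \<xi>)) * N0)) \<le> (A * N0 * (2 powr (- M)) ^ j) * (1 / M)" .
  have "(LBINT x. \<bar>u T x\<bar> * (1 - cos (x \<bullet> (b /\<^sub>R 2 ^ j)))) \<le> 2 * (2 powr (- M)) ^ j * L1w_norm M u0 + (A * N0 * (2 powr (- M)) ^ j) * (1 / M)"
    using cosine_bound[OF T, of \<xi>, folded N0_def] 1 2 unfolding \<xi> by linarith
  then show ?thesis unfolding N0_def[symmetric] by (simp add: algebra_simps)
qed

text \<open>Weighting scale j by 2^(jm) against the gain 2^(-jM) leaves a geometric series of ratio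
  2^(m-M), which converges because m < M. Finiteness of the moment is part of the claim, hence the
  work with nonnegative integrals. The order of quantifiers records that kernel and jump rate enter
  the bound only through \<open>A\<close>.\<close>

lemma moment_bound:
  fixes u0 :: "'a::euclidean_space \<Rightarrow> real"
  assumes m: "0 < m" "m < M" "M \<le> 1" and u0M: "L1w M u0"
  shows "\<exists>C. \<forall>K lam u. mild K lam u0 u \<and> (\<forall>\<zeta>. norm \<zeta> \<le> 1 \<longrightarrow> lam * cmod (1 - fourier K \<zeta>) \<le> A * norm \<zeta> powr M)
    \<longrightarrow> (\<forall>t\<ge>0. L1w m (u t) \<and> L1w_norm m (u t) \<le> C)"
proof -
  define N0 where "N0 = (LBINT x. \<bar>u0 x\<bar>)"
  define D where "D = \<bar>2 * L1w_norm M u0 + A / M * N0\<bar>"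
  define c where "c = 2 / (1 - cos (1::real))"
  have "cos 1 < (1::real)" using cos_monotone_0_pi[of 0 1] pi_gt3 by simp
  then have c: "0 < c" unfolding c_def by simp
  define \<rho> where "\<rho> = (2::real) powr m * 2 powr (- M)"
  have "\<rho> < 2 powr 0" unfolding \<rho>_def powr_add[symmetric] using m by (intro powr_less_mono) auto
  then have \<rho>: "0 < \<rho>" "\<rho> < 1" unfolding \<rho>_def by auto
  have N0: "0 \<le> N0" unfolding N0_def by (rule Bochner_Integration.integral_nonneg) simp
  define S where "S = N0 + c * D * (1 / (1 - \<rho>))"
  have S: "0 \<le> S" unfolding S_def using N0 c \<rho> by (auto simp: D_def intro!: add_nonneg_nonneg mult_nonneg_nonneg)
  define C where "C = (1 + real DIM('a)) * (N0 + real DIM('a) * S)"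
  have "L1w m (u t) \<and> L1w_norm m (u t) \<le> C"
    if mild: "mild K lam u0 u" and A: "\<And>\<zeta>. norm \<zeta> \<le> 1 \<Longrightarrow> lam * cmod (1 - fourier K \<zeta>) \<le> A * norm \<zeta> powr M"
      and t: "0 \<le> t" for K lam u t
  proof -
    interpret mild K lam u0 u by (rule mild)
    have [measurable]: "u t \<in> borel_measurable borel" using int[OF t] by (auto dest: borel_measurable_integrable)
    have N: "(\<integral>\<^sup>+x. ennreal \<bar>u t x\<bar> \<partial>lborel) \<le> ennreal N0"
      using mass_bound[OF t] int[OF t] unfolding N0_def by (subst nn_integral_eq_integral) (auto intro: ennreal_leI)
    define r where "r b j x = \<bar>u t x\<bar> * (1 - cos (x \<bullet> (b /\<^sub>R 2 ^ j)))" for b :: 'a and j :: nat and x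
    have r0: "0 \<le> r b j x" for b j x unfolding r_def using cos_le_one by (intro mult_nonneg_nonneg) auto
    have [measurable]: "r b j \<in> borel_measurable borel" for b j unfolding r_def by measurable
    have ri: "integrable lborel (r b j)" for b j
    proof (rule Bochner_Integration.integrable_bound)
      show "integrable lborel (\<lambda>x. 2 * u t x)" using int[OF t] by simp
      have "\<bar>1 - cos y\<bar> \<le> 2" for y :: real using cos_le_one[of y] cos_ge_minus_one[of y] by linarith
      then have "\<bar>u t x\<bar> * \<bar>1 - cos y\<bar> \<le> \<bar>u t x\<bar> * 2" for x y by (intro mult_left_mono) auto
      then show "AE x in lborel. norm (r b j x) \<le> norm (2 * u t x)"
        unfolding r_def by (intro AE_I2) (simp add: abs_mult mult.commute[of _ 2])
    qed simp
    have rb: "(\<integral>\<^sup>+x. ennreal (r b j x) \<partial>lborel) \<le> ennreal (D * (2 powr (- M)) ^ j)" if b: "b \<in> Basis" for b j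
    proof -
      have "(LBINT x. r b j x) \<le> (2 * L1w_norm M u0 + A / M * N0) * (2 powr (- M)) ^ j"
        unfolding r_def N0_def using m b by (intro dyadic_cosine_bound u0M A t) auto
      also have "\<dots> \<le> D * (2 powr (- M)) ^ j" unfolding D_def by (intro mult_right_mono) auto
      finally show ?thesis using ri r0 by (subst nn_integral_eq_integral) (auto intro: ennreal_leI)
    qed
    have coord: "(\<integral>\<^sup>+x. ennreal (\<bar>x \<bullet> b\<bar> powr m * \<bar>u t x\<bar>) \<partial>lborel) \<le> ennreal S" if b: "b \<in> Basis" for b
    proof -
      have "ennreal (\<bar>x \<bullet> b\<bar> powr m * \<bar>u t x\<bar>) \<le> ennreal \<bar>u t x\<bar> + (\<Sum>j. ennreal (c * (2 powr m) ^ j * r b j x))" for x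
      proof (cases "\<bar>x \<bullet> b\<bar> \<ge> 1")
        case True
        obtain j where j: "\<bar>x \<bullet> b\<bar> powr m \<le> c * (2 powr m) ^ j * (1 - cos ((x \<bullet> b) / 2 ^ j))"
          using powr_le_dyadic_cosine[OF m(1) _ True] m unfolding c_def by fastforce
        have "\<bar>x \<bullet> b\<bar> powr m * \<bar>u t x\<bar> \<le> (c * (2 powr m) ^ j * (1 - cos ((x \<bullet> b) / 2 ^ j))) * \<bar>u t x\<bar>"
          by (intro mult_right_mono j) auto
        also have "\<dots> = c * (2 powr m) ^ j * r b j x" unfolding r_def by (simp add: divide_inverse mult_ac)
        finally have "ennreal (\<bar>x \<bullet> b\<bar> powr m * \<bar>u t x\<bar>) \<le> ennreal (c * (2 powr m) ^ j * r b j x)" by (rule ennreal_leI)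
        \<comment> \<open>A single scale suffices at each point, but it varies with the point; the
          sum over all scales dominates it since its terms are nonnegative.\<close>
        also have "\<dots> \<le> (\<Sum>j. ennreal (c * (2 powr m) ^ j * r b j x))"
          using sum_le_suminf[of "\<lambda>j. ennreal (c * (2 powr m) ^ j * r b j x)" "{j}"] by simp
        finally show ?thesis by (simp add: add_increasing)
      next
        case False
        then have "\<bar>x \<bullet> b\<bar> powr m \<le> 1" using m by (intro powr_le1) auto
        then have "ennreal (\<bar>x \<bullet> b\<bar> powr m * \<bar>u t x\<bar>) \<le> ennreal \<bar>u t x\<bar>"
          by (intro ennreal_leI) (auto intro: mult_left_le_one_le)
        then show ?thesis by (simp add: add_increasing2)
      qed
      then have "(\<integral>\<^sup>+x. ennreal (\<bar>x \<bullet> b\<bar> powr m * \<bar>u t x\<bar>) \<partial>lborel)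
        \<le> (\<integral>\<^sup>+x. ennreal \<bar>u t x\<bar> + (\<Sum>j. ennreal (c * (2 powr m) ^ j * r b j x)) \<partial>lborel)"
        by (rule nn_integral_mono)
      also have "\<dots> = (\<integral>\<^sup>+x. ennreal \<bar>u t x\<bar> \<partial>lborel) + (\<Sum>j. \<integral>\<^sup>+x. ennreal (c * (2 powr m) ^ j * r b j x) \<partial>lborel)"
        by (subst nn_integral_add) (auto simp: nn_integral_suminf)
      also have "\<dots> \<le> ennreal N0 + (\<Sum>j. ennreal (c * D * \<rho> ^ j))"
      proof (intro add_mono N suminf_le)
        fix j
        have "(\<integral>\<^sup>+x. ennreal (c * (2 powr m) ^ j * r b j x) \<partial>lborel) = ennreal (c * (2 powr m) ^ j) * (\<integral>\<^sup>+x. ennreal (r b j x) \<partial>lborel)"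
          using c r0 by (subst nn_integral_cmult[symmetric]) (auto simp: ennreal_mult)
        also have "\<dots> \<le> ennreal (c * (2 powr m) ^ j) * ennreal (D * (2 powr (- M)) ^ j)"
          by (intro mult_left_mono rb b) simp
        also have "\<dots> = ennreal (c * D * \<rho> ^ j)"
          using c by (subst ennreal_mult[symmetric]) (auto simp: D_def \<rho>_def power_mult_distrib mult_ac)
        finally show "(\<integral>\<^sup>+x. ennreal (c * (2 powr m) ^ j * r b j x) \<partial>lborel) \<le> ennreal (c * D * \<rho> ^ j)" .
      qed auto
      also have "(\<Sum>j. ennreal (c * D * \<rho> ^ j)) = ennreal (c * D * (1 / (1 - \<rho>)))"
        using c \<rho> by (intro suminf_ennreal_eq sums_mult geometric_sums) (auto simp: D_def)
      also have "ennreal N0 + ennreal (c * D * (1 / (1 - \<rho>))) = ennreal S"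
        unfolding S_def using N0 c \<rho> by (subst ennreal_plus) (auto simp: D_def)
      finally show ?thesis .
    qed
    have "(\<integral>\<^sup>+x. ennreal (jbr x powr m * \<bar>u t x\<bar>) \<partial>lborel)
      \<le> (\<integral>\<^sup>+x. ennreal (1 + real DIM('a)) * (ennreal \<bar>u t x\<bar> + (\<Sum>b\<in>Basis. ennreal (\<bar>x \<bullet> b\<bar> powr m * \<bar>u t x\<bar>))) \<partial>lborel)"
    proof (rule nn_integral_mono)
      fix x :: 'a
      have "jbr x powr m * \<bar>u t x\<bar> \<le> ((1 + real DIM('a)) * (1 + (\<Sum>b\<in>Basis. \<bar>x \<bullet> b\<bar> powr m))) * \<bar>u t x\<bar>"
        using m by (intro mult_right_mono jbr_powr_le) auto
      also have "\<dots> = (1 + real DIM('a)) * (\<bar>u t x\<bar> + (\<Sum>b\<in>Basis. \<bar>x \<bullet> b\<bar> powr m * \<bar>u t x\<bar>))"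
        by (simp add: distrib_right distrib_left sum_distrib_right)
      finally show "ennreal (jbr x powr m * \<bar>u t x\<bar>) \<le> ennreal (1 + real DIM('a)) * (ennreal \<bar>u t x\<bar> + (\<Sum>b\<in>Basis. ennreal (\<bar>x \<bullet> b\<bar> powr m * \<bar>u t x\<bar>)))"
        by (subst sum_ennreal, simp, subst ennreal_plus[symmetric], simp, simp add: sum_nonneg, subst ennreal_mult[symmetric])
           (auto intro!: ennreal_leI add_nonneg_nonneg sum_nonneg)
    qed
    also have "\<dots> = ennreal (1 + real DIM('a)) * ((\<integral>\<^sup>+x. ennreal \<bar>u t x\<bar> \<partial>lborel) + (\<Sum>b\<in>Basis. \<integral>\<^sup>+x. ennreal (\<bar>x \<bullet> b\<bar> powr m * \<bar>u t x\<bar>) \<partial>lborel))"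
      by (subst nn_integral_cmult, measurable, subst nn_integral_add, measurable, subst nn_integral_sum, measurable)
    also have "\<dots> \<le> ennreal (1 + real DIM('a)) * (ennreal N0 + (\<Sum>b\<in>(Basis::'a set). ennreal S))"
      by (intro mult_left_mono add_mono N sum_mono coord) auto
    also have "\<dots> = ennreal C"
      unfolding C_def using N0 S by (simp add: ennreal_mult ennreal_plus ennreal_of_nat_eq_real_of_nat)
    finally have le: "(\<integral>\<^sup>+x. ennreal (jbr x powr m * \<bar>u t x\<bar>) \<partial>lborel) \<le> ennreal C" .
    have C: "0 \<le> C" unfolding C_def using N0 S by simp
    have "integrable lborel (\<lambda>x. jbr x powr m * \<bar>u t x\<bar>)"
      by (rule integrableI_bounded) (use le in \<open>auto simp: le_less_trans[OF _ ennreal_less_top]\<close>)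
    moreover have "(LBINT x. jbr x powr m * \<bar>u t x\<bar>) \<le> C"
      by (rule integral_real_bounded[OF C le])
    ultimately show ?thesis unfolding L1w_def L1w_norm_def by simp
  qed
  then show ?thesis by blast
qed

section \<open>Symbols of the rescaled operators\<close>

lemma powr_between:
  fixes y :: real
  assumes "0 < y" "a \<le> p" "p \<le> b"
  shows "y powr p \<le> y powr a + y powr b"
proof (cases "y \<le> 1")
  case True
  then have "y powr p \<le> y powr a" using assms by (intro powr_mono') auto
  then show ?thesis by (simp add: add_increasing2)
next
  case False
  then have "y powr p \<le> y powr b" using assms by (intro powr_mono) auto
  then show ?thesis by (simp add: add_increasing)
qed

lemma neg_ln_le_powr:
  fixes z :: real
  assumes "0 < z" "z \<le> 1" "0 < a"
  shows "- ln z \<le> z powr (- a) / a"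
  using ln_powr_bound[of "1 / z" a] assms by (simp add: ln_div powr_divide powr_minus_divide)

text \<open>Here \<open>z\<close> stands for \<epsilon>|\<eta>| and \<open>y\<close> for |\<eta>|.
  Near 0 the logarithm is absorbed by z^\<delta>, at infinity it costs an extra power \<kappa>;
  passing from \<open>z\<close> to \<open>y\<close> removes \<epsilon> from the bound.\<close>

lemma powr_mult_max_ln_le:
  fixes y z :: real
  assumes z: "0 < z" "z \<le> y" and d: "0 < \<delta>" and k: "0 < \<kappa>"
  shows "z powr \<delta> * max 1 \<bar>ln z\<bar> \<le> (1 + 1 / \<delta> + 1 / \<kappa>) * (1 + y powr (\<delta> + \<kappa>))"
proof (cases "z \<le> 1")
  case True
  have 1: "z powr \<delta> \<le> 1" using z True d by (intro powr_le1) auto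
  have "z powr \<delta> * (- ln z) \<le> z powr \<delta> * (z powr (- \<delta>) / \<delta>)"
    using neg_ln_le_powr[OF z(1) True d] by (intro mult_left_mono) auto
  also have "\<dots> = 1 / \<delta>" using z by (simp add: powr_minus)
  finally have "z powr \<delta> * \<bar>ln z\<bar> \<le> 1 / \<delta>" using z True by simp
  then have "z powr \<delta> * max 1 \<bar>ln z\<bar> \<le> 1 + 1 / \<delta>" using 1 d by (auto simp: max_def add_increasing add_increasing2)
  also have "\<dots> \<le> (1 + 1 / \<delta> + 1 / \<kappa>) * 1" using k by simp
  also have "\<dots> \<le> (1 + 1 / \<delta> + 1 / \<kappa>) * (1 + y powr (\<delta> + \<kappa>))"
    using d k by (intro mult_left_mono) auto
  finally show ?thesis .
next
  case False
  have "max 1 \<bar>ln z\<bar> \<le> z powr \<kappa> * (1 + 1 / \<kappa>)"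
  proof -
    have "ln z \<le> z powr \<kappa> / \<kappa>" using False k by (intro ln_powr_bound) auto
    moreover have "1 \<le> z powr \<kappa>" using False k by (intro ge_one_powr_ge_zero) auto
    moreover have "0 \<le> z powr \<kappa> / \<kappa>" using k by simp
    ultimately show ?thesis using False by (auto simp: distrib_left)
  qed
  then have "z powr \<delta> * max 1 \<bar>ln z\<bar> \<le> z powr \<delta> * (z powr \<kappa> * (1 + 1 / \<kappa>))"
    by (rule mult_left_mono) simp
  also have "\<dots> = (1 + 1 / \<kappa>) * z powr (\<delta> + \<kappa>)" by (simp add: powr_add)
  also have "\<dots> \<le> (1 + 1 / \<delta> + 1 / \<kappa>) * (1 + y powr (\<delta> + \<kappa>))"
  proof (rule mult_mono)
    have "z powr (\<delta> + \<kappa>) \<le> y powr (\<delta> + \<kappa>)" using z d k by (intro powr_mono2) auto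
    then show "z powr (\<delta> + \<kappa>) \<le> 1 + y powr (\<delta> + \<kappa>)" by simp
  qed (use d k in auto)
  finally show ?thesis .
qed

lemma abs_powr_diff_le:
  fixes y :: real
  assumes "0 < y"
  shows "\<bar>y powr a - y powr b\<bar> \<le> \<bar>a - b\<bar> * \<bar>ln y\<bar> * (y powr a + y powr b)"
proof -
  have *: "exp u - exp v \<le> \<bar>u - v\<bar> * (exp u + exp v)" for u v :: real
  proof -
    have "exp u * (1 + (v - u)) \<le> exp u * exp (v - u)" by (intro mult_left_mono exp_ge_add_one_self) auto
    also have "\<dots> = exp v" by (simp add: exp_add[symmetric])
    finally have "exp u - exp v \<le> (u - v) * exp u" by (simp add: algebra_simps)
    also have "\<dots> \<le> \<bar>u - v\<bar> * (exp u + exp v)" by (intro mult_mono) auto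
    finally show ?thesis .
  qed
  have "\<bar>exp (a * ln y) - exp (b * ln y)\<bar> \<le> \<bar>a * ln y - b * ln y\<bar> * (exp (a * ln y) + exp (b * ln y))"
    using *[of "a * ln y" "b * ln y"] *[of "b * ln y" "a * ln y"] by (auto simp: abs_le_iff abs_minus_commute add.commute)
  also have "\<bar>a * ln y - b * ln y\<bar> = \<bar>a - b\<bar> * \<bar>ln y\<bar>" by (simp add: abs_mult[symmetric] left_diff_distrib)
  finally show ?thesis using assms by (simp add: powr_def)
qed

text \<open>Near 0 the logarithm may cost half a power, as both exponents are larger than 1; at
  infinity it costs \<kappa>. The exponent 1/2 left at the origin is positive, which makes later
  integrals along rays bounded uniformly in their length.\<close>

lemma abs_ln_mult_powr_le:
  fixes y :: real
  assumes y: "0 < y" and s: "1 / 2 < s" "s < 1" and k: "0 < \<kappa>" and d: "0 < \<delta>"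
  shows "\<bar>ln y\<bar> * (y powr (2 * s) + y powr 2) \<le> (4 + 2 / \<kappa>) * (y powr (1 / 2) + y powr (2 + \<delta> + \<kappa>))"
proof (cases "y \<le> 1")
  case True
  have "\<bar>ln y\<bar> \<le> 2 * y powr (- (1 / 2))" using neg_ln_le_powr[OF y True, of "1 / 2"] y True by simp
  then have "\<bar>ln y\<bar> * (y powr (2 * s) + y powr 2) \<le> (2 * y powr (- (1 / 2))) * (y powr 1 + y powr 1)"
    using y s True by (intro mult_mono add_mono powr_mono') auto
  also have "\<dots> = 4 * (y powr (- (1 / 2)) * y powr 1)" by simp
  also have "y powr (- (1 / 2)) * y powr 1 = y powr (1 / 2)" unfolding powr_add[symmetric] by simp
  also have "4 * y powr (1 / 2) \<le> (4 + 2 / \<kappa>) * (y powr (1 / 2) + y powr (2 + \<delta> + \<kappa>))"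
    using k by (intro mult_mono) auto
  finally show ?thesis .
next
  case False
  have "\<bar>ln y\<bar> \<le> y powr \<kappa> / \<kappa>" using ln_powr_bound[of y \<kappa>] False k by simp
  then have "\<bar>ln y\<bar> * (y powr (2 * s) + y powr 2) \<le> (y powr \<kappa> / \<kappa>) * (y powr (2 + \<delta>) + y powr (2 + \<delta>))"
    using y s False k d by (intro mult_mono add_mono powr_mono) auto
  also have "\<dots> = 2 / \<kappa> * (y powr (2 + \<delta> + \<kappa>))" by (simp add: powr_add)
  also have "\<dots> \<le> (4 + 2 / \<kappa>) * (y powr (1 / 2) + y powr (2 + \<delta> + \<kappa>))"
    using k by (intro mult_mono) auto
  finally show ?thesis .
qed

text \<open>Scaling turns the two symbols into |\<eta>|^(2s) \<open>gs\<close> and |\<eta>|^2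
  \<open>g1\<close>, with the quotients of (H2) taken at \<epsilon>\<eta>, so all negative powers of
  \<epsilon> cancel. The difference splits into |\<eta>|^(2s) (gs - g1), controlled by (H2), and
  (|\<eta>|^(2s) - |\<eta>|^2) g1, where \<open>g1\<close> is bounded by the expansion at small
  arguments and by |1 - G| \<le> 2 at large ones.\<close>

lemma symbol_diff:
  fixes F G :: "'a::real_normed_vector \<Rightarrow> complex"
  assumes d: "0 < \<delta>" and C0: "0 < C0" and CC: "0 < CC" and k: "0 < \<kappa>" and s: "1 / 2 < s" "s < 1"
    and e: "0 < \<epsilon>" "\<epsilon> \<le> 1" and 0: "F 0 = 1" "G 0 = 1" and G2: "\<And>\<xi>. cmod (1 - G \<xi>) \<le> 2"
    and G: "\<And>\<xi>. norm \<xi> \<le> 1 \<Longrightarrow> cmod (G \<xi> - complex_of_real (1 - (norm \<xi>)\<^sup>2)) \<le> C0 * norm \<xi> powr (2 + \<delta>)"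
    and FG: "\<And>\<xi>. \<xi> \<noteq> 0 \<Longrightarrow> cmod ((1 - F \<xi>) / complex_of_real (norm \<xi> powr (2 * s))
              - (1 - G \<xi>) / complex_of_real ((norm \<xi>)\<^sup>2))
        \<le> CC * (1 - s) * norm \<xi> powr \<delta> * max 1 \<bar>ln (norm \<xi>)\<bar>"
  shows "cmod ((1 / \<epsilon> powr (2 * s)) *\<^sub>R (1 - F (\<epsilon> *\<^sub>R \<eta>)) - (1 / \<epsilon> powr (2 * 1)) *\<^sub>R (1 - G (\<epsilon> *\<^sub>R \<eta>)))
    \<le> (2 * CC * (1 + 1 / \<delta> + 1 / \<kappa>) + 2 * (4 + 2 / \<kappa>) * (2 + C0)) * (1 - s)
       * (norm \<eta> powr (1 / 2) + norm \<eta> powr (2 + \<delta> + \<kappa>))"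
proof (cases "\<eta> = 0")
  case True
  then show ?thesis using 0 by simp
next
  case False
  define y where "y = norm \<eta>"
  define z where "z = \<epsilon> * y"
  have y: "0 < y" using False by (simp add: y_def)
  have z: "0 < z" "z \<le> y" using e y unfolding z_def by (auto intro: mult_left_le_one_le)
  have nz: "norm (\<epsilon> *\<^sub>R \<eta>) = z" using e by (simp add: z_def y_def)
  define P where "P = y powr (1 / 2) + y powr (2 + \<delta> + \<kappa>)"
  define gs where "gs = (1 - F (\<epsilon> *\<^sub>R \<eta>)) / complex_of_real (z powr (2 * s))"
  define g1 where "g1 = (1 - G (\<epsilon> *\<^sub>R \<eta>)) / complex_of_real (z\<^sup>2)"
  have as: "(1 / \<epsilon> powr (2 * s)) *\<^sub>R (1 - F (\<epsilon> *\<^sub>R \<eta>)) = y powr (2 * s) *\<^sub>R gs"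
    using e y z unfolding gs_def by (simp add: z_def powr_mult scaleR_conv_of_real)
  have a1: "(1 / \<epsilon> powr (2 * 1)) *\<^sub>R (1 - G (\<epsilon> *\<^sub>R \<eta>)) = y powr 2 *\<^sub>R g1"
    using e y z unfolding g1_def by (simp add: z_def power_mult_distrib scaleR_conv_of_real)
  have diff: "cmod (gs - g1) \<le> CC * (1 - s) * z powr \<delta> * max 1 \<bar>ln z\<bar>"
    using FG[of "\<epsilon> *\<^sub>R \<eta>"] False e unfolding nz gs_def g1_def by simp
  have g1: "cmod g1 \<le> 2 + C0"
  proof (cases "z \<le> 1")
    case True
    have "cmod (1 - G (\<epsilon> *\<^sub>R \<eta>)) \<le> cmod (complex_of_real (z\<^sup>2)) + cmod (G (\<epsilon> *\<^sub>R \<eta>) - complex_of_real (1 - z\<^sup>2))"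
      using norm_triangle_ineq4[of "complex_of_real (z\<^sup>2)" "G (\<epsilon> *\<^sub>R \<eta>) - complex_of_real (1 - z\<^sup>2)"] by simp
    also have "\<dots> \<le> z\<^sup>2 + C0 * z powr (2 + \<delta>)" using G[of "\<epsilon> *\<^sub>R \<eta>"] True unfolding nz by (simp add: norm_power)
    also have "z powr (2 + \<delta>) \<le> z powr 2" using z True d by (intro powr_mono') auto
    also have "z powr 2 = z\<^sup>2" using z by simp
    finally have "cmod (1 - G (\<epsilon> *\<^sub>R \<eta>)) \<le> (1 + C0) * z\<^sup>2" using C0 by (simp add: algebra_simps)
    then show ?thesis using z unfolding g1_def by (simp add: norm_divide norm_power divide_le_eq) (smt (verit) mult_right_mono zero_le_power2)
  next
    case False
    then have "1 \<le> z\<^sup>2" by simp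
    then have "2 \<le> (2 + C0) * z\<^sup>2" using mult_mono[of 2 "2 + C0" 1 "z\<^sup>2"] C0 by simp
    then show ?thesis using z G2[of "\<epsilon> *\<^sub>R \<eta>"] unfolding g1_def by (simp add: norm_divide norm_power divide_le_eq)
  qed
  have t1: "y powr (2 * s) * cmod (gs - g1) \<le> 2 * CC * (1 + 1 / \<delta> + 1 / \<kappa>) * (1 - s) * P"
  proof -
    have "y powr (2 * s) * cmod (gs - g1) \<le> y powr (2 * s) * (CC * (1 - s) * ((1 + 1 / \<delta> + 1 / \<kappa>) * (1 + y powr (\<delta> + \<kappa>))))"
      using powr_mult_max_ln_le[OF z d k] CC s
      by (intro mult_left_mono order_trans[OF diff]) (simp_all add: mult.assoc)
    also have "\<dots> = CC * (1 + 1 / \<delta> + 1 / \<kappa>) * (1 - s) * (y powr (2 * s) + y powr (2 * s + (\<delta> + \<kappa>)))"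
    proof -
      have "y powr (2 * s) * (CC * (1 - s) * (E * (1 + w))) = CC * E * (1 - s) * (y powr (2 * s) + y powr (2 * s) * w)" for E w
        by (simp add: algebra_simps)
      then show ?thesis by (simp only: powr_add)
    qed
    also have "\<dots> \<le> CC * (1 + 1 / \<delta> + 1 / \<kappa>) * (1 - s) * (P + P)"
    proof (rule mult_left_mono[OF add_mono])
      show "y powr (2 * s) \<le> P" "y powr (2 * s + (\<delta> + \<kappa>)) \<le> P"
        unfolding P_def using y s d k by (intro powr_between; simp)+
      show "0 \<le> CC * (1 + 1 / \<delta> + 1 / \<kappa>) * (1 - s)"
        using CC d k s by (intro mult_nonneg_nonneg add_nonneg_nonneg) auto
    qed
    finally show ?thesis by (simp add: mult_ac)
  qed
  have t2: "\<bar>y powr (2 * s) - y powr 2\<bar> * cmod g1 \<le> 2 * (4 + 2 / \<kappa>) * (2 + C0) * (1 - s) * P"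
  proof -
    have "\<bar>y powr (2 * s) - y powr 2\<bar> \<le> \<bar>2 * s - 2\<bar> * (\<bar>ln y\<bar> * (y powr (2 * s) + y powr 2))"
      using abs_powr_diff_le[OF y, of "2 * s" 2] by (simp add: mult.assoc)
    also have "\<dots> \<le> \<bar>2 * s - 2\<bar> * ((4 + 2 / \<kappa>) * P)"
      unfolding P_def by (intro mult_left_mono abs_ln_mult_powr_le y s k d) auto
    also have "\<bar>2 * s - 2\<bar> = 2 * (1 - s)" using s by simp
    finally have "\<bar>y powr (2 * s) - y powr 2\<bar> * cmod g1 \<le> (2 * (1 - s) * ((4 + 2 / \<kappa>) * P)) * (2 + C0)"
      using g1 s k unfolding P_def by (intro mult_mono) auto
    then show ?thesis by (simp only: mult_ac)
  qed
  have "y powr (2 * s) *\<^sub>R gs - y powr 2 *\<^sub>R g1 = y powr (2 * s) *\<^sub>R (gs - g1) + (y powr (2 * s) - y powr 2) *\<^sub>R g1"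
    by (simp add: algebra_simps)
  then have "cmod (y powr (2 * s) *\<^sub>R gs - y powr 2 *\<^sub>R g1) \<le> y powr (2 * s) * cmod (gs - g1) + \<bar>y powr (2 * s) - y powr 2\<bar> * cmod g1"
    using norm_triangle_ineq[of "y powr (2 * s) *\<^sub>R (gs - g1)" "(y powr (2 * s) - y powr 2) *\<^sub>R g1"] by simp
  also have "\<dots> \<le> (2 * CC * (1 + 1 / \<delta> + 1 / \<kappa>) + 2 * (4 + 2 / \<kappa>) * (2 + C0)) * (1 - s) * P"
    using add_mono[OF t1 t2] by (simp add: distrib_right)
  finally show ?thesis unfolding as a1 P_def y_def .
qed

section \<open>Probability densities and the order of their expansion\<close>

lemma prob_densityD:
  assumes "prob_density J"
  shows "J \<in> borel_measurable borel" "0 \<le> J x" "integrable lborel J" "(LBINT x. J x) = 1"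
  using assms unfolding prob_density_def by auto

lemma integrable_density_bounded:
  fixes g :: "'a::euclidean_space \<Rightarrow> real"
  assumes J: "prob_density J" and [measurable]: "g \<in> borel_measurable borel" and g: "\<And>x. \<bar>g x\<bar> \<le> B"
  shows "integrable lborel (\<lambda>x. J x * g x)"
proof (rule Bochner_Integration.integrable_bound)
  have [measurable]: "J \<in> borel_measurable borel" by (rule prob_densityD[OF J])
  have B: "0 \<le> B" using order_trans[OF abs_ge_zero g] .
  show "integrable lborel (\<lambda>x. J x * B)" using prob_densityD(3)[OF J] by simp
  show "AE x in lborel. norm (J x * g x) \<le> norm (J x * B)"
    using B g by (intro AE_I2) (auto simp: abs_mult intro!: mult_left_mono)
qed (use prob_densityD(1)[OF J] in simp)

lemma Re_fourier:
  assumes J: "prob_density J"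
  shows "Re (fourier J \<xi>) = (LBINT x. J x * cos (x \<bullet> \<xi>))"
  unfolding fourier_def using integrable_fourier_integrand[OF prob_densityD(3)[OF J], of \<xi>]
  by (subst integral_Re[symmetric]) (auto simp: mult.commute)

lemma Re_one_minus_fourier:
  assumes J: "prob_density J"
  shows "Re (1 - fourier J \<xi>) = (LBINT x. J x * (1 - cos (x \<bullet> \<xi>)))"
proof -
  have "integrable lborel (\<lambda>x. J x * cos (x \<bullet> \<xi>))"
    by (rule integrable_density_bounded[OF J, of _ 1]) auto
  then show ?thesis using prob_densityD(3,4)[OF J] Re_fourier[OF J, of \<xi>] by (simp add: right_diff_distrib)
qed

lemma Re_one_minus_fourier_nonneg:
  assumes J: "prob_density J"
  shows "0 \<le> Re (1 - fourier J \<xi>)"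
  unfolding Re_one_minus_fourier[OF J] using prob_densityD(2)[OF J]
  by (intro Bochner_Integration.integral_nonneg mult_nonneg_nonneg) auto

lemma cmod_fourier_le_1: "prob_density J \<Longrightarrow> cmod (fourier J \<xi>) \<le> 1"
  using norm_fourier_le[of J \<xi>] prob_densityD(2,4)[of J] by simp

lemma fourier_0: "prob_density J \<Longrightarrow> fourier J 0 = 1"
  using prob_densityD(4)[of J] unfolding fourier_def by simp

text \<open>A remainder of order larger than four would annihilate the fourth moment of the density;
  quantitatively, \<open>4(1 - cos \<theta>) - (1 - cos 2\<theta>) = 2(1 - cos \<theta>)\<^sup>2\<close> and Jensen's inequality.\<close>

lemma expansion_exponent_le_2:
  fixes J :: "'a::euclidean_space \<Rightarrow> real"
  assumes J: "prob_density J" and C0: "0 < C0" and d: "0 < \<delta>"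
    and ex: "\<And>\<xi>. norm \<xi> \<le> 1 \<Longrightarrow> cmod (fourier J \<xi> - complex_of_real (1 - (norm \<xi>)\<^sup>2)) \<le> C0 * norm \<xi> powr (2 + \<delta>)"
  shows "\<delta> \<le> 2"
proof (rule ccontr)
  assume "\<not> \<delta> \<le> 2"
  then have d2: "2 < \<delta>" by simp
  obtain b :: 'a where b: "b \<in> Basis" using nonempty_Basis by blast
  define f where "f \<xi> = (LBINT x. J x * (1 - cos (x \<bullet> \<xi>)))" for \<xi>
  have i1: "integrable lborel (\<lambda>x. J x * (1 - cos (x \<bullet> \<xi>)))" for \<xi>
    by (rule integrable_density_bounded[OF J, of _ 2])
       (auto simp: abs_le_iff intro: order_trans[OF cos_ge_minus_one] order_trans[OF cos_le_one])
  have i2: "integrable lborel (\<lambda>x. J x * (1 - cos (x \<bullet> \<xi>))\<^sup>2)" for \<xi>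
  proof (rule integrable_density_bounded[OF J, of _ "2\<^sup>2"])
    show "\<bar>(1 - cos (x \<bullet> \<xi>))\<^sup>2\<bar> \<le> 2\<^sup>2" for x
      using cos_ge_minus_one[of "x \<bullet> \<xi>"] cos_le_one[of "x \<bullet> \<xi>"] by (simp only: abs_power2) (intro power_mono, auto)
  qed auto
  have fb: "\<bar>f \<xi> - (norm \<xi>)\<^sup>2\<bar> \<le> C0 * norm \<xi> powr (2 + \<delta>)" if "norm \<xi> \<le> 1" for \<xi>
  proof -
    have "\<bar>f \<xi> - (norm \<xi>)\<^sup>2\<bar> = \<bar>Re (fourier J \<xi> - complex_of_real (1 - (norm \<xi>)\<^sup>2))\<bar>"
      unfolding f_def Re_one_minus_fourier[OF J, symmetric] by simp
    also have "\<dots> \<le> C0 * norm \<xi> powr (2 + \<delta>)" by (rule order_trans[OF abs_Re_le_cmod ex[OF that]])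
    finally show ?thesis .
  qed
  have jensen: "(f \<xi>)\<^sup>2 \<le> (LBINT x. J x * (1 - cos (x \<bullet> \<xi>))\<^sup>2)" for \<xi>
  proof -
    have "0 \<le> (LBINT x. J x * ((1 - cos (x \<bullet> \<xi>)) - f \<xi>)\<^sup>2)"
      using prob_densityD(2)[OF J] by (intro Bochner_Integration.integral_nonneg) auto
    also have "\<dots> = (LBINT x. J x * (1 - cos (x \<bullet> \<xi>))\<^sup>2 - 2 * f \<xi> * (J x * (1 - cos (x \<bullet> \<xi>))) + (f \<xi>)\<^sup>2 * J x)"
      by (intro Bochner_Integration.integral_cong refl) (simp add: power2_eq_square algebra_simps)
    also have "\<dots> = (LBINT x. J x * (1 - cos (x \<bullet> \<xi>))\<^sup>2) - 2 * f \<xi> * f \<xi> + (f \<xi>)\<^sup>2"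
      using i1[of \<xi>] i2[of \<xi>] prob_densityD(3,4)[OF J] by (simp only: Bochner_Integration.integral_add Bochner_Integration.integral_diff
         Bochner_Integration.integrable_diff integrable_mult_right integral_mult_right_zero f_def mult_1_right)
    finally show ?thesis by (simp add: power2_eq_square)
  qed
  have double: "f (2 *\<^sub>R \<xi>) \<le> 4 * f \<xi> - 2 * (f \<xi>)\<^sup>2" for \<xi>
  proof -
    have "f (2 *\<^sub>R \<xi>) = (LBINT x. 4 * (J x * (1 - cos (x \<bullet> \<xi>))) - 2 * (J x * (1 - cos (x \<bullet> \<xi>))\<^sup>2))"
    proof -
      have "cos (x \<bullet> (2 *\<^sub>R \<xi>)) = 2 * (cos (x \<bullet> \<xi>))\<^sup>2 - 1" for x
        using cos_double_cos[of "x \<bullet> \<xi>"] by simp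
      then show ?thesis unfolding f_def
        by (intro Bochner_Integration.integral_cong refl) (simp only:, simp add: power2_eq_square algebra_simps)
    qed
    also have "\<dots> = 4 * f \<xi> - 2 * (LBINT x. J x * (1 - cos (x \<bullet> \<xi>))\<^sup>2)"
      using i1[of \<xi>] i2[of \<xi>] by (simp only: Bochner_Integration.integral_diff integrable_mult_right integral_mult_right_zero f_def)
    finally show ?thesis using jensen[of \<xi>] by simp
  qed
  \<comment> \<open>In 4 f(\<xi>) - f(2\<xi>) the quadratic terms cancel and \<open>C'\<close>
    bounds the two remainders of order r^(2+\<delta>), while \<open>double\<close> forces at least 2
    f(\<xi>)^2, of order r^4. For \<delta> > 2 a small r is contradictory.\<close>
  define C' where "C' = C0 * 2 powr (2 + \<delta>) + 4 * C0"
  have "((\<lambda>r. r powr \<delta>) \<longlongrightarrow> 0) (at_right 0)" "((\<lambda>r. r powr (\<delta> - 2)) \<longlongrightarrow> 0) (at_right (0::real))"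
    using d d2 by (auto intro!: tendsto_eq_intros tendsto_zero_powrI eventually_at_right_less simp: eventually_at_filter)
  then have lim: "((\<lambda>r. C0 * r powr \<delta>) \<longlongrightarrow> C0 * 0) (at_right 0)" "((\<lambda>r. C' * r powr (\<delta> - 2)) \<longlongrightarrow> C' * 0) (at_right (0::real))"
    by (auto intro: tendsto_mult_right_zero)
  have "eventually (\<lambda>r. C0 * r powr \<delta> < 1 / 2) (at_right 0)" "eventually (\<lambda>r. C' * r powr (\<delta> - 2) < 1 / 2) (at_right 0)"
    using order_tendstoD(2)[OF lim(1), of "1/2"] order_tendstoD(2)[OF lim(2), of "1/2"] by auto
  moreover have "eventually (\<lambda>r. r < 1 / 2) (at_right (0::real))" "eventually (\<lambda>r. 0 < r) (at_right (0::real))"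
    by (auto simp: eventually_at_right_less intro!: eventually_at_right_real eventually_at_rightI[of 0 "1/2"])
  ultimately have "eventually (\<lambda>r. C0 * r powr \<delta> < 1 / 2 \<and> C' * r powr (\<delta> - 2) < 1 / 2 \<and> r < 1 / 2 \<and> 0 < r) (at_right 0)"
    by eventually_elim auto
  then obtain r :: real where r: "C0 * r powr \<delta> < 1 / 2" "C' * r powr (\<delta> - 2) < 1 / 2" "r < 1 / 2" "0 < r"
    using eventually_happens trivial_limit_at_right_real by blast
  let ?\<xi> = "r *\<^sub>R b"
  have n: "norm ?\<xi> = r" "norm (2 *\<^sub>R ?\<xi>) = 2 * r" using b r by auto
  have p: "r powr (2 + \<delta>) = r\<^sup>2 * r powr \<delta>" using r by (simp add: powr_add)
  have f1: "\<bar>f ?\<xi> - r\<^sup>2\<bar> \<le> C0 * (r\<^sup>2 * r powr \<delta>)" using fb[of ?\<xi>] r unfolding n p by simp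
  have f2: "\<bar>f (2 *\<^sub>R ?\<xi>) - (2 * r)\<^sup>2\<bar> \<le> C0 * (2 powr (2 + \<delta>) * (r\<^sup>2 * r powr \<delta>))"
    using fb[of "2 *\<^sub>R ?\<xi>"] r unfolding n powr_mult p by simp
  have half: "C0 * (r\<^sup>2 * r powr \<delta>) \<le> r\<^sup>2 / 2"
    using mult_left_mono[of "C0 * r powr \<delta>" "1/2" "r\<^sup>2"] r by (simp add: mult_ac)
  have lo: "r\<^sup>2 / 2 \<le> f ?\<xi>" using f1 half by linarith
  have "(r\<^sup>2 / 2)\<^sup>2 \<le> (f ?\<xi>)\<^sup>2" using lo r by (intro power_mono) auto
  then have "2 * (r\<^sup>2 / 2)\<^sup>2 \<le> 4 * f ?\<xi> - f (2 *\<^sub>R ?\<xi>)" using double[of ?\<xi>] by linarith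
  also have "\<dots> \<le> C' * (r\<^sup>2 * r powr \<delta>)" using f1 f2 unfolding C'_def
    by (simp add: power_mult_distrib distrib_right mult.assoc)
  also have "r powr \<delta> = r\<^sup>2 * r powr (\<delta> - 2)" using r by (simp add: powr_diff)
  finally have "r^4 * (1/2) \<le> r^4 * (C' * r powr (\<delta> - 2))" by (simp add: power2_eq_square power4_eq_xxxx mult_ac)
  then have "1/2 \<le> C' * r powr (\<delta> - 2)" using r by simp
  then show False using r by simp
qed

section \<open>Non-concentration on hyperplanes\<close>

lemma abs_sinc_le_1: "\<bar>sinc z\<bar> \<le> 1"
  using abs_sin_x_le_abs_x[of z] by (auto simp: divide_le_eq_1)

lemma sinc_ge_half:
  assumes "\<bar>z\<bar> < 1"
  shows "1 / 2 \<le> sinc z"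
proof -
  have *: "1 / 2 \<le> sin w / w" if w: "0 < w" "w < 1" for w :: real
  proof -
    obtain c where c: "0 < c" "c < w" "sin w - sin 0 = (w - 0) * cos c"
      using MVT2[of 0 w sin cos] w by (auto intro!: derivative_eq_intros)
    have "cos (pi / 3) \<le> cos c" using c w pi_gt3 by (intro cos_monotone_0_pi_le) auto
    then show ?thesis using c w by (simp add: cos_60)
  qed
  show ?thesis
    using *[of z] *[of "- z"] assms by (cases "z = 0"; cases "z > 0") auto
qed

lemma set_integral_cos:
  assumes T: "0 < T"
  shows "(LBINT \<tau>:{0..T}. cos (\<tau> * z)) = T * sinc (T * z)"
proof (cases "z = 0")
  case True
  then show ?thesis using T by (auto simp: set_lebesgue_integral_def)
next
  case False
  have "(LBINT \<tau>:{0..T}. cos (\<tau> * z)) = sin (T * z) / z - sin (0 * z) / z"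
    unfolding set_lebesgue_integral_def
    by (rule integral_FTC_atLeastAtMost[OF less_imp_le[OF T]])
       (use False in \<open>auto intro!: derivative_eq_intros continuous_intros simp: has_real_derivative_iff_has_vector_derivative[symmetric]\<close>)
  then show ?thesis using False T by simp
qed

lemma integrable_density_sinc:
  "prob_density J \<Longrightarrow> integrable lborel (\<lambda>x. J x * sinc (T * (x \<bullet> \<omega>)))"
  by (rule integrable_density_bounded[OF _ _ abs_sinc_le_1]) auto

text \<open>Averaging cos (\<tau> x . \<omega>) over [0, T] produces sinc. The identity joins two
  viewpoints: kernels are compared on the Fourier side, where (H2) applies, while concentration of
  mass is read off from the sinc mean.\<close>

lemma set_integral_Re_fourier_ray:
  fixes J :: "'a::euclidean_space \<Rightarrow> real"
  assumes J: "prob_density J" and T: "0 < T"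
  shows "(LBINT \<tau>:{0..T}. Re (fourier J (\<tau> *\<^sub>R \<omega>))) = T * (LBINT x. J x * sinc (T * (x \<bullet> \<omega>)))"
proof -
  have [measurable]: "J \<in> borel_measurable borel" by (rule prob_densityD[OF J])
  have ind: "integrable lborel (indicator {0..T} :: real \<Rightarrow> real)"
    by (rule integrable_real_indicator) (use T in auto)
  have "(LBINT \<tau>:{0..T}. Re (fourier J (\<tau> *\<^sub>R \<omega>))) =
    (LBINT \<tau>. (LBINT x. indicator {0..T} \<tau> * (J x * cos (\<tau> * (x \<bullet> \<omega>)))))"
    unfolding set_lebesgue_integral_def Re_fourier[OF J] by simp
  also have "\<dots> = (LBINT x. (LBINT \<tau>. indicator {0..T} \<tau> * (J x * cos (\<tau> * (x \<bullet> \<omega>)))))"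
  proof (rule lborel_pair.Fubini_integral, rule integrable_pair_bound[OF prob_densityD(3)[OF J] ind])
    fix x \<tau>
    have "\<bar>J x\<bar> * \<bar>cos (\<tau> * (x \<bullet> \<omega>))\<bar> \<le> \<bar>J x\<bar>" by (rule mult_left_le) auto
    then show "norm (case (x, \<tau>) of (x, \<tau>) \<Rightarrow> indicator {0..T} \<tau> * (J x * cos (\<tau> * (x \<bullet> \<omega>)))) \<le> \<bar>J x\<bar> * \<bar>indicator {0..T} \<tau>\<bar>"
      by (auto simp: abs_mult split: split_indicator)
  qed simp
  also have "\<dots> = (LBINT x. T * (J x * sinc (T * (x \<bullet> \<omega>))))"
  proof (intro Bochner_Integration.integral_cong refl)
    fix x
    have "(LBINT \<tau>. indicator {0..T} \<tau> * (J x * cos (\<tau> * (x \<bullet> \<omega>)))) = J x * (LBINT \<tau>:{0..T}. cos (\<tau> * (x \<bullet> \<omega>)))"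
      unfolding set_lebesgue_integral_def integral_mult_right_zero[symmetric] by (simp add: mult_ac)
    then show "(LBINT \<tau>. indicator {0..T} \<tau> * (J x * cos (\<tau> * (x \<bullet> \<omega>)))) = T * (J x * sinc (T * (x \<bullet> \<omega>)))"
      unfolding set_integral_cos[OF T] by (simp only: mult_ac)
  qed
  finally show ?thesis by (simp only: integral_mult_right_zero)
qed

text \<open>Directional averages of the Fourier transform vanish at infinity uniformly in the direction:
  otherwise a limit direction of a sequence of counterexamples contradicts dominated convergence,
  since hyperplanes are null sets.\<close>

lemma uniform_sinc_decay:
  fixes J :: "'a::euclidean_space \<Rightarrow> real"
  assumes J: "prob_density J" and c: "0 < c"
  shows "\<exists>T\<ge>1. \<forall>\<omega>. norm \<omega> = 1 \<longrightarrow> (LBINT x. J x * sinc (T * (x \<bullet> \<omega>))) \<le> c"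
proof (rule ccontr)
  have [measurable]: "J \<in> borel_measurable borel" by (rule prob_densityD[OF J])
  assume "\<not> ?thesis"
  then have neg: "\<not> (\<forall>\<omega>. norm \<omega> = 1 \<longrightarrow> (LBINT x. J x * sinc (T * (x \<bullet> \<omega>))) \<le> c)" if "1 \<le> T" for T
    using that by blast
  have "\<exists>\<omega>. norm \<omega> = 1 \<and> c < (LBINT x. J x * sinc (real (Suc n) * (x \<bullet> \<omega>)))" for n :: nat
    using neg[of "real (Suc n)"] unfolding not_all not_imp not_le by simp
  then have "\<exists>\<omega>. \<forall>n. norm (\<omega> n) = 1 \<and> c < (LBINT x. J x * sinc (real (Suc n) * (x \<bullet> \<omega> n)))"
    by (intro choice allI)
  then obtain \<omega> :: "nat \<Rightarrow> 'a" where \<omega>: "\<And>n. norm (\<omega> n) = 1"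
    "\<And>n. c < (LBINT x. J x * sinc (real (Suc n) * (x \<bullet> \<omega> n)))" by blast
  have "\<forall>n. \<omega> n \<in> sphere 0 1" using \<omega>(1) by simp
  from seq_compactE[OF compact_imp_seq_compact[OF compact_sphere] this]
  obtain l r where l: "l \<in> sphere 0 1" and r: "strict_mono r" "(\<omega> \<circ> r) \<longlonglongrightarrow> l"
    by blast
  have l0: "l \<noteq> 0" using l by auto
  have AE: "AE x in lborel. x \<bullet> l \<noteq> 0"
  proof -
    have "negligible {x. l \<bullet> x = 0}" using l0 by (intro negligible_hyperplane) simp
    then have "AE x in lebesgue. x \<notin> {x. l \<bullet> x = 0}" by (simp only: negligible_iff_null_sets AE_not_in)
    then show ?thesis unfolding AE_completion_iff by (simp add: inner_commute)
  qed
  have "(\<lambda>n. \<integral>x. J x * sinc (real (Suc (r n)) * (x \<bullet> \<omega> (r n))) \<partial>lborel) \<longlonglongrightarrow> (\<integral>x. (0::real) \<partial>(lborel :: 'a measure))"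
  proof (rule integral_dominated_convergence[where w=J])
    show "AE x in lborel. norm (J x * sinc (real (Suc (r n)) * (x \<bullet> \<omega> (r n)))) \<le> J x" for n
      using prob_densityD(2)[OF J] abs_sinc_le_1
      unfolding real_norm_def abs_mult by (intro AE_I2) (simp only: abs_of_nonneg mult_left_le)
    show "AE x in lborel. (\<lambda>n. J x * sinc (real (Suc (r n)) * (x \<bullet> \<omega> (r n)))) \<longlonglongrightarrow> 0"
      using AE
    proof eventually_elim
      case (elim x)
      \<comment> \<open>For fixed x off the hyperplane orthogonal to \<open>l\<close>, |x .
        \<omega>| stays away from 0 along the subsequence, so the argument of sinc diverges.\<close>
      have lim: "(\<lambda>n. \<bar>x \<bullet> \<omega> (r n)\<bar>) \<longlonglongrightarrow> \<bar>x \<bullet> l\<bar>"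
        using r(2) unfolding comp_def by (intro tendsto_intros)
      have top: "filterlim (\<lambda>n. real (Suc (r n))) at_top sequentially"
        by (rule filterlim_compose[OF filterlim_real_sequentially])
           (rule filterlim_compose[OF filterlim_Suc filterlim_subseq[OF r(1)]])
      have "filterlim (\<lambda>n. \<bar>x \<bullet> \<omega> (r n)\<bar> * real (Suc (r n))) at_top sequentially"
        by (rule filterlim_tendsto_pos_mult_at_top[OF lim _ top]) (use elim in simp)
      then have inv: "(\<lambda>n. inverse (\<bar>x \<bullet> \<omega> (r n)\<bar> * real (Suc (r n)))) \<longlonglongrightarrow> 0"
        by (rule tendsto_inverse_0_at_top)
      have "(\<lambda>n. sinc (real (Suc (r n)) * (x \<bullet> \<omega> (r n)))) \<longlonglongrightarrow> 0"
      proof (rule Lim_null_comparison[OF _ inv])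
        have "eventually (\<lambda>n. 0 < \<bar>x \<bullet> \<omega> (r n)\<bar>) sequentially"
          using order_tendstoD(1)[OF lim, of 0] elim by simp
        then show "\<forall>\<^sub>F n in sequentially. norm (sinc (real (Suc (r n)) * (x \<bullet> \<omega> (r n)))) \<le> inverse (\<bar>x \<bullet> \<omega> (r n)\<bar> * real (Suc (r n)))"
        proof eventually_elim
          case (elim n)
          have "\<bar>sin y\<bar> / \<bar>y\<bar> \<le> inverse \<bar>y\<bar>" for y :: real by (simp add: divide_inverse mult_left_le_one_le)
          from this[of "real (Suc (r n)) * (x \<bullet> \<omega> (r n))"] elim show ?case
            by (simp add: abs_mult mult.commute del: of_nat_Suc)
        qed
      qed
      then show ?case by (rule tendsto_mult_right_zero)
    qed
  qed (use prob_densityD(3)[OF J] in auto)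
  then have "(\<lambda>n. \<integral>x. J x * sinc (real (Suc (r n)) * (x \<bullet> \<omega> (r n))) \<partial>lborel) \<longlonglongrightarrow> 0" by simp
  from LIMSEQ_le_const[OF this, of c] \<omega>(2) c show False by (auto intro: less_imp_le)
qed

abbreviation spread :: "('a::euclidean_space \<Rightarrow> real) \<Rightarrow> real \<Rightarrow> 'a \<Rightarrow> bool" where
  "spread J T \<omega> \<equiv> 1 / 8 \<le> (LBINT x. J x * indicator {x. 1 \<le> \<bar>T * (x \<bullet> \<omega>)\<bar>} x)"

text \<open>On the slab |T (x . \<omega>)| < 1 sinc is at least 1/2, elsewhere 1 - sinc is at most
  2. Integrating gives 3/4 \<le> 1/2 + 2 mu for the mass mu off the slab, hence the 1/8 in
  \<open>spread\<close>.\<close>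

lemma mass_away_from_hyperplane:
  fixes J :: "'a::euclidean_space \<Rightarrow> real"
  assumes J: "prob_density J" and le: "(LBINT x. J x * sinc (T * (x \<bullet> \<omega>))) \<le> 1 / 4"
  shows "spread J T \<omega>"
proof -
  have iI: "integrable lborel (\<lambda>x. J x * indicator {x. 1 \<le> \<bar>T * (x \<bullet> \<omega>)\<bar>} x)"
    by (rule integrable_density_bounded[OF J, of _ 1]) (auto split: split_indicator)
  note iS = integrable_density_sinc[OF J, of T \<omega>]
  have "1 - (LBINT x. J x * sinc (T * (x \<bullet> \<omega>))) = (LBINT x. J x - J x * sinc (T * (x \<bullet> \<omega>)))"
    using iS prob_densityD(3,4)[OF J] by simp
  also have "\<dots> \<le> (LBINT x. (1 / 2) * J x + 2 * (J x * indicator {x. 1 \<le> \<bar>T * (x \<bullet> \<omega>)\<bar>} x))"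
  proof (rule integral_mono)
    show "integrable lborel (\<lambda>x. J x - J x * sinc (T * (x \<bullet> \<omega>)))"
      by (rule Bochner_Integration.integrable_diff[OF prob_densityD(3)[OF J] iS])
    show "integrable lborel (\<lambda>x. (1 / 2) * J x + 2 * (J x * indicator {x. 1 \<le> \<bar>T * (x \<bullet> \<omega>)\<bar>} x))"
      by (intro Bochner_Integration.integrable_add integrable_mult_right iI prob_densityD(3)[OF J])
    fix x
    have "1 - sinc (T * (x \<bullet> \<omega>)) \<le> 1 / 2 + 2 * indicator {x. 1 \<le> \<bar>T * (x \<bullet> \<omega>)\<bar>} x"
      using abs_sinc_le_1[of "T * (x \<bullet> \<omega>)"] sinc_ge_half[of "T * (x \<bullet> \<omega>)"]
      unfolding abs_le_iff by (cases "1 \<le> \<bar>T * (x \<bullet> \<omega>)\<bar>") simp_all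
    from mult_left_mono[OF this prob_densityD(2)[OF J, of x]]
    show "J x - J x * sinc (T * (x \<bullet> \<omega>)) \<le> (1 / 2) * J x + 2 * (J x * indicator {x. 1 \<le> \<bar>T * (x \<bullet> \<omega>)\<bar>} x)"
      by (simp only: right_diff_distrib distrib_left mult_1_right mult_ac)
  qed
  also have "\<dots> = 1 / 2 + 2 * (LBINT x. J x * indicator {x. 1 \<le> \<bar>T * (x \<bullet> \<omega>)\<bar>} x)"
    by (subst Bochner_Integration.integral_add)
       (simp_all only: integrable_mult_right[OF iI] integrable_mult_right[OF prob_densityD(3)[OF J]] integral_mult_right_zero prob_densityD(4)[OF J] mult_1_right)
  finally show ?thesis using le by linarith
qed

text \<open>Integration by parts, with cos (e^\<tau> z) read as e^(-\<tau>) times the derivative of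
  sin (e^\<tau> z)/z. The summand e^(-\<tau>)/|z| in \<open>G\<close> gives the residual sine term a
  sign, so that the derivative of \<open>G\<close> stays below the integrand.\<close>

lemma integral_one_minus_cos_exp_ge:
  fixes z :: real
  assumes t: "\<tau>1 \<le> t" and z: "z \<noteq> 0"
  shows "(t - \<tau>1) - 2 / (exp \<tau>1 * \<bar>z\<bar>) \<le> integral {\<tau>1..t} (\<lambda>\<tau>. 1 - cos (exp \<tau> * z))"
proof -
  define G where "G \<tau> = \<tau> - exp (- \<tau>) * sin (exp \<tau> * z) / z + exp (- \<tau>) / \<bar>z\<bar>" for \<tau>
  have "((\<lambda>\<tau>. 1 - cos (exp \<tau> * z) + exp (- \<tau>) * (sin (exp \<tau> * z) / z - 1 / \<bar>z\<bar>)) has_integral (G t - G \<tau>1)) {\<tau>1..t}"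
    unfolding G_def
    by (rule fundamental_theorem_of_calculus[OF t])
       (use z in \<open>auto intro!: derivative_eq_intros simp: has_real_derivative_iff_has_vector_derivative[symmetric] exp_minus field_simps\<close>)
  moreover have "((\<lambda>\<tau>. 1 - cos (exp \<tau> * z)) has_integral integral {\<tau>1..t} (\<lambda>\<tau>. 1 - cos (exp \<tau> * z))) {\<tau>1..t}"
    by (intro integrable_integral integrable_continuous_real continuous_intros)
  moreover have "\<bar>sin y / z\<bar> \<le> 1 / \<bar>z\<bar>" for y unfolding abs_divide by (intro divide_right_mono) auto
  then have sz: "sin y / z \<le> 1 / \<bar>z\<bar>" "- (sin y / z) \<le> 1 / \<bar>z\<bar>" for y unfolding abs_le_iff by auto
  have "1 - cos (exp \<tau> * z) + exp (- \<tau>) * (sin (exp \<tau> * z) / z - 1 / \<bar>z\<bar>) \<le> 1 - cos (exp \<tau> * z)" for \<tau>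
    using sz(1)[of "exp \<tau> * z"] by (simp add: mult_le_0_iff)
  ultimately have "G t - G \<tau>1 \<le> integral {\<tau>1..t} (\<lambda>\<tau>. 1 - cos (exp \<tau> * z))"
    by (rule has_integral_le)
  moreover have "exp (- t) * (sin (exp t * z) / z) \<le> exp (- t) * (1 / \<bar>z\<bar>)" using sz(1)[of "exp t * z"] by (intro mult_left_mono) auto
  moreover have "exp (- \<tau>1) * - (sin (exp \<tau>1 * z) / z) \<le> exp (- \<tau>1) * (1 / \<bar>z\<bar>)" using sz(2)[of "exp \<tau>1 * z"] by (intro mult_left_mono) auto
  moreover have "2 / (exp \<tau>1 * \<bar>z\<bar>) = 2 * (exp (- \<tau>1) * (1 / \<bar>z\<bar>))" by (simp add: exp_minus field_simps)
  ultimately show ?thesis unfolding G_def by simp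
qed

section \<open>Decay of the propagator\<close>

definition expo :: "('a::euclidean_space \<Rightarrow> real) \<Rightarrow> real \<Rightarrow> real \<Rightarrow> real \<Rightarrow> 'a \<Rightarrow> complex" where
  "expo J \<epsilon> \<sigma> t \<xi> = integral {0..t} (\<lambda>\<tau>. (1 / \<epsilon> powr (2 * \<sigma>)) *\<^sub>R (1 - fourier J (\<epsilon> *\<^sub>R exp \<tau> *\<^sub>R \<xi>)))"

lemma continuous_on_symbol:
  fixes J :: "'a::euclidean_space \<Rightarrow> real"
  assumes "prob_density J"
  shows "continuous_on A (\<lambda>\<tau>. fourier J (\<epsilon> *\<^sub>R exp \<tau> *\<^sub>R \<xi>))"
  by (rule continuous_on_compose2[OF continuous_on_fourier[OF prob_densityD(3)[OF assms]]])
     (auto intro!: continuous_intros)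

lemma Re_expo:
  assumes J: "prob_density J"
  shows "Re (expo J \<epsilon> \<sigma> t \<xi>) = integral {0..t} (\<lambda>\<tau>. (1 / \<epsilon> powr (2 * \<sigma>)) * Re (1 - fourier J (\<epsilon> *\<^sub>R exp \<tau> *\<^sub>R \<xi>)))"
proof -
  have "(\<lambda>\<tau>. (1 / \<epsilon> powr (2 * \<sigma>)) *\<^sub>R (1 - fourier J (\<epsilon> *\<^sub>R exp \<tau> *\<^sub>R \<xi>))) integrable_on {0..t}"
    by (intro integrable_continuous_real continuous_intros continuous_on_symbol J)
  from integral_linear[OF this bounded_linear_Re, symmetric] show ?thesis
    unfolding expo_def comp_def scaleR_complex.sel .
qed

text \<open>By \<open>high\<close>, every x off the slab already has phase at least 2 in modulus at
  time \<open>\<tau>1\<close>, so its oscillation loses at most 1 from the elapsed time. Integrating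
  over the mass 1/8 off the slab gives the rate 1/8, without any pointwise decay of the
  transform.\<close>

lemma high_frequency_dissipation:
  fixes J :: "'a::euclidean_space \<Rightarrow> real"
  assumes J: "prob_density J" and T: "0 < T" and e: "0 < \<epsilon>" and t: "\<tau>1 \<le> t"
    and conc: "spread J T (sgn \<xi>)"
    and high: "2 * T \<le> \<epsilon> * exp \<tau>1 * norm \<xi>"
  shows "(t - \<tau>1 - 1) / 8 \<le> integral {\<tau>1..t} (\<lambda>\<tau>. Re (1 - fourier J (\<epsilon> *\<^sub>R exp \<tau> *\<^sub>R \<xi>)))"
proof (cases "t - \<tau>1 \<le> 1")
  case True
  have "0 \<le> integral {\<tau>1..t} (\<lambda>\<tau>. Re (1 - fourier J (\<epsilon> *\<^sub>R exp \<tau> *\<^sub>R \<xi>)))"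
    by (intro integral_nonneg integrable_continuous_real continuous_intros continuous_on_symbol J Re_one_minus_fourier_nonneg)
  then show ?thesis using True by simp
next
  case False
  have [measurable]: "J \<in> borel_measurable borel" by (rule prob_densityD[OF J])
  have \<xi>0: "\<xi> \<noteq> 0" using high T by auto
  define A where "A = {x::'a. 1 \<le> \<bar>T * (x \<bullet> sgn \<xi>)\<bar>}"
  have [measurable]: "A \<in> sets borel" unfolding A_def by measurable
  define f where "f \<tau> x = 1 - cos (exp \<tau> * (\<epsilon> * (x \<bullet> \<xi>)))" for \<tau> x
  have f0: "0 \<le> f \<tau> x" "f \<tau> x \<le> 2" for \<tau> x
    unfolding f_def using cos_le_one[of "exp \<tau> * (\<epsilon> * (x \<bullet> \<xi>))"] cos_ge_minus_one[of "exp \<tau> * (\<epsilon> * (x \<bullet> \<xi>))"] by linarith+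
  have cf: "continuous_on {\<tau>1..t} (\<lambda>\<tau>. f \<tau> x)" for x unfolding f_def by (intro continuous_intros)
  have sf: "(LBINT \<tau>:{\<tau>1..t}. f \<tau> x) = integral {\<tau>1..t} (\<lambda>\<tau>. f \<tau> x)" for x
    by (intro set_borel_integral_eq_integral borel_integrable_atLeastAtMost' cf)
  have sf0: "0 \<le> (LBINT \<tau>:{\<tau>1..t}. f \<tau> x)" for x
    unfolding set_lebesgue_integral_def using f0 by (intro Bochner_Integration.integral_nonneg) auto
  have sfA: "(t - \<tau>1 - 1) * indicator A x \<le> (LBINT \<tau>:{\<tau>1..t}. f \<tau> x)" for x
  proof (cases "x \<in> A")
    case xA: True
    let ?z = "\<epsilon> * (x \<bullet> \<xi>)"
    have xx: "x \<bullet> \<xi> = norm \<xi> * (x \<bullet> sgn \<xi>)" using \<xi>0 by (simp add: sgn_div_norm)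
    have x1: "1 \<le> T * \<bar>x \<bullet> sgn \<xi>\<bar>" using xA T unfolding A_def by (simp add: abs_mult)
    then have z0: "?z \<noteq> 0" using e \<xi>0 unfolding xx by auto
    have "2 * 1 \<le> 2 * (T * \<bar>x \<bullet> sgn \<xi>\<bar>)" using x1 by simp
    also have "\<dots> = (2 * T) * \<bar>x \<bullet> sgn \<xi>\<bar>" by simp
    also have "\<dots> \<le> (\<epsilon> * exp \<tau>1 * norm \<xi>) * \<bar>x \<bullet> sgn \<xi>\<bar>" by (intro mult_right_mono high) auto
    also have "\<dots> = exp \<tau>1 * \<bar>?z\<bar>" using e unfolding xx by (simp add: abs_mult)
    finally have "2 / (exp \<tau>1 * \<bar>?z\<bar>) \<le> 1" using z0 by (subst divide_le_eq_1) auto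
    then show ?thesis
      using integral_one_minus_cos_exp_ge[OF t z0] xA unfolding sf unfolding f_def by simp
  qed (use sf0 in simp)
  have ind: "integrable lborel (\<lambda>\<tau>. 2 * indicator {\<tau>1..t} \<tau> :: real)"
    by (intro integrable_mult_right integrable_real_indicator) (use t in auto)
  have int: "integrable (lborel \<Otimes>\<^sub>M lborel) (\<lambda>(x, \<tau>). indicator {\<tau>1..t} \<tau> * (J x * f \<tau> x))"
  proof (rule integrable_pair_bound[OF prob_densityD(3)[OF J] ind])
    show "(\<lambda>(x, \<tau>). indicator {\<tau>1..t} \<tau> * (J x * f \<tau> x)) \<in> borel_measurable (lborel \<Otimes>\<^sub>M lborel)"
      unfolding f_def by measurable
    fix x \<tau>
    have "\<bar>J x\<bar> * \<bar>f \<tau> x\<bar> \<le> \<bar>J x\<bar> * 2" using f0[of \<tau> x] by (intro mult_left_mono) auto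
    then show "norm (case (x, \<tau>) of (x, \<tau>) \<Rightarrow> indicator {\<tau>1..t} \<tau> * (J x * f \<tau> x)) \<le> \<bar>J x\<bar> * \<bar>2 * indicator {\<tau>1..t} \<tau>\<bar>"
      by (auto simp: abs_mult split: split_indicator)
  qed
  have e1: "(LBINT \<tau>. indicator {\<tau>1..t} \<tau> * (J x * f \<tau> x)) = J x * (LBINT \<tau>:{\<tau>1..t}. f \<tau> x)" for x
    unfolding set_lebesgue_integral_def integral_mult_right_zero[symmetric] by (simp add: mult_ac)
  have "(t - \<tau>1 - 1) / 8 \<le> (t - \<tau>1 - 1) * (LBINT x. J x * indicator A x)"
    using mult_left_mono[OF conc, of "t - \<tau>1 - 1"] False unfolding A_def by simp
  also have "\<dots> = (LBINT x. J x * ((t - \<tau>1 - 1) * indicator A x))"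
    unfolding integral_mult_right_zero[symmetric] by (simp add: mult_ac)
  also have "\<dots> \<le> (LBINT x. (LBINT \<tau>. indicator {\<tau>1..t} \<tau> * (J x * f \<tau> x)))"
  proof (rule integral_mono_AE')
    show "integrable lborel (\<lambda>x. \<integral>\<tau>. indicator {\<tau>1..t} \<tau> * (J x * f \<tau> x) \<partial>lborel)"
      using lborel_pair.integrable_fst[OF int] by simp
    show "AE x in lborel. J x * ((t - \<tau>1 - 1) * indicator A x) \<le> (LBINT \<tau>. indicator {\<tau>1..t} \<tau> * (J x * f \<tau> x))"
      unfolding e1 by (intro AE_I2 mult_left_mono sfA prob_densityD(2)[OF J])
    show "AE x in lborel. 0 \<le> (LBINT \<tau>. indicator {\<tau>1..t} \<tau> * (J x * f \<tau> x))"
      unfolding e1 by (intro AE_I2 mult_nonneg_nonneg sf0 prob_densityD(2)[OF J])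
  qed
  also have "\<dots> = (LBINT \<tau>. (LBINT x. indicator {\<tau>1..t} \<tau> * (J x * f \<tau> x)))"
    by (rule lborel_pair.Fubini_integral[OF int, symmetric])
  also have "\<dots> = (LBINT \<tau>:{\<tau>1..t}. Re (1 - fourier J (\<epsilon> *\<^sub>R exp \<tau> *\<^sub>R \<xi>)))"
  proof -
    have "x \<bullet> (\<epsilon> *\<^sub>R exp \<tau> *\<^sub>R \<xi>) = exp \<tau> * (\<epsilon> * (x \<bullet> \<xi>))" for x \<tau> by simp
    then show ?thesis
      unfolding set_lebesgue_integral_def Re_one_minus_fourier[OF J] f_def
      by (simp only: integral_mult_right_zero real_scaleR_def)
  qed
  also have "\<dots> = integral {\<tau>1..t} (\<lambda>\<tau>. Re (1 - fourier J (\<epsilon> *\<^sub>R exp \<tau> *\<^sub>R \<xi>)))"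
    by (intro set_borel_integral_eq_integral borel_integrable_atLeastAtMost' continuous_intros continuous_on_symbol J)
  finally show ?thesis .
qed

text \<open>The threshold solves C0 z^\<delta> = 1/2: below it the remainder is at most half of the
  main term, so the scaled symbol is at least |\<eta>|^(2\<sigma>)/2 \<ge> |\<eta>|/2, using
  2\<sigma> > 1 and |\<eta>| \<ge> 1.\<close>

lemma low_frequency_dissipation:
  fixes J :: "'a::euclidean_space \<Rightarrow> real"
  assumes s: "1 / 2 < \<sigma>" and C0: "0 < C0" and d: "0 < \<delta>" and N: "1 \<le> N" and e: "0 < \<epsilon>"
    and ex: "\<And>\<xi>. norm \<xi> \<le> 1 \<Longrightarrow> cmod (fourier J \<xi> - complex_of_real (1 - norm \<xi> powr (2 * \<sigma>))) \<le> C0 * norm \<xi> powr (2 * \<sigma> + \<delta>)"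
    and lo: "2 * N \<le> norm \<eta>" and hi: "\<epsilon> * norm \<eta> \<le> min 1 ((1 / (2 * C0)) powr (1 / \<delta>))"
  shows "N \<le> (1 / \<epsilon> powr (2 * \<sigma>)) * Re (1 - fourier J (\<epsilon> *\<^sub>R \<eta>))"
proof -
  define z where "z = \<epsilon> * norm \<eta>"
  have y: "1 \<le> norm \<eta>" using lo N by linarith
  then have "0 < norm \<eta>" by linarith
  then have z: "0 < z" using e by (simp add: z_def)
  have nz: "norm (\<epsilon> *\<^sub>R \<eta>) = z" using e by (simp add: z_def)
  have z1: "z \<le> 1" "z \<le> (1 / (2 * C0)) powr (1 / \<delta>)" using hi by (auto simp: z_def)
  have "z powr \<delta> \<le> ((1 / (2 * C0)) powr (1 / \<delta>)) powr \<delta>" using z z1 d by (intro powr_mono2) auto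
  also have "\<dots> = 1 / (2 * C0)" using d C0 by (simp add: powr_powr)
  finally have "C0 * z powr \<delta> \<le> 1 / 2" using C0 by (simp add: field_simps)
  then have "z powr (2 * \<sigma>) * (C0 * z powr \<delta>) \<le> z powr (2 * \<sigma>) * (1 / 2)" by (rule mult_left_mono) simp
  moreover have "\<bar>Re (fourier J (\<epsilon> *\<^sub>R \<eta>) - complex_of_real (1 - z powr (2 * \<sigma>)))\<bar> \<le> C0 * z powr (2 * \<sigma> + \<delta>)"
    using order_trans[OF abs_Re_le_cmod ex[of "\<epsilon> *\<^sub>R \<eta>"]] z1 unfolding nz by simp
  ultimately have "z powr (2 * \<sigma>) / 2 \<le> Re (1 - fourier J (\<epsilon> *\<^sub>R \<eta>))"
    by (simp add: powr_add mult_ac abs_le_iff)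
  then have "(1 / \<epsilon> powr (2 * \<sigma>)) * (z powr (2 * \<sigma>) / 2) \<le> (1 / \<epsilon> powr (2 * \<sigma>)) * Re (1 - fourier J (\<epsilon> *\<^sub>R \<eta>))"
    by (rule mult_left_mono) simp
  moreover have "(1 / \<epsilon> powr (2 * \<sigma>)) * (z powr (2 * \<sigma>) / 2) = norm \<eta> powr (2 * \<sigma>) / 2"
    using e by (simp add: z_def powr_mult)
  moreover have "norm \<eta> powr 1 \<le> norm \<eta> powr (2 * \<sigma>)" using y s by (intro powr_mono) auto
  ultimately show ?thesis using lo y by (simp add: powr_one)
qed

text \<open>Dissipation at rate at least N holds while the frequency is between 2N and
  \<rho>/\<epsilon>, and on average once it exceeds \<open>k0\<close>/\<epsilon>. What is missing
  over [0, t] is the time before the frequency reaches 2N, the crossing time \<open>c\<close> of the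
  middle window and the loss 1 from averaging; the last two give the constant, the first gives the
  quotient of frequencies.\<close>

lemma exp_expo_le:
  fixes J :: "'a::euclidean_space \<Rightarrow> real"
  assumes J: "prob_density J" and s: "1 / 2 < \<sigma>" and C0: "0 < C0" and d: "0 < \<delta>" and N: "1 \<le> N"
    and e: "0 < \<epsilon>" "\<epsilon> \<le> 1 / (8 * N)" and T: "0 < T" and t: "0 \<le> t" and \<xi>: "\<xi> \<noteq> 0"
    and ex: "\<And>\<xi>. norm \<xi> \<le> 1 \<Longrightarrow> cmod (fourier J \<xi> - complex_of_real (1 - norm \<xi> powr (2 * \<sigma>))) \<le> C0 * norm \<xi> powr (2 * \<sigma> + \<delta>)"
    and conc: "\<And>\<omega>. norm \<omega> = 1 \<Longrightarrow> spread J T \<omega>"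
  shows "exp (- Re (expo J \<epsilon> \<sigma> t \<xi>)) \<le>
    exp (N * (1 + ln (max 1 (2 * T) / min 1 ((1 / (2 * C0)) powr (1 / \<delta>))))) * (4 * N) powr N
      * ((1 + norm \<xi>) / (1 + exp t * norm \<xi>)) powr N"
proof -
  define y where "y = norm \<xi>"
  have y: "0 < y" using \<xi> by (simp add: y_def)
  define \<rho> where "\<rho> = min 1 ((1 / (2 * C0)) powr (1 / \<delta>))"
  have \<rho>: "0 < \<rho>" "\<rho> \<le> 1" using C0 by (auto simp: \<rho>_def)
  define k0 where "k0 = max 1 (2 * T)"
  have k0: "1 \<le> k0" "2 * T \<le> k0" by (auto simp: k0_def)
  define c where "c = ln (k0 / \<rho>)"
  have "ln \<rho> \<le> 0" "0 \<le> ln k0" using \<rho> k0 by auto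
  then have c: "0 \<le> c" "c = ln k0 - ln \<rho>" unfolding c_def using \<rho> k0 by (simp_all add: ln_div)
  \<comment> \<open>Clamping to [0, t] is needed because each transition time may fall before the
    start or after the end.\<close>
  define cl where "cl v = max 0 (min t v)" for v
  \<comment> \<open>The times at which e^\<tau>|\<xi>| reaches \<open>k0\<close>/\<epsilon>,
    \<rho>/\<epsilon> and 2N. The gap between the first two depends on neither \<xi> nor
    \<epsilon>.\<close>
  define v1 v2 v3 where "v1 = ln (k0 / (\<epsilon> * y))" and "v2 = ln (\<rho> / (\<epsilon> * y))" and "v3 = ln (2 * N / y)"
  have v12: "v1 - v2 = c" unfolding v1_def v2_def c(2) using \<rho> k0 e y by (simp add: ln_div ln_mult)
  define lam where "lam = 1 / \<epsilon> powr (2 * \<sigma>)"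
  \<comment> \<open>The smallness of \<epsilon> enters here: \<epsilon>^(2\<sigma>) \<le> \<epsilon>
    as 2\<sigma> > 1. The factor 8 offsets the rate 1/8 of
    \<open>high_frequency_dissipation\<close>.\<close>
  have lam: "8 * N \<le> lam"
  proof -
    have e1: "\<epsilon> \<le> 1" using e N by (auto intro: order_trans simp: divide_le_eq_1)
    have "\<epsilon> powr (2 * \<sigma>) \<le> \<epsilon> powr 1" using e e1 s by (intro powr_mono') auto
    also have "\<dots> \<le> 1 / (8 * N)" using e by simp
    finally show ?thesis unfolding lam_def using e N by (simp add: field_simps)
  qed
  then have lam0: "0 \<le> lam" using N by linarith
  define g where "g \<tau> = lam * Re (1 - fourier J (\<epsilon> *\<^sub>R exp \<tau> *\<^sub>R \<xi>))" for \<tau>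
  have g0: "0 \<le> g \<tau>" for \<tau> unfolding g_def using lam0 Re_one_minus_fourier_nonneg[OF J] by simp
  have gc: "continuous_on A g" for A unfolding g_def[abs_def] by (intro continuous_intros continuous_on_symbol J)
  have gi: "g integrable_on {a..b}" for a b by (rule integrable_continuous_real[OF gc])
  have gn: "0 \<le> integral {a..b} g" for a b by (intro integral_nonneg gi g0)
  have cl01: "0 \<le> cl v" "cl v \<le> t" for v using t by (auto simp: cl_def)
  have high: "N * (t - cl v1 - 1) \<le> integral {cl v1..t} g"
  proof (cases "cl v1 < t")
    case False
    then have "N * (t - cl v1 - 1) \<le> 0" using N cl01[of v1] by (simp add: mult_le_0_iff)
    then show ?thesis using gn[of "cl v1" t] by linarith
  next
    case True
    then have "v1 \<le> cl v1" by (auto simp: cl_def split: if_splits)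
    then have "exp v1 \<le> exp (cl v1)" by simp
    then have "k0 / (\<epsilon> * y) \<le> exp (cl v1)" using k0 e y by (simp add: v1_def)
    then have "k0 \<le> \<epsilon> * exp (cl v1) * norm \<xi>" using e y by (simp add: y_def[symmetric] field_simps)
    then have "(t - cl v1 - 1) / 8 \<le> integral {cl v1..t} (\<lambda>\<tau>. Re (1 - fourier J (\<epsilon> *\<^sub>R exp \<tau> *\<^sub>R \<xi>)))" (is "_ \<le> ?I")
      using k0 \<xi> by (intro high_frequency_dissipation[OF J T e(1)] cl01 conc) (auto simp: norm_sgn)
    moreover have "0 \<le> ?I"
      by (intro integral_nonneg integrable_continuous_real continuous_intros continuous_on_symbol J Re_one_minus_fourier_nonneg)
    ultimately have "(8 * N) * ((t - cl v1 - 1) / 8) \<le> lam * ?I"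
      using lam N by (meson mult_left_mono mult_right_mono order_trans zero_le_mult_iff zero_le_numeral zero_le_one)
    also have "lam * ?I = integral {cl v1..t} g" unfolding g_def[abs_def] by simp
    finally show ?thesis by simp
  qed
  have low: "N * (cl v2 - cl v3) \<le> integral {cl v3..cl v2} g" if "cl v3 < cl v2"
  proof -
    have v2: "cl v2 \<le> v2" and v3: "v3 \<le> cl v3" using that t by (auto simp: cl_def max_def min_def split: if_splits)
    have "integral {cl v3..cl v2} (\<lambda>_. N) \<le> integral {cl v3..cl v2} g"
    proof (rule integral_le)
      fix \<tau> assume \<tau>: "\<tau> \<in> {cl v3..cl v2}"
      have n: "norm (exp \<tau> *\<^sub>R \<xi>) = exp \<tau> * y" by (simp add: y_def)
      have "exp v3 \<le> exp \<tau>" using \<tau> v3 by simp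
      then have "2 * N / y \<le> exp \<tau>" using N y by (simp add: v3_def)
      then have lo: "2 * N \<le> norm (exp \<tau> *\<^sub>R \<xi>)" unfolding n using y by (simp add: field_simps)
      have "exp \<tau> \<le> exp v2" using \<tau> v2 by simp
      then have "exp \<tau> \<le> \<rho> / (\<epsilon> * y)" using \<rho> e y by (simp add: v2_def)
      then have hi: "\<epsilon> * norm (exp \<tau> *\<^sub>R \<xi>) \<le> \<rho>" unfolding n using e y by (simp add: field_simps)
      show "N \<le> g \<tau>" unfolding g_def lam_def
        by (rule low_frequency_dissipation[OF s C0 d N e(1) ex lo hi[unfolded \<rho>_def]])
    qed (auto intro: gi)
    then show ?thesis using that by (simp add: mult.commute)
  qed
  \<comment> \<open>In the second case the low-frequency window is empty, and the high-frequency
    regime begins at most \<open>c\<close> after \<open>cl v3\<close>.\<close>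
  have "N * (t - cl v3) - N * (1 + c) \<le> integral {0..t} g"
  proof (cases "cl v3 < cl v2")
    case True
    have c21: "cl v2 \<le> cl v1" "cl v1 - cl v2 \<le> c" using v12 c unfolding cl_def by (auto simp: max_def min_def)
    have "integral {0..t} g = integral {0..cl v3} g + (integral {cl v3..cl v2} g + (integral {cl v2..cl v1} g + integral {cl v1..t} g))"
      using cl01 True c21 gi by (simp add: Henstock_Kurzweil_Integration.integral_combine)
    then have "integral {cl v3..cl v2} g + integral {cl v1..t} g \<le> integral {0..t} g"
      using gn[of 0 "cl v3"] gn[of "cl v2" "cl v1"] by linarith
    then have "N * (cl v2 - cl v3) + N * (t - cl v1 - 1) \<le> integral {0..t} g"
      using low[OF True] high by linarith
    moreover have "N * (cl v1 - cl v2) \<le> N * c" using c21 N by (intro mult_left_mono) auto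
    ultimately show ?thesis by (simp add: algebra_simps)
  next
    case False
    have c21: "cl v1 - cl v3 \<le> c" using v12 c False unfolding cl_def by (auto simp: max_def min_def split: if_splits)
    have "integral {0..t} g = integral {0..cl v1} g + integral {cl v1..t} g"
      using cl01 gi by (simp add: Henstock_Kurzweil_Integration.integral_combine)
    then have "N * (t - cl v1 - 1) \<le> integral {0..t} g"
      using gn[of 0 "cl v1"] high by linarith
    moreover have "N * (cl v1 - cl v3) \<le> N * c" using c21 N by (intro mult_left_mono) auto
    ultimately show ?thesis by (simp add: algebra_simps)
  qed
  moreover have "Re (expo J \<epsilon> \<sigma> t \<xi>) = integral {0..t} g"
    unfolding Re_expo[OF J] g_def[abs_def] lam_def by simp
  ultimately have "exp (- Re (expo J \<epsilon> \<sigma> t \<xi>)) \<le> exp (N * (1 + c) + N * (cl v3 - t))"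
    by (simp add: algebra_simps)
  also have "\<dots> = exp (N * (1 + c)) * exp (cl v3 - t) powr N"
    by (simp add: exp_add exp_powr_real mult.commute)
  also have "exp (cl v3 - t) powr N \<le> (4 * N * ((1 + y) / (1 + exp t * y))) powr N"
  proof (rule powr_mono2)
    \<comment> \<open>No decay is claimed before \<open>v3\<close>; since e^(cl v3) is at most max 1
      (2N/|\<xi>|), this delay is what the numerator 1 + |\<xi>| pays for.\<close>
    show "exp (cl v3 - t) \<le> 4 * N * ((1 + y) / (1 + exp t * y))"
    proof (cases "exp t * y \<le> 1")
      case True
      have "exp (cl v3 - t) \<le> 1" using cl01[of v3] by simp
      also have "1 \<le> 4 * 1 * (1 / 2 :: real)" by simp
      also have "\<dots> \<le> 4 * N * ((1 + y) / (1 + exp t * y))"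
        using N y True by (intro mult_mono frac_le) (auto intro: add_pos_pos)
      finally show ?thesis .
    next
      case False
      have "exp (cl v3) \<le> max 1 (2 * N / y)"
      proof -
        have "cl v3 \<le> max 0 v3" unfolding cl_def by auto
        then have "exp (cl v3) \<le> exp (max 0 v3)" by simp
        also have "\<dots> = max 1 (2 * N / y)" using N y by (simp add: max_def v3_def ln_ge_zero_iff)
        finally show ?thesis .
      qed
      also have "\<dots> \<le> 2 * N * (1 + y) / y" using N y by (auto simp: field_simps add_increasing)
      finally have "exp (cl v3 - t) \<le> 2 * N * (1 + y) / y / exp t"
        unfolding exp_diff by (rule divide_right_mono) simp
      also have "\<dots> = 4 * N * (1 + y) / (exp t * y + exp t * y)" using y by (simp add: field_simps)
      also have "\<dots> \<le> 4 * N * (1 + y) / (1 + exp t * y)"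
        using False N y by (intro divide_left_mono mult_pos_pos add_pos_pos add_right_mono) auto
      finally show ?thesis by simp
    qed
  qed (use N in auto)
  also have "(4 * N * ((1 + y) / (1 + exp t * y))) powr N = (4 * N) powr N * ((1 + y) / (1 + exp t * y)) powr N"
    by (rule powr_mult)
  finally show ?thesis unfolding c_def k0_def \<rho>_def y_def by (simp add: mult.assoc)
qed

section \<open>Interpolation and the difference of two solutions\<close>

lemma fourier_diff:
  assumes "integrable lborel f" "integrable lborel g"
  shows "fourier (\<lambda>x. f x - g x) \<xi> = fourier f \<xi> - fourier g \<xi>"
  using integrable_fourier_integrand[OF assms(1)] integrable_fourier_integrand[OF assms(2)]
  unfolding fourier_def by (simp add: right_diff_distrib)

text \<open>Mean value inequality on a right half-plane containing both points, which is convex; the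
  sum of the two exponentials replaces their maximum.\<close>

lemma cmod_exp_diff_le:
  "cmod (exp (- a) - exp (- b)) \<le> (exp (- Re a) + exp (- Re b)) * cmod (a - b)"
proof -
  let ?m = "min (Re a) (Re b)"
  have "cmod (exp (- a) - exp (- b)) \<le> exp (- ?m) * cmod (a - b)"
  proof (rule field_differentiable_bound[where S="{z. Re z \<ge> ?m}"])
    show "convex {z. Re z \<ge> ?m}" by (rule convex_halfspace_Re_ge)
    show "((\<lambda>z. exp (- z)) has_field_derivative - exp (- z)) (at z within {z. Re z \<ge> ?m})" for z :: complex
      by (auto intro!: derivative_eq_intros)
  qed auto
  also have "\<dots> \<le> (exp (- Re a) + exp (- Re b)) * cmod (a - b)"
    by (intro mult_right_mono) (auto simp: min_def)
  finally show ?thesis .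
qed

text \<open>The norm is split at radius r: inside, the Fourier bound gives r^k r^(d/2) h; outside,
  the moment gives r^(k-m). The two balance for r^(-(m + d/2)) = h, which is where the exponent
  comes from.\<close>

lemma interpolation:
  fixes f :: "'a::euclidean_space \<Rightarrow> real"
  assumes k: "0 \<le> k" "k < m" and f: "L1w m f" "L1w_norm m f \<le> B"
    and F: "integrable lborel (\<lambda>\<xi>. (cmod (fourier f \<xi>))\<^sup>2)" "(LBINT \<xi>. (cmod (fourier f \<xi>))\<^sup>2) \<le> h\<^sup>2 * Q"
    and h: "0 < h" "h \<le> 1"
  shows "L1w_norm k f \<le> (2 powr k * ((Q + unit_ball_vol (real DIM('a))) / 2) + B) * h powr ((m - k) / (m + real DIM('a) / 2))"
proof -
  define n where "n = real DIM('a)"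
  have n: "0 < n" by (simp add: n_def)
  define p where "p = m + n / 2"
  have p: "0 < p" using k n by (simp add: p_def)
  define \<theta> where "\<theta> = (m - k) / p"
  define r where "r = h powr (- (1 / p))"
  have r: "1 \<le> r" using powr_mono'[of "- (1 / p)" 0 h] h p by (simp add: r_def)
  have rp: "r powr a = h powr (- (a / p))" for a by (simp add: r_def powr_powr)
  have B: "0 \<le> B" using order_trans[OF _ f(2)] unfolding L1w_norm_def by (simp add: Bochner_Integration.integral_nonneg)
  define V where "V = unit_ball_vol n"
  have fi: "integrable lborel f" using L1w_imp_integrable(1)[OF f(1)] k by simp
  have mi: "integrable lborel (\<lambda>x. jbr x powr m * \<bar>f x\<bar>)" using f(1) by (simp add: L1w_def)
  have [measurable]: "f \<in> borel_measurable borel" "cball (0::'a) r \<in> sets borel"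
    using fi by (auto dest: borel_measurable_integrable)
  have ci: "integrable lborel (\<lambda>x. indicator (cball 0 r) x * \<bar>f x\<bar>)"
  proof (rule Bochner_Integration.integrable_bound[OF fi])
    show "(\<lambda>x. indicator (cball 0 r) x * \<bar>f x\<bar>) \<in> borel_measurable lborel" by measurable
  qed (auto split: split_indicator)
  have small: "(\<integral>x\<in>cball 0 r. \<bar>f x\<bar> \<partial>lborel) \<le> r powr (n / 2) * h * ((Q + V) / 2)"
  proof -
    \<comment> \<open>With this value both l h^2 and the volume divided by l are multiples of
      r^(d/2) h.\<close>
    let ?l = "r powr (n / 2) / h"
    have l: "0 < ?l" using r h by simp
    have vol: "measure lborel (cball (0::'a) r) = V * (r powr (n / 2) * r powr (n / 2))"
      using r unfolding powr_add[symmetric] V_def n_def by (simp add: content_cball powr_realpow)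
    have "(\<integral>x\<in>cball 0 r. \<bar>f x\<bar> \<partial>lborel) \<le> (?l * (LBINT \<xi>. (cmod (fourier f \<xi>))\<^sup>2) + measure lborel (cball (0::'a) r) / ?l) / 2"
      using r by (intro integral_abs_le_fourier_L2 fi F(1) l) auto
    also have "\<dots> \<le> (?l * (h\<^sup>2 * Q) + measure lborel (cball (0::'a) r) / ?l) / 2"
      using l F(2) by (intro divide_right_mono add_right_mono mult_left_mono) auto
    also have "\<dots> = r powr (n / 2) * h * ((Q + V) / 2)"
      using r h unfolding vol by (simp add: field_simps power2_eq_square)
    finally show ?thesis .
  qed
  have "L1w_norm k f \<le> (LBINT x. (2 * r) powr k * (indicator (cball 0 r) x * \<bar>f x\<bar>) + r powr (k - m) * (jbr x powr m * \<bar>f x\<bar>))"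
    unfolding L1w_norm_def
  proof (rule integral_mono_AE')
    show "integrable lborel (\<lambda>x. (2 * r) powr k * (indicator (cball 0 r) x * \<bar>f x\<bar>) + r powr (k - m) * (jbr x powr m * \<bar>f x\<bar>))"
      by (intro Bochner_Integration.integrable_add integrable_mult_right ci mi)
    show "AE x in lborel. 0 \<le> (2 * r) powr k * (indicator (cball 0 r) x * \<bar>f x\<bar>) + r powr (k - m) * (jbr x powr m * \<bar>f x\<bar>)"
      by auto
    show "AE x in lborel. jbr x powr k * \<bar>f x\<bar> \<le> (2 * r) powr k * (indicator (cball 0 r) x * \<bar>f x\<bar>) + r powr (k - m) * (jbr x powr m * \<bar>f x\<bar>)"
    proof (rule AE_I2)
      fix x :: 'a
      have "jbr x powr k \<le> (2 * r) powr k * indicator (cball 0 r) x + r powr (k - m) * jbr x powr m"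
      proof (cases "norm x \<le> r")
        case True
        have "jbr x \<le> 2 * r" using jbr_le[of x] True r by linarith
        then have "jbr x powr k \<le> (2 * r) powr k" using jbr_ge_1[of x] k by (intro powr_mono2) auto
        then show ?thesis using True by (simp add: add_increasing2)
      next
        case False
        then have "r \<le> jbr x" using jbr_ge_norm[of x] by linarith
        then have "jbr x powr (k - m) \<le> r powr (k - m)" using r k by (intro powr_mono2') auto
        then have "jbr x powr (k - m) * jbr x powr m \<le> r powr (k - m) * jbr x powr m" by (rule mult_right_mono) simp
        then show ?thesis using False by (simp add: powr_add[symmetric])
      qed
      from mult_right_mono[OF this, of "\<bar>f x\<bar>"]
      show "jbr x powr k * \<bar>f x\<bar> \<le> (2 * r) powr k * (indicator (cball 0 r) x * \<bar>f x\<bar>) + r powr (k - m) * (jbr x powr m * \<bar>f x\<bar>)"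
        by (simp only: distrib_right mult.assoc abs_ge_zero simp_thms)
    qed
  qed
  also have "\<dots> = (2 * r) powr k * (\<integral>x\<in>cball 0 r. \<bar>f x\<bar> \<partial>lborel) + r powr (k - m) * L1w_norm m f"
    unfolding set_lebesgue_integral_def L1w_norm_def using ci mi by (subst Bochner_Integration.integral_add) auto
  also have "\<dots> \<le> (2 * r) powr k * (r powr (n / 2) * h * ((Q + V) / 2)) + r powr (k - m) * B"
    using small f(2) by (intro add_mono mult_left_mono) auto
  also have "(2 * r) powr k * (r powr (n / 2) * h * ((Q + V) / 2)) = 2 powr k * ((Q + V) / 2) * (r powr (k + n / 2) * h powr 1)"
    using h by (simp add: powr_mult powr_add)
  also have "r powr (k + n / 2) * h powr 1 = h powr \<theta>"
  proof -
    have "- ((k + n / 2) / p) + 1 = (p - (k + n / 2)) / p" using p by (simp add: diff_divide_distrib)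
    also have "\<dots> = \<theta>" by (simp add: \<theta>_def p_def)
    finally show ?thesis unfolding rp powr_add[symmetric] by simp
  qed
  also have "r powr (k - m) = h powr \<theta>" unfolding rp \<theta>_def minus_divide_left minus_diff_eq ..
  finally show ?thesis unfolding \<theta>_def p_def n_def[symmetric] V_def by (simp add: algebra_simps)
qed

text \<open>The parameter \<kappa> is the room between 2 + \<delta> and the Sobolev exponent; it is
  spent on the logarithm in (H2), and \<kappa> \<le> 1 keeps the growth order \<open>q\<close> at
  most 5.\<close>

locale kernels =
  fixes J :: "real \<Rightarrow> 'a::euclidean_space \<Rightarrow> real" and J1 :: "'a \<Rightarrow> real" and \<delta> C0 CC \<kappa> :: real
  assumes d: "0 < \<delta>" and C0: "0 < C0" and CC: "0 < CC" and k01: "0 < \<kappa>" "\<kappa> \<le> 1"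
    and Js: "\<And>s. 1 / 2 < s \<Longrightarrow> s < 1 \<Longrightarrow> prob_density (J s)" and J1: "prob_density J1"
    and exJ: "\<And>s \<xi>. 1 / 2 < s \<Longrightarrow> s < 1 \<Longrightarrow> norm \<xi> \<le> 1 \<Longrightarrow>
       cmod (fourier (J s) \<xi> - complex_of_real (1 - norm \<xi> powr (2 * s))) \<le> C0 * norm \<xi> powr (2 * s + \<delta>)"
    and exJ1: "\<And>\<xi>. norm \<xi> \<le> 1 \<Longrightarrow> cmod (fourier J1 \<xi> - complex_of_real (1 - (norm \<xi>)\<^sup>2)) \<le> C0 * norm \<xi> powr (2 + \<delta>)"
    and close: "\<And>s \<xi>. 1 / 2 < s \<Longrightarrow> s < 1 \<Longrightarrow> \<xi> \<noteq> 0 \<Longrightarrow>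
       cmod ((1 - fourier (J s) \<xi>) / complex_of_real (norm \<xi> powr (2 * s)) - (1 - fourier J1 \<xi>) / complex_of_real ((norm \<xi>)\<^sup>2))
        \<le> CC * (1 - s) * norm \<xi> powr \<delta> * max 1 \<bar>ln (norm \<xi>)\<bar>"
begin

definition "q = 2 + \<delta> + \<kappa>"
definition "Csym = 2 * CC * (1 + 1 / \<delta> + 1 / \<kappa>) + 2 * (4 + 2 / \<kappa>) * (2 + C0)"

lemma Csym: "0 < Csym"
  unfolding Csym_def using d C0 CC k01 by (auto intro!: add_pos_pos mult_pos_pos)

lemma exJ1': "norm \<xi> \<le> 1 \<Longrightarrow> cmod (fourier J1 \<xi> - complex_of_real (1 - norm \<xi> powr (2 * 1))) \<le> C0 * norm \<xi> powr (2 * 1 + \<delta>)"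
  using exJ1[of \<xi>] by (cases "\<xi> = 0") auto

lemma delta_le_2: "\<delta> \<le> 2"
  by (rule expansion_exponent_le_2[OF J1 C0 d exJ1])

lemma q_bounds: "2 < q" "q \<le> 5"
  using d k01 delta_le_2 by (auto simp: q_def)

lemma symbol_difference:
  assumes "1 / 2 < s" "s < 1" "0 < \<epsilon>" "\<epsilon> \<le> 1"
  shows "cmod ((1 / \<epsilon> powr (2 * s)) *\<^sub>R (1 - fourier (J s) (\<epsilon> *\<^sub>R \<eta>)) - (1 / \<epsilon> powr (2 * 1)) *\<^sub>R (1 - fourier J1 (\<epsilon> *\<^sub>R \<eta>)))
    \<le> Csym * (1 - s) * (norm \<eta> powr (1 / 2) + norm \<eta> powr q)"
  unfolding Csym_def q_def
proof (rule symbol_diff[OF d C0 CC k01(1) assms])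
  show "cmod (1 - fourier J1 \<xi>) \<le> 2" for \<xi>
    using norm_triangle_ineq4[of 1 "fourier J1 \<xi>"] cmod_fourier_le_1[OF J1, of \<xi>] by simp
  show "fourier (J s) 0 = 1" "fourier J1 0 = 1" by (intro fourier_0 Js J1 assms)+
qed (rule exJ1 close[OF assms(1,2)]; assumption)+

text \<open>The symbol estimate at \<epsilon> = 1, integrated over the segment from 0 to T\<omega>.
  The error grows with T, so it is useful only once T has been fixed by the limit kernel.\<close>

lemma sinc_mean_close:
  assumes s: "1 / 2 < s" "s < 1" and T: "0 < T" and w: "norm \<omega> = 1"
  shows "(LBINT x. J s x * sinc (T * (x \<bullet> \<omega>)))
    \<le> (LBINT x. J1 x * sinc (T * (x \<bullet> \<omega>))) + Csym * (1 - s) * (T powr (1 / 2) + T powr q)"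
proof -
  let ?c = "Csym * (1 - s) * (T powr (1 / 2) + T powr q)"
  have c: "continuous_on A (\<lambda>\<tau>. Re (fourier K (\<tau> *\<^sub>R \<omega>)))" if "prob_density K" for K A
    by (intro continuous_intros continuous_on_compose2[OF continuous_on_fourier[OF prob_densityD(3)[OF that]]]) auto
  have si: "set_integrable lborel {0..T} (\<lambda>\<tau>. Re (fourier K (\<tau> *\<^sub>R \<omega>)))" if "prob_density K" for K
    by (intro borel_integrable_atLeastAtMost' c that)
  have ci: "set_integrable lborel {0..T} (\<lambda>\<tau>. ?c)" by (intro borel_integrable_atLeastAtMost' continuous_intros)
  have "T * (LBINT x. J s x * sinc (T * (x \<bullet> \<omega>))) = (LBINT \<tau>:{0..T}. Re (fourier (J s) (\<tau> *\<^sub>R \<omega>)))"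
    by (rule set_integral_Re_fourier_ray[OF Js[OF s] T, symmetric])
  also have "\<dots> \<le> (LBINT \<tau>:{0..T}. Re (fourier J1 (\<tau> *\<^sub>R \<omega>)) + ?c)"
  proof (rule set_integral_mono)
    fix \<tau> assume \<tau>: "\<tau> \<in> {0..T}"
    have "Re (fourier (J s) (\<tau> *\<^sub>R \<omega>)) - Re (fourier J1 (\<tau> *\<^sub>R \<omega>)) = Re ((1 - fourier J1 (\<tau> *\<^sub>R \<omega>)) - (1 - fourier (J s) (\<tau> *\<^sub>R \<omega>)))" by simp
    also have "\<dots> \<le> cmod ((1 - fourier (J s) (\<tau> *\<^sub>R \<omega>)) - (1 - fourier J1 (\<tau> *\<^sub>R \<omega>)))"
      using complex_Re_le_cmod by (subst norm_minus_commute) blast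
    also have "\<dots> \<le> Csym * (1 - s) * (\<tau> powr (1 / 2) + \<tau> powr q)"
      using symbol_difference[OF s, of 1 "\<tau> *\<^sub>R \<omega>"] \<tau> w by simp
    also have "\<dots> \<le> ?c"
      using \<tau> s Csym q_bounds by (intro mult_left_mono add_mono powr_mono2) auto
    finally show "Re (fourier (J s) (\<tau> *\<^sub>R \<omega>)) \<le> Re (fourier J1 (\<tau> *\<^sub>R \<omega>)) + ?c" by simp
  qed (use si Js s J1 ci in \<open>auto intro: set_integral_add(1)\<close>)
  also have "\<dots> = (LBINT \<tau>:{0..T}. Re (fourier J1 (\<tau> *\<^sub>R \<omega>))) + (LBINT \<tau>:{0..T}. ?c)"
    by (rule set_integral_add(2)[OF si[OF J1] ci])
  also have "\<dots> = T * ((LBINT x. J1 x * sinc (T * (x \<bullet> \<omega>))) + ?c)"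
    using T unfolding set_integral_Re_fourier_ray[OF J1 T] by (simp add: set_lebesgue_integral_def distrib_left)
  finally show ?thesis using T by simp
qed

text \<open>The kernels \<open>J s\<close> are not assumed to be uniformly regular, so their Fourier transforms
  need not decay uniformly in \<open>s\<close>; only this uniform non-concentration on hyperplanes is inherited
  from the limit kernel.\<close>

lemma uniform_mass_away:
  shows "\<exists>T>0. \<exists>s0<1. 1 / 2 \<le> s0 \<and> (\<forall>\<omega>. norm \<omega> = 1 \<longrightarrow>
      spread J1 T \<omega> \<and>
      (\<forall>s. s0 < s \<and> s < 1 \<longrightarrow> spread (J s) T \<omega>))"
proof -
  obtain T where T: "1 \<le> T" "\<And>\<omega>. norm \<omega> = 1 \<Longrightarrow> (LBINT x. J1 x * sinc (T * (x \<bullet> \<omega>))) \<le> 1 / 8"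
    using uniform_sinc_decay[OF J1, of "1 / 8"] by auto
  define W where "W = Csym * (T powr (1 / 2) + T powr q)"
  have W: "0 < W" unfolding W_def using Csym T by (intro mult_pos_pos add_pos_pos) auto
  \<comment> \<open>Chosen such that the error W (1 - s) is at most 1/8; added to the 1/8 reserved
    for the limit kernel it meets the threshold 1/4 of
    \<open>mass_away_from_hyperplane\<close>.\<close>
  define s0 where "s0 = max (1 / 2) (1 - 1 / (8 * W))"
  have "spread (J s) T \<omega>"
    if s: "s0 < s" "s < 1" and w: "norm \<omega> = 1" for s \<omega>
  proof (rule mass_away_from_hyperplane)
    have s': "1 / 2 < s" "1 - s \<le> 1 / (8 * W)" using s by (auto simp: s0_def)
    show "prob_density (J s)" by (rule Js[OF s'(1) s(2)])
    have "W * (1 - s) \<le> W * (1 / (8 * W))" using W s' by (intro mult_left_mono) auto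
    also have "W * (1 / (8 * W)) = 1 / 8" using W by simp
    also have "W * (1 - s) = Csym * (1 - s) * (T powr (1 / 2) + T powr q)" by (simp only: W_def mult_ac)
    finally have "Csym * (1 - s) * (T powr (1 / 2) + T powr q) \<le> 1 / 8" .
    then show "(LBINT x. J s x * sinc (T * (x \<bullet> \<omega>))) \<le> 1 / 4"
      using sinc_mean_close[OF s'(1) s(2) _ w, of T] T w by fastforce
  qed
  moreover have "spread J1 T \<omega>" if w: "norm \<omega> = 1" for \<omega>
    using T(2)[OF w] by (intro mass_away_from_hyperplane J1) simp
  moreover have "s0 < 1" "1 / 2 \<le> s0" using W by (auto simp: s0_def)
  ultimately show ?thesis using T(1) by (intro exI[of _ T] exI[of _ s0] conjI allI impI) auto
qed

text \<open>Both powers in the symbol estimate are positive, so their integrals along the growing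
  frequency are dominated by the endpoint e^t |\<xi>| and need no factor t. Each contributes 1/a
  \<le> 2, as the exponents a are at least 1/2.\<close>

lemma expo_diff:
  assumes s: "1 / 2 < s" "s < 1" and e: "0 < \<epsilon>" "\<epsilon> \<le> 1" and t: "0 \<le> t" and \<xi>: "\<xi> \<noteq> 0"
  shows "cmod (expo (J s) \<epsilon> s t \<xi> - expo J1 \<epsilon> 1 t \<xi>) \<le> 4 * Csym * (1 - s) * (1 + exp t * norm \<xi>) powr q"
proof -
  define y where "y = norm \<xi>"
  have y: "0 < y" using \<xi> by (simp add: y_def)
  define Y where "Y = exp t * y"
  have Y: "0 < Y" using y by (simp add: Y_def)
  let ?f = "\<lambda>\<tau>. (1 / \<epsilon> powr (2 * s)) *\<^sub>R (1 - fourier (J s) (\<epsilon> *\<^sub>R exp \<tau> *\<^sub>R \<xi>))"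
  let ?g = "\<lambda>\<tau>. (1 / \<epsilon> powr (2 * 1)) *\<^sub>R (1 - fourier J1 (\<epsilon> *\<^sub>R exp \<tau> *\<^sub>R \<xi>))"
  have fi: "?f integrable_on {0..t}" and gi: "?g integrable_on {0..t}"
    by (intro integrable_continuous_real continuous_intros continuous_on_symbol Js s J1)+
  have hi: "((\<lambda>\<tau>. y powr a * exp (a * \<tau>)) has_integral y powr a * (exp (a * t) / a - exp (a * 0) / a)) {0..t}" if a: "0 < a" for a
    using a t by (intro has_integral_mult_right fundamental_theorem_of_calculus)
      (auto intro!: derivative_eq_intros simp: has_real_derivative_iff_has_vector_derivative[symmetric])
  have le: "y powr a * (exp (a * t) / a - exp (a * 0) / a) \<le> 2 * (1 + Y) powr q" if a: "1 / 2 \<le> a" "a \<le> q" for a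
  proof -
    have "y powr a * (exp (a * t) / a - exp (a * 0) / a) \<le> y powr a * (exp (a * t) / a)"
      using a by (intro mult_left_mono) auto
    also have "\<dots> = Y powr a / a" unfolding Y_def powr_mult by (simp add: exp_powr_real mult.commute)
    also have "\<dots> \<le> (1 + Y) powr q / (1 / 2)"
    proof (rule frac_le)
      have "Y powr a \<le> (1 + Y) powr a" using Y a by (intro powr_mono2) auto
      also have "\<dots> \<le> (1 + Y) powr q" using Y a by (intro powr_mono) auto
      finally show "Y powr a \<le> (1 + Y) powr q" .
    qed (use a in auto)
    finally show ?thesis by simp
  qed
  have "cmod (expo (J s) \<epsilon> s t \<xi> - expo J1 \<epsilon> 1 t \<xi>) = cmod (integral {0..t} (\<lambda>\<tau>. ?f \<tau> - ?g \<tau>))"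
    unfolding expo_def by (subst Henstock_Kurzweil_Integration.integral_diff[OF fi gi]) simp
  also have "\<dots> \<le> integral {0..t} (\<lambda>\<tau>. Csym * (1 - s) * (y powr (1 / 2) * exp (1 / 2 * \<tau>) + y powr q * exp (q * \<tau>)))"
  proof (rule integral_norm_bound_integral)
    show "(\<lambda>\<tau>. ?f \<tau> - ?g \<tau>) integrable_on {0..t}" by (rule Henstock_Kurzweil_Integration.integrable_diff[OF fi gi])
    show "(\<lambda>\<tau>. Csym * (1 - s) * (y powr (1 / 2) * exp (1 / 2 * \<tau>) + y powr q * exp (q * \<tau>))) integrable_on {0..t}"
      by (intro integrable_continuous_real continuous_intros)
    show "cmod (?f \<tau> - ?g \<tau>) \<le> Csym * (1 - s) * (y powr (1 / 2) * exp (1 / 2 * \<tau>) + y powr q * exp (q * \<tau>))" for \<tau>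
      using symbol_difference[OF s e, of "exp \<tau> *\<^sub>R \<xi>"]
      by (simp add: y_def powr_mult exp_powr_real mult.commute)
  qed
  also have "\<dots> = Csym * (1 - s) * (y powr (1 / 2) * (exp (1 / 2 * t) / (1 / 2) - exp (1 / 2 * 0) / (1 / 2)) + y powr q * (exp (q * t) / q - exp (q * 0) / q))"
    using q_bounds by (intro integral_unique has_integral_mult_right has_integral_add hi) auto
  also have "\<dots> \<le> Csym * (1 - s) * (2 * (1 + Y) powr q + 2 * (1 + Y) powr q)"
    using Csym s q_bounds by (intro mult_left_mono add_mono le) auto
  finally show ?thesis unfolding Y_def y_def by simp
qed

text \<open>Supplies the hypothesis of \<open>moment_bound\<close> uniformly in \<epsilon> and s:
  scaling cancels \<epsilon>^(2s), and 2s \<ge> 1 \<ge> M allows the exponent to be lowered on the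
  unit ball.\<close>

lemma symbol_bound:
  assumes s: "1 / 2 < s" "s \<le> 1" and e: "0 < \<epsilon>" "\<epsilon> \<le> 1" and M: "0 < M" "M \<le> 1" and K: "prob_density K" and z: "norm \<zeta> \<le> 1"
    and ex: "\<And>\<xi>. norm \<xi> \<le> 1 \<Longrightarrow> cmod (fourier K \<xi> - complex_of_real (1 - norm \<xi> powr (2 * s))) \<le> C0 * norm \<xi> powr (2 * s + \<delta>)"
  shows "1 / \<epsilon> powr (2 * s) * cmod (1 - fourier (rescale \<epsilon> K) \<zeta>) \<le> (1 + C0) * norm \<zeta> powr M"
proof -
  let ?x = "\<epsilon> *\<^sub>R \<zeta>"
  have n: "norm ?x \<le> 1" using e z mult_mono[of \<epsilon> 1 "norm \<zeta>" 1] by simp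
  have "cmod (1 - fourier K ?x) \<le> cmod (complex_of_real (norm ?x powr (2 * s))) + cmod (fourier K ?x - complex_of_real (1 - norm ?x powr (2 * s)))"
    using norm_triangle_ineq4[of "complex_of_real (norm ?x powr (2 * s))" "fourier K ?x - complex_of_real (1 - norm ?x powr (2 * s))"] by simp
  also have "\<dots> \<le> norm ?x powr (2 * s) + C0 * norm ?x powr (2 * s)"
  proof (rule add_mono)
    have "norm ?x powr (2 * s + \<delta>) \<le> norm ?x powr (2 * s)"
      using n d by (cases "?x = 0") (auto intro!: powr_mono')
    then show "cmod (fourier K ?x - complex_of_real (1 - norm ?x powr (2 * s))) \<le> C0 * norm ?x powr (2 * s)"
      using C0 by (intro order_trans[OF ex[OF n]] mult_left_mono) auto
  qed simp
  also have "\<dots> = (1 + C0) * (\<epsilon> powr (2 * s) * norm \<zeta> powr (2 * s))" using e by (simp add: powr_mult distrib_right)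
  finally have "1 / \<epsilon> powr (2 * s) * cmod (1 - fourier K ?x) \<le> 1 / \<epsilon> powr (2 * s) * ((1 + C0) * (\<epsilon> powr (2 * s) * norm \<zeta> powr (2 * s)))"
    by (rule mult_left_mono) simp
  also have "\<dots> = (1 + C0) * norm \<zeta> powr (2 * s)" using e by simp
  also have "\<dots> \<le> (1 + C0) * norm \<zeta> powr M"
    using C0 z M s by (intro mult_left_mono; cases "\<zeta> = 0") (auto intro!: powr_mono')
  finally show ?thesis using e K by (simp add: fourier_rescale prob_densityD)
qed

end

text \<open>For y \<ge> 1, e^t (1 + y)/2 \<le> 1 + e^t y converts the decay into e^(-nt) and leaves
  (1 + y)^(2q), which the Sobolev weight controls; with n = d the factor e^(-nt) is the Jacobian
  needed later. For y < 1 the initial datum enters through the bound \<open>V\<close>, and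
  integrability in the dilated variable comes from (1 + e^t y)^(-2n).\<close>

lemma frequency_weight_le:
  fixes y :: real
  assumes y: "0 \<le> y" and t: "0 \<le> t" and q: "0 < q" "q \<le> \<eta>" and N: "real n \<le> N - q" "1 \<le> n" and v: "0 \<le> v" "v \<le> V"
  shows "v * ((1 + y) powr (2 * N) * (1 + exp t * y) powr (2 * q - 2 * N))
    \<le> 2 powr (2 * N + q) * (exp (- (real n * t)) * ((1 + y\<^sup>2) powr \<eta> * v)) + 2 powr (2 * N) * V * inverse ((1 + exp t * y) ^ (2 * n))"
proof -
  define Y where "Y = exp t * y"
  have Y: "0 \<le> Y" using y by (simp add: Y_def)
  define r where "r = 2 * N - 2 * q"
  have r: "2 * real n \<le> r" "0 < r" "r \<le> 2 * N" using N q by (auto simp: r_def)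
  show ?thesis
  proof (cases "1 \<le> y")
    case True
    have "exp t * ((1 + y) / 2) \<le> exp t * y" using True by (intro mult_left_mono) auto
    then have "exp t * ((1 + y) / 2) \<le> 1 + Y" unfolding Y_def by linarith
    then have "(1 + Y) powr (- r) \<le> (exp t * ((1 + y) / 2)) powr (- r)"
      using r y by (intro powr_mono2') auto
    also have "\<dots> = exp (- (r * t)) * (1 + y) powr (- r) * 2 powr r"
      by (simp only: powr_mult powr_divide exp_powr_real) (simp add: powr_minus divide_inverse mult_ac)
    also have "\<dots> \<le> exp (- (real n * t)) * (1 + y) powr (- r) * 2 powr (2 * N)"
    proof (intro mult_mono powr_mono)
      have "real n * t \<le> r * t" using r t by (intro mult_right_mono) auto
      then show "exp (- (r * t)) \<le> exp (- (real n * t))" by simp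
    qed (use r y in auto)
    finally have "(1 + y) powr (2 * N) * (1 + Y) powr (- r) \<le> (1 + y) powr (2 * N) * (exp (- (real n * t)) * (1 + y) powr (- r) * 2 powr (2 * N))"
      by (rule mult_left_mono) simp
    also have "\<dots> = 2 powr (2 * N) * exp (- (real n * t)) * (1 + y) powr (2 * N + - r)"
      by (simp only: powr_add mult_ac)
    also have "(1 + y) powr (2 * N + - r) = ((1 + y)\<^sup>2) powr q"
      using y by (simp add: r_def powr_power[symmetric] powr_powr[symmetric] powr_numeral)
    also have "((1 + y)\<^sup>2) powr q \<le> (2 * (1 + y\<^sup>2)) powr q"
    proof -
      have "(1 + y)\<^sup>2 \<le> 2 * (1 + y\<^sup>2)" using zero_le_power2[of "1 - y"] by (simp add: power2_eq_square algebra_simps)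
      then show ?thesis using q by (intro powr_mono2) auto
    qed
    also have "\<dots> = 2 powr q * (1 + y\<^sup>2) powr q" by (rule powr_mult)
    also have "\<dots> \<le> 2 powr q * (1 + y\<^sup>2) powr \<eta>" using q by (intro mult_left_mono powr_mono) auto
    finally have "(1 + y) powr (2 * N) * (1 + Y) powr (- r) \<le> 2 powr (2 * N) * exp (- (real n * t)) * (2 powr q * (1 + y\<^sup>2) powr \<eta>)"
      by (simp add: mult_left_mono)
    from mult_left_mono[OF this v(1)]
    have "v * ((1 + y) powr (2 * N) * (1 + Y) powr (- r)) \<le> 2 powr (2 * N + q) * (exp (- (real n * t)) * ((1 + y\<^sup>2) powr \<eta> * v))"
      by (simp only: powr_add mult_ac)
    moreover have "0 \<le> 2 powr (2 * N) * V * inverse ((1 + Y) ^ (2 * n))" using v Y by simp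
    ultimately show ?thesis unfolding Y_def[symmetric] by (simp add: r_def)
  next
    case False
    have "v * ((1 + y) powr (2 * N) * (1 + Y) powr (- r)) \<le> V * (2 powr (2 * N) * (1 + Y) powr (- (2 * real n)))"
      using v y Y False r N q by (intro mult_mono powr_mono powr_mono2) auto
    also have "(1 + Y) powr (- (2 * real n)) = inverse ((1 + Y) ^ (2 * n))"
    proof -
      have "(1 + Y) powr (- (2 * real n)) = inverse ((1 + Y) powr real (2 * n))" by (simp add: powr_minus)
      then show ?thesis using Y by (subst (asm) powr_realpow) auto
    qed
    finally have "v * ((1 + y) powr (2 * N) * (1 + Y) powr (- r)) \<le> 2 powr (2 * N) * V * inverse ((1 + Y) ^ (2 * n))"
      by (simp add: mult_ac)
    moreover have "0 \<le> 2 powr (2 * N + q) * (exp (- (real n * t)) * ((1 + y\<^sup>2) powr \<eta> * v))" using v by simp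
    ultimately show ?thesis unfolding Y_def[symmetric] by (simp add: r_def)
  qed
qed

context kernels
begin

text \<open>The difference of the multipliers is bounded by twice the decay of order N times the
  difference of exponents, of order q. The choice of \<open>N\<close> leaves N - q \<ge> d, exactly
  what \<open>frequency_weight_le\<close> asks for. \<open>Q\<close> comes before \<epsilon>, s and
  t, which is the uniformity required.\<close>

lemma fourier_L2_difference:
  fixes u0 :: "'a \<Rightarrow> real"
  assumes u0: "integrable lborel u0" and \<eta>: "q \<le> \<eta>" and T: "0 < T"
    and H: "integrable lborel (\<lambda>\<xi>. (1 + (norm \<xi>)\<^sup>2) powr \<eta> * (cmod (fourier u0 \<xi>))\<^sup>2)"
    and N: "N = 5 + real DIM('a)"
    and conc1: "\<And>\<omega>. norm \<omega> = 1 \<Longrightarrow> spread J1 T \<omega>"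
  shows "\<exists>Q. \<forall>\<epsilon> s t us u1. 0 < \<epsilon> \<and> \<epsilon> \<le> 1 / (8 * N) \<and> 1 / 2 < s \<and> s < 1 \<and> 0 \<le> t \<and>
      (\<forall>\<omega>. norm \<omega> = 1 \<longrightarrow> spread (J s) T \<omega>) \<and>
      mild (rescale \<epsilon> (J s)) (1 / \<epsilon> powr (2 * s)) u0 us \<and> mild (rescale \<epsilon> J1) (1 / \<epsilon> powr (2 * 1)) u0 u1 \<longrightarrow>
      integrable lborel (\<lambda>\<xi>. (cmod (fourier (\<lambda>x. us t x - u1 t x) \<xi>))\<^sup>2) \<and>
      (LBINT \<xi>. (cmod (fourier (\<lambda>x. us t x - u1 t x) \<xi>))\<^sup>2) \<le> (1 - s)\<^sup>2 * Q"
proof -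
  define Cx where "Cx = exp (N * (1 + ln (max 1 (2 * T) / min 1 ((1 / (2 * C0)) powr (1 / \<delta>))))) * (4 * N) powr N"
  \<comment> \<open>Two propagators, each with constant \<open>Cx\<close>, times the 4
    \<open>Csym\<close> of \<open>expo_diff\<close>.\<close>
  define A where "A = 8 * Csym * Cx"
  define N0 where "N0 = (LBINT x. \<bar>u0 x\<bar>)"
  define c1 where "c1 = 2 powr (2 * N + q)"
  define c2 where "c2 = 2 powr (2 * N) * N0\<^sup>2"
  define G where "G \<xi> = (1 + (norm \<xi>)\<^sup>2) powr \<eta> * (cmod (fourier u0 \<xi>))\<^sup>2" for \<xi> :: 'a
  define R where "R \<xi> = inverse ((1 + norm \<xi>) ^ (2 * DIM('a)))" for \<xi> :: 'a
  define Q where "Q = A\<^sup>2 * (c1 * (LBINT \<xi>. G \<xi>) + c2 * (LBINT \<xi>. R \<xi>))"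
  have N1: "1 \<le> N" unfolding N by simp
  have Cx: "0 < Cx" unfolding Cx_def using N1 by simp
  have "integrable lborel (\<lambda>\<xi>. (cmod (fourier (\<lambda>x. us t x - u1 t x) \<xi>))\<^sup>2) \<and>
      (LBINT \<xi>. (cmod (fourier (\<lambda>x. us t x - u1 t x) \<xi>))\<^sup>2) \<le> (1 - s)\<^sup>2 * Q"
    if e: "0 < \<epsilon>" "\<epsilon> \<le> 1 / (8 * N)" and s: "1 / 2 < s" "s < 1" and t: "0 \<le> t"
      and conc: "\<And>\<omega>. norm \<omega> = 1 \<Longrightarrow> spread (J s) T \<omega>"
      and us: "mild (rescale \<epsilon> (J s)) (1 / \<epsilon> powr (2 * s)) u0 us"
      and u1: "mild (rescale \<epsilon> J1) (1 / \<epsilon> powr (2 * 1)) u0 u1" for \<epsilon> s t us u1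
  proof -
    interpret us: mild "rescale \<epsilon> (J s)" "1 / \<epsilon> powr (2 * s)" u0 us by (rule us)
    interpret u1: mild "rescale \<epsilon> J1" "1 / \<epsilon> powr (2 * 1)" u0 u1 by (rule u1)
    have e1: "\<epsilon> \<le> 1" using e N1 by (auto intro: order_trans simp: divide_le_eq_1)
    define F where "F = fourier (\<lambda>x. us t x - u1 t x)"
    have Fi: "integrable lborel (\<lambda>x. us t x - u1 t x)" using us.int[OF t] u1.int[OF t] by simp
    have [measurable]: "F \<in> borel_measurable borel" unfolding F_def by (rule measurable_fourier[OF Fi])
    have F: "F (exp t *\<^sub>R \<xi>) = fourier u0 \<xi> * (exp (- expo (J s) \<epsilon> s t \<xi>) - exp (- expo J1 \<epsilon> 1 t \<xi>))" for \<xi>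
    proof -
      have "fourier (us t) (exp t *\<^sub>R \<xi>) = fourier u0 \<xi> * exp (- expo (J s) \<epsilon> s t \<xi>)"
        using us.fourier_eq[OF t, of \<xi>] unfolding expo_def fourier_rescale[OF prob_densityD(1)[OF Js[OF s]] e(1)] .
      moreover have "fourier (u1 t) (exp t *\<^sub>R \<xi>) = fourier u0 \<xi> * exp (- expo J1 \<epsilon> 1 t \<xi>)"
        using u1.fourier_eq[OF t, of \<xi>] unfolding expo_def fourier_rescale[OF prob_densityD(1)[OF J1] e(1)] .
      ultimately show ?thesis unfolding F_def fourier_diff[OF us.int[OF t] u1.int[OF t]] by (simp add: right_diff_distrib)
    qed
    have pt: "(cmod (F (exp t *\<^sub>R \<xi>)))\<^sup>2 \<le> (1 - s)\<^sup>2 * A\<^sup>2 * (c1 * (exp (- (real DIM('a) * t)) * G \<xi>) + c2 * R (exp t *\<^sub>R \<xi>))" for \<xi>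
    proof (cases "\<xi> = 0")
      case True
      have "expo (J s) \<epsilon> s t 0 = 0" "expo J1 \<epsilon> 1 t 0 = 0"
        unfolding expo_def using fourier_0[OF Js[OF s]] fourier_0[OF J1] by simp_all
      then have "F (exp t *\<^sub>R \<xi>) = 0" using F[of \<xi>] True by simp
      then show ?thesis by (simp add: G_def R_def c1_def c2_def)
    next
      case False
      define y where "y = norm \<xi>"
      define Y where "Y = exp t * y"
      have y: "0 \<le> y" "0 \<le> Y" by (auto simp: y_def Y_def)
      have E: "exp (- Re (expo (J s) \<epsilon> s t \<xi>)) \<le> Cx * ((1 + y) / (1 + Y)) powr N"
        unfolding Cx_def y_def Y_def by (rule exp_expo_le[OF Js[OF s] s(1) C0 d N1 e T t False exJ[OF s] conc])
      have E1: "exp (- Re (expo J1 \<epsilon> 1 t \<xi>)) \<le> Cx * ((1 + y) / (1 + Y)) powr N"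
        unfolding Cx_def y_def Y_def by (rule exp_expo_le[OF J1 _ C0 d N1 e T t False exJ1' conc1]) auto
      have "cmod (exp (- expo (J s) \<epsilon> s t \<xi>) - exp (- expo J1 \<epsilon> 1 t \<xi>))
         \<le> (exp (- Re (expo (J s) \<epsilon> s t \<xi>)) + exp (- Re (expo J1 \<epsilon> 1 t \<xi>))) * cmod (expo (J s) \<epsilon> s t \<xi> - expo J1 \<epsilon> 1 t \<xi>)"
        by (rule cmod_exp_diff_le)
      also have "\<dots> \<le> (Cx * ((1 + y) / (1 + Y)) powr N + Cx * ((1 + y) / (1 + Y)) powr N) * (4 * Csym * (1 - s) * (1 + Y) powr q)"
        using E E1 expo_diff[OF s e(1) e1 t False] Cx unfolding y_def[symmetric] Y_def[symmetric] by (intro mult_mono add_mono) auto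
      also have "\<dots> = A * (1 - s) * ((1 + y) powr N * (1 + Y) powr (q - N))"
        using y by (simp add: A_def powr_divide powr_diff)
      finally have "cmod (F (exp t *\<^sub>R \<xi>)) \<le> cmod (fourier u0 \<xi>) * (A * (1 - s) * ((1 + y) powr N * (1 + Y) powr (q - N)))"
        unfolding F norm_mult by (rule mult_left_mono) simp
      then have "(cmod (F (exp t *\<^sub>R \<xi>)))\<^sup>2 \<le> (cmod (fourier u0 \<xi>) * (A * (1 - s) * ((1 + y) powr N * (1 + Y) powr (q - N))))\<^sup>2"
        by (rule power_mono) simp
      also have "\<dots> = (1 - s)\<^sup>2 * A\<^sup>2 * ((cmod (fourier u0 \<xi>))\<^sup>2 * (((1 + y) powr N)\<^sup>2 * ((1 + Y) powr (q - N))\<^sup>2))"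
        by (simp only: power_mult_distrib mult_ac)
      also have "((1 + y) powr N)\<^sup>2 = (1 + y) powr (2 * N)" by (simp add: power2_eq_square powr_add[symmetric])
      also have "((1 + Y) powr (q - N))\<^sup>2 = (1 + exp t * y) powr (2 * q - 2 * N)"
        unfolding Y_def by (simp add: power2_eq_square powr_add[symmetric])
      also have "(1 - s)\<^sup>2 * A\<^sup>2 * ((cmod (fourier u0 \<xi>))\<^sup>2 * ((1 + y) powr (2 * N) * (1 + exp t * y) powr (2 * q - 2 * N)))
        \<le> (1 - s)\<^sup>2 * A\<^sup>2 * (2 powr (2 * N + q) * (exp (- (real DIM('a) * t)) * ((1 + y\<^sup>2) powr \<eta> * (cmod (fourier u0 \<xi>))\<^sup>2))
           + 2 powr (2 * N) * N0\<^sup>2 * inverse ((1 + exp t * y) ^ (2 * DIM('a))))"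
        using y q_bounds \<eta> t N norm_fourier_le[of u0 \<xi>]
        by (intro mult_left_mono frequency_weight_le) (auto simp: N0_def intro!: power_mono DIM_positive[unfolded Suc_le_eq[symmetric] One_nat_def[symmetric]])
      finally show ?thesis by (simp add: c1_def c2_def G_def R_def y_def Y_def)
    qed
    \<comment> \<open>Solutions are known at e^t \<xi>; this rewrites the bound in the frequency at
      time t.\<close>
    have pt': "(cmod (F \<xi>))\<^sup>2 \<le> (1 - s)\<^sup>2 * A\<^sup>2 * (c1 * (exp (- (real DIM('a) * t)) * G (exp (- t) *\<^sub>R \<xi>)) + c2 * R \<xi>)" for \<xi>
      using pt[of "exp (- t) *\<^sub>R \<xi>"] by (simp add: exp_minus)
    have Gi: "integrable lborel G" using H unfolding G_def[abs_def] .
    then have [measurable]: "G \<in> borel_measurable borel" by (auto dest: borel_measurable_integrable)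
    have Ri: "integrable lborel R" unfolding R_def[abs_def] by (rule integrable_inverse_1_plus_norm_power)
    have Gs: "integrable lborel (\<lambda>\<xi>. G (exp (- t) *\<^sub>R \<xi>))" using integrable_lborel_affine[OF Gi, of "exp (- t)" 0] by simp
    \<comment> \<open>The factor e^(-dt) kept in the pointwise bound cancels the Jacobian of the
      dilation, so the integral is independent of t.\<close>
    have "\<bar>exp (- t)\<bar> ^ DIM('a) = exp (- (real DIM('a) * t))" by (simp add: exp_of_nat_mult[symmetric])
    then have Gt: "exp (- (real DIM('a) * t)) * (LBINT \<xi>. G (exp (- t) *\<^sub>R \<xi>)) = (LBINT \<xi>. G \<xi>)"
      by (subst integral_lborel_affine[of G "exp (- t)" 0]) auto
    have mi: "integrable lborel (\<lambda>\<xi>. (1 - s)\<^sup>2 * A\<^sup>2 * (c1 * (exp (- (real DIM('a) * t)) * G (exp (- t) *\<^sub>R \<xi>)) + c2 * R \<xi>))"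
      by (intro integrable_mult_right Bochner_Integration.integrable_add Gs Ri)
    have Fint: "integrable lborel (\<lambda>\<xi>. (cmod (F \<xi>))\<^sup>2)"
      by (rule Bochner_Integration.integrable_bound[OF mi]) (use pt' in \<open>auto intro!: AE_I2 order_trans[OF _ abs_ge_self]\<close>)
    have "(LBINT \<xi>. (cmod (F \<xi>))\<^sup>2) \<le> (LBINT \<xi>. (1 - s)\<^sup>2 * A\<^sup>2 * (c1 * (exp (- (real DIM('a) * t)) * G (exp (- t) *\<^sub>R \<xi>)) + c2 * R \<xi>))"
      by (rule integral_mono[OF Fint mi pt'])
    also have "\<dots> = (1 - s)\<^sup>2 * A\<^sup>2 * (c1 * (exp (- (real DIM('a) * t)) * (LBINT \<xi>. G (exp (- t) *\<^sub>R \<xi>))) + c2 * (LBINT \<xi>. R \<xi>))"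
      using Gs Ri by simp
    also have "\<dots> = (1 - s)\<^sup>2 * Q" unfolding Gt Q_def by (simp add: mult.assoc)
    finally show ?thesis using Fint unfolding F_def by simp
  qed
  then show ?thesis by (intro exI[of _ Q]) blast
qed

end

section \<open>From the Fourier estimate to the weighted L^1 estimate\<close>

lemma L1w_diff:
  fixes f g :: "'a::euclidean_space \<Rightarrow> real"
  assumes "L1w m f" "L1w m g"
  shows "L1w m (\<lambda>x. f x - g x)" "L1w_norm m (\<lambda>x. f x - g x) \<le> L1w_norm m f + L1w_norm m g"
proof -
  have [measurable]: "f \<in> borel_measurable borel" "g \<in> borel_measurable borel" using assms by (auto simp: L1w_def)
  have i: "integrable lborel (\<lambda>x. jbr x powr m * \<bar>f x\<bar>)" "integrable lborel (\<lambda>x. jbr x powr m * \<bar>g x\<bar>)"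
    using assms by (auto simp: L1w_def)
  have le: "jbr x powr m * \<bar>f x - g x\<bar> \<le> jbr x powr m * \<bar>f x\<bar> + jbr x powr m * \<bar>g x\<bar>" for x
    unfolding distrib_left[symmetric] by (intro mult_left_mono abs_triangle_ineq4) auto
  have id: "integrable lborel (\<lambda>x. jbr x powr m * \<bar>f x - g x\<bar>)"
    by (rule Bochner_Integration.integrable_bound[OF Bochner_Integration.integrable_add[OF i]])
       (use le in \<open>auto intro!: AE_I2 order_trans[OF _ abs_ge_self] simp: abs_mult\<close>)
  then show "L1w m (\<lambda>x. f x - g x)" unfolding L1w_def by simp
  show "L1w_norm m (\<lambda>x. f x - g x) \<le> L1w_norm m f + L1w_norm m g"
    unfolding L1w_norm_def Bochner_Integration.integral_add[OF i, symmetric]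
    by (rule integral_mono[OF id Bochner_Integration.integrable_add[OF i] le])
qed

lemma L1w_norm_mono:
  fixes f :: "'a::euclidean_space \<Rightarrow> real"
  assumes "L1w m f" "k \<le> m"
  shows "L1w_norm k f \<le> L1w_norm m f"
  unfolding L1w_norm_def
proof (rule integral_mono_AE')
  show "AE x in lborel. jbr x powr k * \<bar>f x\<bar> \<le> jbr x powr m * \<bar>f x\<bar>"
    using assms(2) jbr_ge_1 by (intro AE_I2 mult_right_mono powr_mono) auto
qed (use assms in \<open>auto simp: L1w_def\<close>)

theorem theorem1p5:
  shows "\<exists>\<epsilon>max>0. \<forall>(J :: real \<Rightarrow> 'a::euclidean_space \<Rightarrow> real) J1 \<delta> C0.
     H1 J \<delta> C0 \<and> H2 J J1 \<delta> C0 \<longrightarrow>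
     (\<forall>k m M \<eta> u0. 0 < k \<and> k < 1 \<and> k < m \<and> m < M \<and> M \<le> 1 \<and> 2 + \<delta> < \<eta> \<and>
        sobolev_H \<eta> u0 \<and> L1w M u0 \<longrightarrow>
        (\<exists>C. \<forall>\<epsilon> s us u1. 0 < \<epsilon> \<and> \<epsilon> \<le> \<epsilon>max \<and> 1/2 < s \<and> s < 1 \<and>
            mild_solution k (J s) \<epsilon> s u0 us \<and> mild_solution k J1 \<epsilon> 1 u0 u1 \<longrightarrow>
            (\<forall>t>0. L1w_norm k (\<lambda>x. us t x - u1 t x)
                \<le> C * (1 - s) powr ((m - k) / (m + real DIM('a) / 2))
                    * (1 + \<epsilon> powr ((m - k) / (m + real DIM('a) / 2) * \<delta>) * \<bar>ln \<epsilon>\<bar>))))"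
proof -
  \<comment> \<open>The 5 bounds \<open>q\<close> for every admissible \<delta>, so \<epsilon>max =
    1/(8N) depends on the dimension alone.\<close>
  define N where "N = 5 + real DIM('a)"
  have N1: "1 \<le> N" unfolding N_def by simp
  have main: "\<exists>C. \<forall>\<epsilon> s us u1. 0 < \<epsilon> \<and> \<epsilon> \<le> 1 / (8 * N) \<and> 1/2 < s \<and> s < 1 \<and>
            mild_solution k (J s) \<epsilon> s u0 us \<and> mild_solution k J1 \<epsilon> 1 u0 u1 \<longrightarrow>
            (\<forall>t>0. L1w_norm k (\<lambda>x. us t x - u1 t x)
                \<le> C * (1 - s) powr ((m - k) / (m + real DIM('a) / 2))
                    * (1 + \<epsilon> powr ((m - k) / (m + real DIM('a) / 2) * \<delta>) * \<bar>ln \<epsilon>\<bar>))"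
    if H1: "H1 J \<delta> C0" and H2: "H2 J J1 \<delta> C0" and k: "0 < k" "k < m" and mM: "m < M" "M \<le> 1" and \<eta>: "2 + \<delta> < \<eta>"
      and u0H: "sobolev_H \<eta> u0" and u0M: "L1w M u0"
    for J :: "real \<Rightarrow> 'a \<Rightarrow> real" and J1 \<delta> C0 k m M \<eta> u0
  proof -
    obtain CC where CC: "0 < CC" and close: "\<And>s \<xi>. s \<in> {1/2<..<1} \<Longrightarrow> \<xi> \<noteq> 0 \<Longrightarrow>
        cmod ((1 - fourier (J s) \<xi>) / complex_of_real (norm \<xi> powr (2 * s))
              - (1 - fourier J1 \<xi>) / complex_of_real ((norm \<xi>)\<^sup>2))
        \<le> CC * (1 - s) * norm \<xi> powr \<delta> * max 1 \<bar>ln (norm \<xi>)\<bar>"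
      using H2 unfolding H2_def by blast
    \<comment> \<open>The strict inequality 2 + \<delta> < \<eta> makes this positive, and then q
      \<le> \<eta>.\<close>
    define \<kappa> where "\<kappa> = min 1 (\<eta> - 2 - \<delta>)"
    have \<kappa>: "0 < \<kappa>" "\<kappa> \<le> 1" "2 + \<delta> + \<kappa> \<le> \<eta>" using \<eta> by (auto simp: \<kappa>_def)
    interpret kernels J J1 \<delta> C0 CC \<kappa>
      by unfold_locales (use H1 H2 CC \<kappa> close in \<open>auto simp: H1_def H2_def\<close>)
    have M0: "0 < M" using k mM by simp
    have u0i: "integrable lborel u0" using L1w_imp_integrable(1)[OF u0M] M0 by simp
    obtain T s0 where T: "0 < T" and s0: "s0 < 1" "1 / 2 \<le> s0"
      and conc1: "\<And>\<omega>. norm \<omega> = 1 \<Longrightarrow> spread J1 T \<omega>"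
      and conc: "\<And>\<omega> s. norm \<omega> = 1 \<Longrightarrow> s0 < s \<Longrightarrow> s < 1 \<Longrightarrow> spread (J s) T \<omega>"
      using uniform_mass_away by blast
    have "m < M" "0 < m" using k mM by auto
    then obtain B where B: "\<And>K lam u t. mild K lam u0 u \<Longrightarrow>
        (\<And>\<zeta>. norm \<zeta> \<le> 1 \<Longrightarrow> lam * cmod (1 - fourier K \<zeta>) \<le> (1 + C0) * norm \<zeta> powr M) \<Longrightarrow> 0 \<le> t \<Longrightarrow>
        L1w m (u t) \<and> L1w_norm m (u t) \<le> B"
      using moment_bound[of m M u0 "1 + C0"] mM u0M by metis
    have "integrable lborel (\<lambda>\<xi>. (1 + (norm \<xi>)\<^sup>2) powr \<eta> * (cmod (fourier u0 \<xi>))\<^sup>2)" using u0H by (simp add: sobolev_H_def)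
    from fourier_L2_difference[OF u0i _ T this N_def conc1] \<kappa>(3)
    obtain Q where Q: "\<And>\<epsilon> s t us u1. 0 < \<epsilon> \<Longrightarrow> \<epsilon> \<le> 1 / (8 * N) \<Longrightarrow> 1 / 2 < s \<Longrightarrow> s < 1 \<Longrightarrow> 0 \<le> t \<Longrightarrow>
      (\<forall>\<omega>. norm \<omega> = 1 \<longrightarrow> spread (J s) T \<omega>) \<Longrightarrow>
      mild (rescale \<epsilon> (J s)) (1 / \<epsilon> powr (2 * s)) u0 us \<Longrightarrow> mild (rescale \<epsilon> J1) (1 / \<epsilon> powr (2 * 1)) u0 u1 \<Longrightarrow>
      integrable lborel (\<lambda>\<xi>. (cmod (fourier (\<lambda>x. us t x - u1 t x) \<xi>))\<^sup>2) \<and>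
      (LBINT \<xi>. (cmod (fourier (\<lambda>x. us t x - u1 t x) \<xi>))\<^sup>2) \<le> (1 - s)\<^sup>2 * Q"
      unfolding q_def by blast
    define \<theta> where "\<theta> = (m - k) / (m + real DIM('a) / 2)"
    have \<theta>: "0 \<le> \<theta>" using k by (auto simp: \<theta>_def)
    define Ca where "Ca = 2 powr k * ((Q + unit_ball_vol (real DIM('a))) / 2) + (B + B)"
    \<comment> \<open>For s \<le> s0 the quantity (1 - s)^\<theta> is at least (1 - s0)^\<theta>, so
      dividing the moment bound by the latter turns it into a rate.\<close>
    define Cb where "Cb = (B + B) / (1 - s0) powr \<theta>"
    define C where "C = max 0 (max Ca Cb)"
    have "L1w_norm k (\<lambda>x. us t x - u1 t x) \<le> C * (1 - s) powr \<theta> * (1 + \<epsilon> powr (\<theta> * \<delta>) * \<bar>ln \<epsilon>\<bar>)"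
      if e: "0 < \<epsilon>" "\<epsilon> \<le> 1 / (8 * N)" and s: "1 / 2 < s" "s < 1"
        and us: "mild_solution k (J s) \<epsilon> s u0 us" and u1: "mild_solution k J1 \<epsilon> 1 u0 u1" and t: "0 < t" for \<epsilon> s us u1 t
    proof -
      have e1: "\<epsilon> \<le> 1" using e N1 by (auto intro: order_trans simp: divide_le_eq_1)
      have ms: "mild (rescale \<epsilon> (J s)) (1 / \<epsilon> powr (2 * s)) u0 us"
        using k by (intro mild_solution_imp_mild[OF _ Js[OF s] e(1) u0i us]) simp
      have m1: "mild (rescale \<epsilon> J1) (1 / \<epsilon> powr (2 * 1)) u0 u1"
        using k by (intro mild_solution_imp_mild[OF _ J1 e(1) u0i u1]) simp
      have Bs: "L1w m (us t) \<and> L1w_norm m (us t) \<le> B"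
        by (rule B[OF ms symbol_bound[OF _ _ e(1) e1 M0 mM(2) Js[OF s]]]) (use s t exJ[OF s] in auto)
      have B1: "L1w m (u1 t) \<and> L1w_norm m (u1 t) \<le> B"
        by (rule B[OF m1 symbol_bound[OF _ _ e(1) e1 M0 mM(2) J1 _ exJ1']]) (use t in auto)
      let ?f = "\<lambda>x. us t x - u1 t x"
      have f: "L1w m ?f" "L1w_norm m ?f \<le> B + B" using L1w_diff[of m "us t" "u1 t"] Bs B1 by auto
      have "L1w_norm k ?f \<le> C * (1 - s) powr \<theta>"
      proof (cases "s0 < s")
        case True
        have "integrable lborel (\<lambda>\<xi>. (cmod (fourier ?f \<xi>))\<^sup>2) \<and> (LBINT \<xi>. (cmod (fourier ?f \<xi>))\<^sup>2) \<le> (1 - s)\<^sup>2 * Q"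
          using t conc True s by (intro Q[OF e s _ _ ms m1]) auto
        \<comment> \<open>Interpolation with h = 1 - s; the moment of the difference is at most B +
          B.\<close>
        then have "L1w_norm k ?f \<le> Ca * (1 - s) powr \<theta>"
          unfolding Ca_def \<theta>_def using k s by (intro interpolation f) auto
        also have "\<dots> \<le> C * (1 - s) powr \<theta>" by (intro mult_right_mono) (auto simp: C_def)
        finally show ?thesis .
      next
        case False
        have "(1 - s0) powr \<theta> \<le> (1 - s) powr \<theta>" using False s0 \<theta> by (intro powr_mono2) auto
        moreover have "0 \<le> B + B" using order_trans[OF _ f(2)] unfolding L1w_norm_def by (simp add: Bochner_Integration.integral_nonneg)
        ultimately have "(B + B) * 1 \<le> (B + B) * ((1 - s) powr \<theta> / (1 - s0) powr \<theta>)"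
          using s0 by (intro mult_left_mono) auto
        then have "B + B \<le> Cb * (1 - s) powr \<theta>" by (simp add: Cb_def)
        moreover have "L1w_norm k ?f \<le> B + B" using k by (intro order_trans[OF L1w_norm_mono[OF f(1)] f(2)]) simp
        ultimately have "L1w_norm k ?f \<le> Cb * (1 - s) powr \<theta>" by linarith
        also have "\<dots> \<le> C * (1 - s) powr \<theta>" by (intro mult_right_mono) (auto simp: C_def)
        finally show ?thesis .
      qed
      \<comment> \<open>The bound obtained so far is uniform in \<epsilon>, and the last factor is
        at least 1.\<close>
      also have "\<dots> \<le> C * (1 - s) powr \<theta> * (1 + \<epsilon> powr (\<theta> * \<delta>) * \<bar>ln \<epsilon>\<bar>)"
      proof -
        have "0 \<le> C * (1 - s) powr \<theta>" by (simp add: C_def)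
        from mult_left_mono[OF _ this, of 1 "1 + \<epsilon> powr (\<theta> * \<delta>) * \<bar>ln \<epsilon>\<bar>"] show ?thesis by simp
      qed
      finally show ?thesis .
    qed
    then show ?thesis unfolding \<theta>_def by blast
  qed
  have "0 < 1 / (8 * N)" using N1 by simp
  then show ?thesis using main by blast
qed

end
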